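(* It is undecidable, given an automatic relation $R\subseteq\Sigma^*\times\Gamma^*$ and a regular control language $L\subseteq\{1,2\}^*$, whether there exists an $L$-controlled subsequential transducer that uniformizes $R$.
   Context: $\Sigma,\Gamma$ are disjoint finite alphabets. For $w\in(\Sigma\cup\Gamma)^*$, $\llbracket w\rrbracket=(\pi_{\mathtt i}(w),\pi_{\mathtt o}(w))$ where $\pi_{\mathtt i}$ (resp. $\pi_{\mathtt o}$) deletes all letters of $\Gamma$ (resp. $\Sigma$). A relation is automatic if it equals $\{\llbracket w\rrbracket:w\in S\}$ for some regular $S\subseteq(\Sigma\Gamma)^*(\Sigma^*+\Gamma^* )$. A subsequential transducer $\mathcal T$ has finite state set $Q$, initial state $q_0$, partial transition function $Q\times\Sigma\to\Gamma^*\times Q$, final states $F$, final output function $f:F\to\Gamma^*$; a run $q_0\xrightarrow{a_1|v_1}p_1\cdots\xrightarrow{a_n|v_n}p_n$, $p_n\in F$, maps $a_1\cdots a_n$ to $v_1\cdots v_nf(p_n)$ and contributes $a_1v_1\cdots a_nv_nf(p_n)$ to its synchronization language $S(\mathcal T)$. Let $h$ be the morphism $(\Sigma\cup\Gamma)^*\to\{1,2\}^*$ mapping each letter of $\Sigma$ to $1$ and each letter of $\Gamma$ to $2$. $\mathcal T$ is $L$-controlled if $h(S(\mathcal T))\subseteq L$. $\mathcal T$ uniformizes $R$ if the function it computes is defined exactly on $\mathrm{dom}(R)$ and maps each $u$ to some $v$ with $(u,v)\in R$. *)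

theory Defs
  imports Main "HOL-Library.Nat_Bijection"
begin

datatype recf = Zero | Succ | Proj nat | Comp recf "recf list" | Prim recf recf | Mn recf

inductive eval :: "recf \<Rightarrow> nat list \<Rightarrow> nat \<Rightarrow> bool" where
  eval_zero: "eval Zero xs 0"
| eval_succ: "eval Succ (x # xs) (Suc x)"
| eval_proj: "i < length xs \<Longrightarrow> eval (Proj i) xs (xs ! i)"
| eval_comp: "list_all2 (\<lambda>g y. eval g xs y) gs ys \<Longrightarrow> eval f ys z \<Longrightarrow> eval (Comp f gs) xs z"
| eval_prim0: "eval f xs y \<Longrightarrow> eval (Prim f g) (0 # xs) y"
| eval_primS: "eval (Prim f g) (n # xs) y \<Longrightarrow> eval g (y # n # xs) z \<Longrightarrow> eval (Prim f g) (Suc n # xs) z"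
| eval_mn: "eval f (n # xs) 0 \<Longrightarrow> (\<forall>m<n. \<exists>y. eval f (m # xs) (Suc y)) \<Longrightarrow> eval (Mn f) xs n"

definition decidable_on :: "('x \<Rightarrow> nat) \<Rightarrow> ('x \<Rightarrow> bool) \<Rightarrow> ('x \<Rightarrow> bool) \<Rightarrow> bool" where
  "decidable_on enc valid P \<longleftrightarrow>
     (\<exists>f. \<forall>x. valid x \<longrightarrow> eval f [enc x] (if P x then 1 else 0))"

text \<open>An NFA: list of initial states, list of transitions (p, a, q), list of final states.\<close>
type_synonym nfa = "nat list \<times> (nat \<times> nat \<times> nat) list \<times> nat list"

definition nfa_step :: "nfa \<Rightarrow> nat set \<Rightarrow> nat \<Rightarrow> nat set" where
  "nfa_step A P a = {q. \<exists>p\<in>P. (p, a, q) \<in> set (fst (snd A))}"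

fun nfa_run :: "nfa \<Rightarrow> nat set \<Rightarrow> nat list \<Rightarrow> nat set" where
  "nfa_run A P [] = P"
| "nfa_run A P (a # w) = nfa_run A (nfa_step A P a) w"

definition nfa_lang :: "nfa \<Rightarrow> nat list set" where
  "nfa_lang A = {w. nfa_run A (set (fst A)) w \<inter> set (snd (snd A)) \<noteq> {}}"

definition enc_nfa :: "nfa \<Rightarrow> nat" where
  "enc_nfa A = list_encode [list_encode (fst A),
      list_encode (map (\<lambda>(p, a, q). prod_encode (p, prod_encode (a, q))) (fst (snd A))),
      list_encode (snd (snd A))]"

text \<open>Alphabets are finite sets of natural numbers, given as lists.\<close>

definition in_sync_shape :: "nat set \<Rightarrow> nat set \<Rightarrow> nat list \<Rightarrow> bool" where
  "in_sync_shape \<Sigma> \<Gamma> w \<longleftrightarrow>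
     (\<exists>ps t. w = concat (map (\<lambda>(a, b). [a, b]) ps) @ t
        \<and> (\<forall>(a, b)\<in>set ps. a \<in> \<Sigma> \<and> b \<in> \<Gamma>)
        \<and> (set t \<subseteq> \<Sigma> \<or> set t \<subseteq> \<Gamma>))"

definition pi_i :: "nat set \<Rightarrow> nat list \<Rightarrow> nat list" where
  "pi_i \<Gamma> w = filter (\<lambda>x. x \<notin> \<Gamma>) w"

definition pi_o :: "nat set \<Rightarrow> nat list \<Rightarrow> nat list" where
  "pi_o \<Sigma> w = filter (\<lambda>x. x \<notin> \<Sigma>) w"

definition sem :: "nat set \<Rightarrow> nat set \<Rightarrow> nat list \<Rightarrow> nat list \<times> nat list" where
  "sem \<Sigma> \<Gamma> w = (pi_i \<Gamma> w, pi_o \<Sigma> w)"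

text \<open>The automatic relation presented by a regular S \<subseteq> (\<Sigma>\<Gamma>)*(\<Sigma>* + \<Gamma>*).\<close>
definition rel_of :: "nat set \<Rightarrow> nat set \<Rightarrow> nat list set \<Rightarrow> (nat list \<times> nat list) set" where
  "rel_of \<Sigma> \<Gamma> S = sem \<Sigma> \<Gamma> ` S"

definition hmor :: "nat set \<Rightarrow> nat list \<Rightarrow> nat list" where
  "hmor \<Sigma> w = map (\<lambda>x. if x \<in> \<Sigma> then 1 else 2) w"

text \<open>(Q, q0, delta, F, f): finite state set, initial state, partial transition function,
  final states, final output function.\<close>
type_synonym sst = "nat set \<times> nat \<times> (nat \<Rightarrow> nat \<Rightarrow> (nat list \<times> nat) option) \<times> nat set \<times> (nat \<Rightarrow> nat list)"

definition sst_wf :: "nat set \<Rightarrow> nat set \<Rightarrow> sst \<Rightarrow> bool" where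
  "sst_wf \<Sigma> \<Gamma> T = (case T of (Q, q0, \<delta>, F, f) \<Rightarrow>
     finite Q \<and> q0 \<in> Q \<and> F \<subseteq> Q
     \<and> (\<forall>q a v p. \<delta> q a = Some (v, p) \<longrightarrow> q \<in> Q \<and> a \<in> \<Sigma> \<and> set v \<subseteq> \<Gamma> \<and> p \<in> Q)
     \<and> (\<forall>q\<in>F. set (f q) \<subseteq> \<Gamma>))"

fun run_out :: "(nat \<Rightarrow> nat \<Rightarrow> (nat list \<times> nat) option) \<Rightarrow> nat \<Rightarrow> nat list \<Rightarrow> (nat list \<times> nat) option" where
  "run_out \<delta> q [] = Some ([], q)"
| "run_out \<delta> q (a # w) = (case \<delta> q a of None \<Rightarrow> None
     | Some (v, p) \<Rightarrow> (case run_out \<delta> p w of None \<Rightarrow> None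
        | Some (s, r) \<Rightarrow> Some (v @ s, r)))"

fun run_sync :: "(nat \<Rightarrow> nat \<Rightarrow> (nat list \<times> nat) option) \<Rightarrow> nat \<Rightarrow> nat list \<Rightarrow> (nat list \<times> nat) option" where
  "run_sync \<delta> q [] = Some ([], q)"
| "run_sync \<delta> q (a # w) = (case \<delta> q a of None \<Rightarrow> None
     | Some (v, p) \<Rightarrow> (case run_sync \<delta> p w of None \<Rightarrow> None
        | Some (s, r) \<Rightarrow> Some (a # v @ s, r)))"

definition sst_fun :: "sst \<Rightarrow> nat list \<Rightarrow> nat list option" where
  "sst_fun T u = (case T of (Q, q0, \<delta>, F, f) \<Rightarrow>
     (case run_out \<delta> q0 u of None \<Rightarrow> None
      | Some (v, p) \<Rightarrow> if p \<in> F then Some (v @ f p) else None))"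

definition sst_sync :: "sst \<Rightarrow> nat list set" where
  "sst_sync T = (case T of (Q, q0, \<delta>, F, f) \<Rightarrow>
     {s @ f p | u s p. run_sync \<delta> q0 u = Some (s, p) \<and> p \<in> F})"

definition controlled :: "nat set \<Rightarrow> nat list set \<Rightarrow> sst \<Rightarrow> bool" where
  "controlled \<Sigma> L T \<longleftrightarrow> hmor \<Sigma> ` sst_sync T \<subseteq> L"

definition uniformizes :: "sst \<Rightarrow> (nat list \<times> nat list) set \<Rightarrow> bool" where
  "uniformizes T R \<longleftrightarrow> dom (sst_fun T) = Domain R
     \<and> (\<forall>u v. sst_fun T u = Some v \<longrightarrow> (u, v) \<in> R)"

text \<open>An instance: alphabet \<Sigma>, alphabet \<Gamma>, an NFA for S presenting R, an NFA for L.\<close>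
type_synonym uinst = "nat list \<times> nat list \<times> nfa \<times> nfa"

definition valid_instance :: "uinst \<Rightarrow> bool" where
  "valid_instance x = (case x of (sig, gam, A, B) \<Rightarrow>
     set sig \<inter> set gam = {}
     \<and> (\<forall>w\<in>nfa_lang A. in_sync_shape (set sig) (set gam) w)
     \<and> (\<forall>w\<in>nfa_lang B. set w \<subseteq> {1, 2}))"

definition enc_instance :: "uinst \<Rightarrow> nat" where
  "enc_instance x = (case x of (sig, gam, A, B) \<Rightarrow>
     list_encode [list_encode sig, list_encode gam, enc_nfa A, enc_nfa B])"

definition controlled_uniformizable :: "uinst \<Rightarrow> bool" where
  "controlled_uniformizable x = (case x of (sig, gam, A, B) \<Rightarrow>
     \<exists>T. sst_wf (set sig) (set gam) T \<and> controlled (set sig) (nfa_lang B) T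
        \<and> uniformizes T (rel_of (set sig) (set gam) (nfa_lang A)))"

end

(* The reduction is from register programs, into which every recursive function compiles. A transducer
   that obeys the control language 1 2^K (1 2)^* 1^* writes K letters on the first input letter and one on
   each further letter, so its output runs ahead of its input by a lag K of its own choice. Its output is
   read as rows of length K, row t describing the configuration after t steps. The input may contain one
   mark, on which the transducer has to output an end marker and to fall silent, since it cannot know
   whether the input ends there. If the input is then continued to the length of the output, the marked
   position and the end of the output are exactly K apart; the relation can see that the lengths agree,
   and only then insists that the letters above each other fit. Hence a uniformizing transducer has to
   write a correct halting computation, and a finite one can be stored in its states.

   The diagonal argument needs no decoding: only the list T of transitions depends on the program, the
   output alphabet consists of all numbers from 2 to the code c of T plus 1, and the number c itself is
   planted as the input of the program by a chain of c further transitions. *)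

theory Submission
  imports Defs "HOL-Library.Countable"
begin

section \<open>Register programs\<close>

text \<open>An automaton that reads input and output in step cannot know the lag K, which the
  transducer chooses and which must exceed every register value of the computation; it can only
  notice that both words end together. The mark turns this into a test at distance K: the output
  letters next to the mark are stored, and the silence after the mark lets the input catch up. At
  other lengths the distance would not be K and a correct transducer would be rejected, so nothing
  is compared. As nearly all positions of the mark and all continuations are in the domain, one and
  the same output sequence has to survive all tests. Registers are written in unary, by position, so
  that a step changes a row only locally. A mark after a single tick is special: the output is then
  the first K letters and the end marker, so the initial row can be checked against the planted
  number. A decision procedure halts on every valid instance, so the program built from it halts
  too; a uniformizing transducer then exists exactly when its answer is 0, which contradicts the
  answer.\<close>

datatype cmd = Inc nat | Dec nat | While nat "cmd list"

instance cmd :: countable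
  by countable_datatype

text \<open>The list of commands still to be run serves as control state. Unrolling a loop pushes
  its body, so no labels are needed, and a halted configuration is a fixed point.\<close>

fun step :: "cmd list \<times> (nat \<Rightarrow> nat) \<Rightarrow> cmd list \<times> (nat \<Rightarrow> nat)" where
  "step ([], \<rho>) = ([], \<rho>)"
| "step (Inc r # k, \<rho>) = (k, \<rho>(r := Suc (\<rho> r)))"
| "step (Dec r # k, \<rho>) = (k, \<rho>(r := \<rho> r - 1))"
| "step (While r b # k, \<rho>) = (if \<rho> r = 0 then k else b @ While r b # k, \<rho>)"

text \<open>Quantifying over the commands \<open>k\<close> that come afterwards is what makes
  execution compose under concatenation.\<close>

definition exec :: "cmd list \<Rightarrow> (nat \<Rightarrow> nat) \<Rightarrow> (nat \<Rightarrow> nat) \<Rightarrow> bool" where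
  "exec p \<rho> \<rho>' \<longleftrightarrow> (\<forall>k. \<exists>i. (step ^^ i) (p @ k, \<rho>) = (k, \<rho>'))"

lemma exec_Nil: "exec [] \<rho> \<rho>"
  unfolding exec_def by (metis append_Nil funpow_0)

lemma exec_append:
  assumes "exec p \<rho> \<rho>'" "exec q \<rho>' \<rho>''"
  shows "exec (p @ q) \<rho> \<rho>''"
  unfolding exec_def
proof
  fix k
  obtain i j where "(step ^^ i) (p @ (q @ k), \<rho>) = (q @ k, \<rho>')" "(step ^^ j) (q @ k, \<rho>') = (k, \<rho>'')"
    using assms unfolding exec_def by blast
  then have "(step ^^ (j + i)) ((p @ q) @ k, \<rho>) = (k, \<rho>'')"
    by (simp add: funpow_add)
  then show "\<exists>i. (step ^^ i) ((p @ q) @ k, \<rho>) = (k, \<rho>'')" by blast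
qed

lemma exec_Cons: "exec [c] \<rho> \<rho>' \<Longrightarrow> exec q \<rho>' \<rho>'' \<Longrightarrow> exec (c # q) \<rho> \<rho>''"
  using exec_append[of "[c]"] by simp

lemma exec_Inc: "exec [Inc r] \<rho> (\<rho>(r := Suc (\<rho> r)))"
  unfolding exec_def by (intro allI exI[of _ 1]) simp

lemma exec_Dec: "exec [Dec r] \<rho> (\<rho>(r := \<rho> r - 1))"
  unfolding exec_def by (intro allI exI[of _ 1]) simp

lemma exec_While_0: "\<rho> r = 0 \<Longrightarrow> exec [While r b] \<rho> \<rho>"
  unfolding exec_def by (intro allI exI[of _ 1]) simp

lemma exec_While_Suc:
  assumes "\<rho> r \<noteq> 0" "exec b \<rho> \<rho>'" "exec [While r b] \<rho>' \<rho>''"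
  shows "exec [While r b] \<rho> \<rho>''"
  unfolding exec_def
proof
  fix k
  have "exec (b @ [While r b]) \<rho> \<rho>''" using assms exec_append by blast
  then obtain i where "(step ^^ i) (b @ While r b # k, \<rho>) = (k, \<rho>'')"
    unfolding exec_def by auto
  then have "(step ^^ Suc i) (While r b # k, \<rho>) = (k, \<rho>'')"
    using assms(1) by (simp add: funpow_swap1 del: funpow.simps) (simp add: funpow_swap1)
  then show "\<exists>i. (step ^^ i) ([While r b] @ k, \<rho>) = (k, \<rho>'')" by (metis append_Cons append_Nil)
qed

lemma exec_clear: "exec [While r [Dec r]] \<rho> (\<rho>(r := 0))"
proof (induction "\<rho> r" arbitrary: \<rho>)
  case 0
  then show ?case using exec_While_0[of \<rho> r] by (metis fun_upd_triv)
next
  case (Suc m)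
  have "exec [While r [Dec r]] (\<rho>(r := \<rho> r - 1)) (\<rho>(r := 0))"
    using Suc(1)[of "\<rho>(r := \<rho> r - 1)"] Suc(2) by simp
  then show ?case using exec_While_Suc[OF _ exec_Dec] Suc(2) by (metis Zero_not_Suc)
qed

lemma exec_move:
  assumes "r \<noteq> s"
  shows "exec [While r [Dec r, Inc s]] \<rho> (\<rho>(s := \<rho> s + \<rho> r, r := 0))"
proof (induction "\<rho> r" arbitrary: \<rho>)
  case 0
  then have "\<rho>(s := \<rho> s + \<rho> r, r := 0) = \<rho>" by auto
  with 0 show ?case using exec_While_0[of \<rho> r] by simp
next
  case (Suc m)
  let ?\<sigma> = "\<rho>(r := \<rho> r - 1, s := Suc (\<rho> s))"
  have e: "exec [Dec r, Inc s] \<rho> ?\<sigma>"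
    using exec_Cons[OF exec_Dec exec_Inc, of r s \<rho>] assms by simp
  have "?\<sigma>(s := ?\<sigma> s + ?\<sigma> r, r := 0) = \<rho>(s := \<rho> s + \<rho> r, r := 0)"
    using assms Suc(2) by (auto simp: fun_eq_iff)
  then have "exec [While r [Dec r, Inc s]] ?\<sigma> (\<rho>(s := \<rho> s + \<rho> r, r := 0))"
    using Suc(1)[of ?\<sigma>] Suc(2) assms by (metis diff_Suc_1 fun_upd_same fun_upd_other)
  then show ?case using exec_While_Suc[OF _ e] Suc(2) by (metis Zero_not_Suc)
qed

lemma exec_move2:
  assumes "r \<noteq> s" "r \<noteq> t" "s \<noteq> t"
  shows "exec [While r [Dec r, Inc s, Inc t]] \<rho> (\<rho>(s := \<rho> s + \<rho> r, t := \<rho> t + \<rho> r, r := 0))"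
proof (induction "\<rho> r" arbitrary: \<rho>)
  case 0
  then have "\<rho>(s := \<rho> s + \<rho> r, t := \<rho> t + \<rho> r, r := 0) = \<rho>" by auto
  with 0 show ?case using exec_While_0[of \<rho> r] by simp
next
  case (Suc m)
  let ?\<sigma> = "\<rho>(r := \<rho> r - 1, s := Suc (\<rho> s), t := Suc (\<rho> t))"
  have e: "exec [Dec r, Inc s, Inc t] \<rho> ?\<sigma>"
    using exec_Cons[OF exec_Dec exec_Cons[OF exec_Inc exec_Inc], of r s t \<rho>] assms by simp
  have "?\<sigma>(s := ?\<sigma> s + ?\<sigma> r, t := ?\<sigma> t + ?\<sigma> r, r := 0) = \<rho>(s := \<rho> s + \<rho> r, t := \<rho> t + \<rho> r, r := 0)"
    using assms Suc(2) by (auto simp: fun_eq_iff)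
  then have "exec [While r [Dec r, Inc s, Inc t]] ?\<sigma> (\<rho>(s := \<rho> s + \<rho> r, t := \<rho> t + \<rho> r, r := 0))"
    using Suc(1)[of ?\<sigma>] Suc(2) assms by (metis diff_Suc_1 fun_upd_same fun_upd_other)
  then show ?case using exec_While_Suc[OF _ e] Suc(2) by (metis Zero_not_Suc)
qed

text \<open>Counting \<open>r\<close> down destroys it, so the value also goes to the scratch
  register \<open>t\<close> and is moved back from there.\<close>

definition copy :: "nat \<Rightarrow> nat \<Rightarrow> nat \<Rightarrow> cmd list" where
  "copy r s t = [While r [Dec r, Inc s, Inc t], While t [Dec t, Inc r]]"

lemma exec_copy:
  assumes "r \<noteq> s" "r \<noteq> t" "s \<noteq> t" "\<rho> s = 0" "\<rho> t = 0"
  shows "exec (copy r s t) \<rho> (\<rho>(s := \<rho> r))"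
proof -
  let ?\<sigma> = "\<rho>(s := \<rho> s + \<rho> r, t := \<rho> t + \<rho> r, r := 0)"
  have "?\<sigma>(r := ?\<sigma> r + ?\<sigma> t, t := 0) = \<rho>(s := \<rho> r)"
    using assms by (auto simp: fun_eq_iff)
  then have "exec [While t [Dec t, Inc r]] ?\<sigma> (\<rho>(s := \<rho> r))"
    using exec_move[of t r ?\<sigma>] assms(2) by simp
  then show ?thesis
    unfolding copy_def using exec_Cons exec_move2 assms(1-3) by blast
qed

lemma exec_clear_range:
  "\<exists>p. \<forall>\<rho>. exec p \<rho> (\<lambda>r. if n \<le> r \<and> r < n + k then 0 else \<rho> r)"
proof (induction k)
  case 0
  have "(\<lambda>r. if n \<le> r \<and> r < n + 0 then 0 else \<rho> r) = \<rho>" for \<rho> :: "nat \<Rightarrow> nat" by auto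
  then show ?case using exec_Nil by (intro exI[of _ "[]"]) simp
next
  case (Suc k)
  then obtain p where p: "\<And>\<rho>. exec p \<rho> (\<lambda>r. if n \<le> r \<and> r < n + k then 0 else \<rho> r)" by blast
  have "(\<lambda>r. if n \<le> r \<and> r < n + k then 0 else \<rho> r)(n + k := 0) = (\<lambda>r. if n \<le> r \<and> r < n + Suc k then 0 else \<rho> r)"
    for \<rho> :: "nat \<Rightarrow> nat" by (auto simp: fun_eq_iff)
  then have "exec (p @ [While (n+k) [Dec (n+k)]]) \<rho> (\<lambda>r. if n \<le> r \<and> r < n + Suc k then 0 else \<rho> r)" for \<rho>
    using exec_append[OF p[of \<rho>] exec_clear[of "n + k"]] by simp
  then show ?case by blast
qed

subsection \<open>Compiling recursive functions\<close>

inductive_cases eval_SuccE: "eval Succ xs y"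
inductive_cases eval_ProjE: "eval (Proj i) xs y"
inductive_cases eval_CompE: "eval (Comp f gs) xs y"
inductive_cases eval_Prim0E: "eval (Prim f g) (0 # xs) y"
inductive_cases eval_PrimSE: "eval (Prim f g) (Suc n # xs) y"
inductive_cases eval_PrimE: "eval (Prim f g) xs y"
inductive_cases eval_MnE: "eval (Mn f) xs y"
inductive_cases eval_ZeroE: "eval Zero xs y"

text \<open>Registers from \<open>n\<close> on are scratch space: zero at the start and, as only
  \<open>d\<close> changes, zero again at the end. Nothing is required of \<open>p\<close> where
  \<open>f\<close> is undefined; totality enters only through the evaluations that are known to
  exist.\<close>

definition computes :: "cmd list \<Rightarrow> recf \<Rightarrow> nat list \<Rightarrow> nat \<Rightarrow> nat \<Rightarrow> bool" where
  "computes p f as d n \<longleftrightarrow>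
     (\<forall>\<rho> y. \<rho> d = 0 \<longrightarrow> (\<forall>r\<ge>n. \<rho> r = 0) \<longrightarrow> eval f (map \<rho> as) y \<longrightarrow> exec p \<rho> (\<rho>(d := y)))"

definition compilable :: "recf \<Rightarrow> bool" where
  "compilable f \<longleftrightarrow>
     (\<forall>as d n. d < n \<longrightarrow> (\<forall>r\<in>set as. r < n) \<longrightarrow> d \<notin> set as \<longrightarrow> (\<exists>p. computes p f as d n))"

lemma compilableD:
  assumes "compilable f" "d < n" "\<forall>r\<in>set as. r < n" "d \<notin> set as"
  obtains p where "\<And>\<rho> y. \<rho> d = 0 \<Longrightarrow> (\<forall>r\<ge>n. \<rho> r = 0) \<Longrightarrow> eval f (map \<rho> as) y \<Longrightarrow> exec p \<rho> (\<rho>(d := y))"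
  using assms unfolding compilable_def computes_def by metis

lemma compilable_Zero: "compilable Zero"
proof -
  have "computes [] Zero as d n" for as d n
    unfolding computes_def by (auto simp: exec_Nil fun_upd_idem elim!: eval_ZeroE)
  then show ?thesis unfolding compilable_def by blast
qed

lemma compilable_Succ: "compilable Succ"
  unfolding compilable_def
proof (intro allI impI)
  fix as :: "nat list" and d n assume a: "d < n" "\<forall>r\<in>set as. r < n" "d \<notin> set as"
  have "computes (copy (hd as) d n @ [Inc d]) Succ as d n"
    unfolding computes_def
  proof (intro allI impI)
    fix \<rho> y assume b: "\<rho> d = 0" "\<forall>r\<ge>n. \<rho> r = 0" "eval Succ (map \<rho> as) y"
    from b(3) obtain x xs where x: "as = x # xs" "y = Suc (\<rho> x)"
      by (cases as) (auto elim: eval_SuccE)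
    have "exec (copy x d n) \<rho> (\<rho>(d := \<rho> x))"
      using a b x by (intro exec_copy) auto
    from exec_append[OF this exec_Inc[of d]] show "exec (copy (hd as) d n @ [Inc d]) \<rho> (\<rho>(d := y))"
      using x by simp
  qed
  then show "\<exists>p. computes p Succ as d n" by blast
qed

lemma compilable_Proj: "compilable (Proj i)"
  unfolding compilable_def
proof (intro allI impI)
  fix as :: "nat list" and d n assume a: "d < n" "\<forall>r\<in>set as. r < n" "d \<notin> set as"
  have "computes (copy (as ! i) d n) (Proj i) as d n"
    unfolding computes_def
  proof (intro allI impI)
    fix \<rho> y assume b: "\<rho> d = 0" "\<forall>r\<ge>n. \<rho> r = 0" "eval (Proj i) (map \<rho> as) y"
    from b(3) have x: "i < length as" "y = \<rho> (as ! i)"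
      by (auto elim: eval_ProjE)
    then have "as ! i \<in> set as" by simp
    then have "as ! i < n" "as ! i \<noteq> d" using a by auto
    then show "exec (copy (as ! i) d n) \<rho> (\<rho>(d := y))"
      using a b x by (auto intro!: exec_copy)
  qed
  then show "\<exists>p. computes p (Proj i) as d n" by blast
qed

text \<open>The induction adds functions at the end of the list, so the results fill the registers
  from \<open>n\<close> upward while the scratch space of each function starts above its own result
  and the arguments stay intact.\<close>

lemma compile_args:
  assumes "\<forall>g\<in>set gs. compilable g" "\<forall>r\<in>set as. r < n"
  shows "\<exists>p. \<forall>\<rho> ys. (\<forall>r\<ge>n. \<rho> r = 0) \<longrightarrow> list_all2 (\<lambda>g y. eval g (map \<rho> as) y) gs ys \<longrightarrow>
     exec p \<rho> (\<lambda>r. if n \<le> r \<and> r < n + length ys then ys ! (r - n) else \<rho> r)"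
  using assms(1)
proof (induction gs rule: rev_induct)
  case Nil
  have "(\<lambda>r. if n \<le> r \<and> r < n + length ([]::nat list) then [] ! (r - n) else \<rho> r) = \<rho>" for \<rho> :: "nat \<Rightarrow> nat"
    by auto
  then show ?case using exec_Nil by (intro exI[of _ "[]"]) simp
next
  case (snoc g gs)
  from snoc obtain p where p: "\<And>\<rho> ys. (\<forall>r\<ge>n. \<rho> r = 0) \<Longrightarrow> list_all2 (\<lambda>g y. eval g (map \<rho> as) y) gs ys \<Longrightarrow>
     exec p \<rho> (\<lambda>r. if n \<le> r \<and> r < n + length ys then ys ! (r - n) else \<rho> r)" by auto
  let ?d = "n + length gs"
  have "compilable g" using snoc by simp
  then obtain q where q: "\<And>\<rho> y. \<rho> ?d = 0 \<Longrightarrow> (\<forall>r\<ge>Suc ?d. \<rho> r = 0) \<Longrightarrow> eval g (map \<rho> as) y \<Longrightarrow> exec q \<rho> (\<rho>(?d := y))"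
    by (rule compilableD[of g ?d "Suc ?d" as]) (use assms(2) in auto)
  have "exec (p @ q) \<rho> (\<lambda>r. if n \<le> r \<and> r < n + length zs then zs ! (r - n) else \<rho> r)"
    if z: "\<forall>r\<ge>n. \<rho> r = 0" "list_all2 (\<lambda>g y. eval g (map \<rho> as) y) (gs @ [g]) zs" for \<rho> zs
  proof -
    obtain ys y where zs: "zs = ys @ [y]" "list_all2 (\<lambda>g y. eval g (map \<rho> as) y) gs ys" "eval g (map \<rho> as) y"
      using z(2) by (auto simp: list_all2_append1 list_all2_Cons1)
    let ?\<sigma> = "\<lambda>r. if n \<le> r \<and> r < n + length ys then ys ! (r - n) else \<rho> r"
    have len: "length ys = length gs" using zs(2) by (simp add: list_all2_lengthD)
    have m: "map ?\<sigma> as = map \<rho> as" using assms(2) by auto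
    have "exec q ?\<sigma> (?\<sigma>(?d := y))"
      by (rule q) (use len z(1) in simp, use len z(1) in simp, unfold m, rule zs(3))
    moreover have "?\<sigma>(?d := y) = (\<lambda>r. if n \<le> r \<and> r < n + length zs then zs ! (r - n) else \<rho> r)"
      using len by (auto simp: fun_eq_iff zs nth_append)
    ultimately show ?thesis using exec_append[OF p[OF z(1) zs(2)]] by simp
  qed
  then show ?case by blast
qed

lemma compilable_Comp:
  assumes "compilable f" "\<forall>g\<in>set gs. compilable g"
  shows "compilable (Comp f gs)"
  unfolding compilable_def
proof (intro allI impI)
  fix as :: "nat list" and d n assume a: "d < n" "\<forall>r\<in>set as. r < n" "d \<notin> set as"
  obtain p where p: "\<And>\<rho> ys. (\<forall>r\<ge>n. \<rho> r = 0) \<Longrightarrow> list_all2 (\<lambda>g y. eval g (map \<rho> as) y) gs ys \<Longrightarrow>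
     exec p \<rho> (\<lambda>r. if n \<le> r \<and> r < n + length ys then ys ! (r - n) else \<rho> r)"
    using compile_args[OF assms(2) a(2)] by blast
  let ?k = "length gs"
  obtain q where q: "\<And>\<rho> y. \<rho> d = 0 \<Longrightarrow> (\<forall>r\<ge>n + ?k. \<rho> r = 0) \<Longrightarrow> eval f (map \<rho> [n..<n + ?k]) y \<Longrightarrow> exec q \<rho> (\<rho>(d := y))"
    by (rule compilableD[OF assms(1), of d "n + ?k" "[n..<n + ?k]"]) (use a in auto)
  obtain c where c: "\<And>\<rho>. exec c \<rho> (\<lambda>r. if n \<le> r \<and> r < n + ?k then 0 else \<rho> r)"
    using exec_clear_range by blast
  have "computes (p @ q @ c) (Comp f gs) as d n"
    unfolding computes_def
  proof (intro allI impI)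
    fix \<rho> y assume b: "\<rho> d = 0" "\<forall>r\<ge>n. \<rho> r = 0" "eval (Comp f gs) (map \<rho> as) y"
    from b(3) obtain ys where ys: "list_all2 (\<lambda>g y. eval g (map \<rho> as) y) gs ys" "eval f ys y"
      by (auto elim: eval_CompE)
    let ?\<sigma> = "\<lambda>r. if n \<le> r \<and> r < n + length ys then ys ! (r - n) else \<rho> r"
    have len: "length ys = ?k" using ys(1) by (simp add: list_all2_lengthD)
    have "map ?\<sigma> [n..<n + ?k] = ys" by (rule nth_equalityI) (auto simp: len)
    then have "exec q ?\<sigma> (?\<sigma>(d := y))"
      using a b ys(2) by (intro q) (auto simp: len)
    from exec_append[OF this c]
    have "exec (q @ c) ?\<sigma> (\<lambda>r. if n \<le> r \<and> r < n + ?k then 0 else (?\<sigma>(d := y)) r)" .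
    moreover have "(\<lambda>r. if n \<le> r \<and> r < n + ?k then 0 else (?\<sigma>(d := y)) r) = \<rho>(d := y)"
      using a b len by (auto simp: fun_eq_iff)
    ultimately show "exec (p @ q @ c) \<rho> (\<rho>(d := y))"
      using exec_append[OF p[OF b(2) ys(1)]] by simp
  qed
  then show "\<exists>p. computes p (Comp f gs) as d n" by blast
qed

lemma compilable_Prim:
  assumes "compilable f" "compilable g"
  shows "compilable (Prim f g)"
  unfolding compilable_def
proof (intro allI impI)
  fix as :: "nat list" and d n assume a: "d < n" "\<forall>r\<in>set as. r < n" "d \<notin> set as"
  show "\<exists>p. computes p (Prim f g) as d n"
  proof (cases as)
    case Nil
    have "computes [] (Prim f g) as d n"
      unfolding computes_def Nil by (auto elim: eval_PrimE)
    then show ?thesis by blast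
  next
    case (Cons x xs)
    obtain pf where pf: "\<And>\<rho> y. \<rho> d = 0 \<Longrightarrow> (\<forall>r\<ge>n. \<rho> r = 0) \<Longrightarrow> eval f (map \<rho> xs) y \<Longrightarrow> exec pf \<rho> (\<rho>(d := y))"
      by (rule compilableD[OF assms(1), of d n xs]) (use a Cons in auto)
    obtain pg where pg: "\<And>\<rho> y. \<rho> (n+2) = 0 \<Longrightarrow> (\<forall>r\<ge>n+3. \<rho> r = 0) \<Longrightarrow> eval g (map \<rho> (d # n # xs)) y \<Longrightarrow> exec pg \<rho> (\<rho>(n+2 := y))"
      by (rule compilableD[OF assms(2), of "n+2" "n+3" "d # n # xs"]) (use a Cons in auto)
    \<comment> \<open>Register \<open>n\<close> holds the index of the recursion, \<open>n+1\<close>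
      the number of rounds left, \<open>d\<close> the current value. The result of \<open>g\<close>
      goes to the fresh register \<open>n+2\<close>, since \<open>d\<close> is one of the arguments
      of \<open>g\<close> and cannot be its destination.\<close>
    define body where "body = [Dec (n+1)] @ pg @ [While d [Dec d]] @ [While (n+2) [Dec (n+2), Inc d]] @ [Inc n]"
    define st where "st \<rho> i j y = \<rho>(n := i, n+1 := j, d := y)" for \<rho> :: "nat \<Rightarrow> nat" and i j y
    have xs: "x < n" "x \<noteq> d" "\<forall>r\<in>set xs. r < n \<and> r \<noteq> d" using a Cons by auto
    have st: "map (st \<rho> i j y) xs = map \<rho> xs" for \<rho> i j y
      using xs by (auto simp: st_def)
    have body: "exec body (st \<rho> i (Suc j) y) (st \<rho> (Suc i) j z)"
      if z: "\<forall>r\<ge>n. \<rho> r = 0" "eval g (y # i # map \<rho> xs) z" for \<rho> i j y z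
    proof -
      have 1: "exec [Dec (n+1)] (st \<rho> i (Suc j) y) (st \<rho> i j y)"
        using exec_Dec[of "n+1" "st \<rho> i (Suc j) y"] a by (simp add: st_def fun_upd_twist)
      have 2: "exec pg (st \<rho> i j y) ((st \<rho> i j y)(n+2 := z))"
      proof (rule pg)
        have "map (st \<rho> i j y) (d # n # xs) = y # i # map \<rho> xs"
          using a st by (simp add: st_def)
        then show "eval g (map (st \<rho> i j y) (d # n # xs)) z" using z(2) by (simp only:)
      qed (use a z(1) in \<open>auto simp: st_def\<close>)
      have 3: "exec [While d [Dec d]] ((st \<rho> i j y)(n+2 := z)) ((st \<rho> i j 0)(n+2 := z))"
        using exec_clear[of d "(st \<rho> i j y)(n+2 := z)"] a by (simp add: st_def fun_upd_twist)
      have "((st \<rho> i j 0)(n+2 := z)) (d := ((st \<rho> i j 0)(n+2 := z)) d + ((st \<rho> i j 0)(n+2 := z)) (n+2), n+2 := 0) = st \<rho> i j z"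
        using a z by (auto simp: st_def fun_eq_iff)
      then have 4: "exec [While (n+2) [Dec (n+2), Inc d]] ((st \<rho> i j 0)(n+2 := z)) (st \<rho> i j z)"
        using exec_move[of "n+2" d "(st \<rho> i j 0)(n+2 := z)"] a by simp
      have 5: "exec [Inc n] (st \<rho> i j z) (st \<rho> (Suc i) j z)"
        using exec_Inc[of n "st \<rho> i j z"] a by (simp add: st_def fun_upd_twist)
      show ?thesis unfolding body_def
        by (intro exec_append[OF 1] exec_append[OF 2] exec_append[OF 3] exec_append[OF 4] 5)
    qed
    let ?loop = "[While (n+1) body]"
    \<comment> \<open>The derivation of \<open>eval\<close> goes down from \<open>m\<close>, the
      loop counts up from 0. Hence the claim pulls an execution that starts in round
      \<open>m\<close> back to one that starts in round 0 with \<open>m\<close> more rounds to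
      go.\<close>
    have loop: "\<exists>y0. eval f zs y0 \<and> (\<forall>\<rho> j \<rho>'. (\<forall>r\<ge>n. \<rho> r = 0) \<longrightarrow> zs = map \<rho> xs \<longrightarrow>
        exec ?loop (st \<rho> m j y) \<rho>' \<longrightarrow> exec ?loop (st \<rho> 0 (m + j) y0) \<rho>')"
      if "eval (Prim f g) (m # zs) y" for m zs y
      using that
    proof (induction m arbitrary: y)
      case 0
      then show ?case by (auto elim: eval_Prim0E)
    next
      case (Suc m)
      from Suc.prems obtain y' where y': "eval (Prim f g) (m # zs) y'" "eval g (y' # m # zs) y"
        by (auto elim: eval_PrimSE)
      from Suc.IH[OF y'(1)] obtain y0 where y0: "eval f zs y0" "\<And>\<rho> j \<rho>'. (\<forall>r\<ge>n. \<rho> r = 0) \<Longrightarrow> zs = map \<rho> xs \<Longrightarrow>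
        exec ?loop (st \<rho> m j y') \<rho>' \<Longrightarrow> exec ?loop (st \<rho> 0 (m + j) y0) \<rho>'" by blast
      have "exec ?loop (st \<rho> 0 (Suc m + j) y0) \<rho>'"
        if h: "\<forall>r\<ge>n. \<rho> r = 0" "zs = map \<rho> xs" "exec ?loop (st \<rho> (Suc m) j y) \<rho>'" for \<rho> j \<rho>'
      proof -
        have "exec ?loop (st \<rho> m (Suc j) y') \<rho>'"
          by (rule exec_While_Suc[OF _ body h(3)]) (use h y'(2) a in \<open>auto simp: st_def\<close>)
        from y0(2)[OF h(1,2) this] show ?thesis by simp
      qed
      with y0(1) show ?case by blast
    qed
    have "computes (pf @ copy x (n+1) (n+2) @ ?loop @ [While n [Dec n]]) (Prim f g) as d n"
      unfolding computes_def
    proof (intro allI impI)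
      fix \<rho> y assume b: "\<rho> d = 0" "\<forall>r\<ge>n. \<rho> r = 0" "eval (Prim f g) (map \<rho> as) y"
      then have "eval (Prim f g) (\<rho> x # map \<rho> xs) y" using Cons by simp
      from loop[OF this] obtain y0 where y0: "eval f (map \<rho> xs) y0"
        "\<And>j \<rho>'. exec ?loop (st \<rho> (\<rho> x) j y) \<rho>' \<Longrightarrow> exec ?loop (st \<rho> 0 (\<rho> x + j) y0) \<rho>'"
        using b(2) by blast
      have 1: "exec pf \<rho> (\<rho>(d := y0))" using pf b y0 by blast
      have "(\<rho>(d := y0))(n+1 := (\<rho>(d := y0)) x) = st \<rho> 0 (\<rho> x) y0"
        using a b xs by (auto simp: st_def fun_eq_iff)
      then have 2: "exec (copy x (n+1) (n+2)) (\<rho>(d := y0)) (st \<rho> 0 (\<rho> x) y0)"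
        using exec_copy[of x "n+1" "n+2" "\<rho>(d := y0)"] a b xs by simp
      have "exec ?loop (st \<rho> (\<rho> x) 0 y) (st \<rho> (\<rho> x) 0 y)"
        using a by (intro exec_While_0) (simp add: st_def)
      from y0(2)[OF this] have 3: "exec ?loop (st \<rho> 0 (\<rho> x) y0) (st \<rho> (\<rho> x) 0 y)" by simp
      have "(st \<rho> (\<rho> x) 0 y)(n := 0) = \<rho>(d := y)"
        using a b by (auto simp: st_def fun_eq_iff)
      then have 4: "exec [While n [Dec n]] (st \<rho> (\<rho> x) 0 y) (\<rho>(d := y))"
        using exec_clear[of n "st \<rho> (\<rho> x) 0 y"] by simp
      show "exec (pf @ copy x (n+1) (n+2) @ ?loop @ [While n [Dec n]]) \<rho> (\<rho>(d := y))"
        by (intro exec_append[OF 1] exec_append[OF 2] exec_append[OF 3] 4)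
    qed
    then show ?thesis by blast
  qed
qed

lemma compilable_Mn:
  assumes "compilable f"
  shows "compilable (Mn f)"
  unfolding compilable_def
proof (intro allI impI)
  fix as :: "nat list" and d n assume a: "d < n" "\<forall>r\<in>set as. r < n" "d \<notin> set as"
  obtain p where p: "\<And>\<rho> y. \<rho> n = 0 \<Longrightarrow> (\<forall>r\<ge>Suc n. \<rho> r = 0) \<Longrightarrow> eval f (map \<rho> (d # as)) y \<Longrightarrow> exec p \<rho> (\<rho>(n := y))"
    by (rule compilableD[OF assms(1), of n "Suc n" "d # as"]) (use a in auto)
  let ?loop = "[While n ([While n [Dec n]] @ [Inc d] @ p)]"
  have "computes (p @ ?loop) (Mn f) as d n"
    unfolding computes_def
  proof (intro allI impI)
    fix \<rho> y assume b: "\<rho> d = 0" "\<forall>r\<ge>n. \<rho> r = 0" "eval (Mn f) (map \<rho> as) y"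
    then have e: "eval f (y # map \<rho> as) 0" "\<And>m. m < y \<Longrightarrow> \<exists>z. eval f (m # map \<rho> as) (Suc z)"
      by (auto elim: eval_MnE)
    have m: "map (\<rho>(d := i)) (d # as) = i # map \<rho> as" for i
      using a by (auto intro: map_cong)
    have pp: "exec p (\<rho>(d := i)) (\<rho>(d := i, n := z))" if "eval f (i # map \<rho> as) z" for i z
      by (rule p) (use a b that m in auto)
    have fin: "\<rho>(d := y, n := 0) = \<rho>(d := y)"
      using a b by (auto simp: fun_eq_iff)
    \<comment> \<open>Here \<open>k\<close> counts the candidates still to be rejected; the value
      \<open>z\<close> kept in register \<open>n\<close> vanishes exactly when none is left, which
      is when the loop stops.\<close>
    have loop: "i + k = y \<Longrightarrow> eval f (i # map \<rho> as) z \<Longrightarrow> (k = 0 \<longrightarrow> z = 0) \<Longrightarrow> (k > 0 \<longrightarrow> z > 0) \<Longrightarrow>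
        exec ?loop (\<rho>(d := i, n := z)) (\<rho>(d := y))" for i k z
    proof (induction k arbitrary: i z)
      case 0
      have "exec ?loop (\<rho>(d := y, n := 0)) (\<rho>(d := y, n := 0))"
        by (rule exec_While_0) simp
      moreover have "i = y" "z = 0" using 0 by simp_all
      ultimately show ?case by (simp only: fin)
    next
      case (Suc k)
      obtain z' where z': "eval f (Suc i # map \<rho> as) z'" "k = 0 \<longrightarrow> z' = 0" "k > 0 \<longrightarrow> z' > 0"
      proof (cases k)
        case 0
        then have "eval f (Suc i # map \<rho> as) 0" using e(1) Suc.prems(1) by simp
        then show ?thesis using that[of 0] 0 by simp
      next
        case (Suc k')
        then have "Suc i < y" using \<open>i + Suc k = y\<close> by simp
        from e(2)[OF this] obtain w where "eval f (Suc i # map \<rho> as) (Suc w)" by (elim exE)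
        then show ?thesis using that[of "Suc w"] Suc by simp
      qed
      have "exec ?loop (\<rho>(d := Suc i, n := z')) (\<rho>(d := y))"
        by (rule Suc.IH) (use Suc.prems z' in auto)
      moreover have "exec ([While n [Dec n]] @ [Inc d] @ p) (\<rho>(d := i, n := z)) (\<rho>(d := Suc i, n := z'))"
      proof -
        have "(\<rho>(d := i, n := z))(n := 0) = \<rho>(d := i)"
          using a b by (auto simp: fun_eq_iff)
        then have 1: "exec [While n [Dec n]] (\<rho>(d := i, n := z)) (\<rho>(d := i))"
          using exec_clear[of n "\<rho>(d := i, n := z)"] by simp
        have 2: "exec [Inc d] (\<rho>(d := i)) (\<rho>(d := Suc i))"
          using exec_Inc[of d "\<rho>(d := i)"] by simp
        show ?thesis
          by (intro exec_append[OF 1] exec_append[OF 2] pp z')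
      qed
      moreover have "(\<rho>(d := i, n := z)) n \<noteq> 0" using Suc.prems by simp
      ultimately show ?case using exec_While_Suc by blast
    qed
    obtain z where z: "eval f (0 # map \<rho> as) z" "y = 0 \<longrightarrow> z = 0" "y > 0 \<longrightarrow> z > 0"
    proof (cases y)
      case 0
      then show ?thesis using that e(1) by simp
    next
      case (Suc y')
      then obtain w where "eval f (0 # map \<rho> as) (Suc w)" using e(2)[of 0] by auto
      then show ?thesis using that Suc by simp
    qed
    have "\<rho>(d := 0) = \<rho>" using b(1) by auto
    then have "exec p \<rho> (\<rho>(d := 0, n := z))"
      using pp[OF z(1)] by (simp only:)
    moreover have "exec ?loop (\<rho>(d := 0, n := z)) (\<rho>(d := y))"
      by (rule loop[of 0 y z]) (use z in auto)
    ultimately show "exec (p @ ?loop) \<rho> (\<rho>(d := y))" by (rule exec_append)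
  qed
  then show "\<exists>p. computes p (Mn f) as d n" by blast
qed

theorem all_compilable: "compilable f"
  by (induction f)
    (auto intro: compilable_Zero compilable_Succ compilable_Proj compilable_Comp compilable_Prim compilable_Mn)

section \<open>The instances and their codes\<close>

text \<open>An interval is used because it can be listed from the number \<open>code_trans T\<close>
  alone. By \<open>letter_le_code\<close> it reaches all letters of the transitions in
  \<open>T\<close>; surplus letters label no transition and do no harm.\<close>

fun out_letters :: "nat \<Rightarrow> nat list" where
  "out_letters 0 = []"
| "out_letters (Suc k) = (k + 2) # out_letters k"

text \<open>The state \<open>2 * k + 1\<close> stands for \<open>Chain k\<close>, and the even
  numbers are left to the other states. The letter 2 is the blank of every program.\<close>

fun chain :: "nat \<Rightarrow> (nat \<times> nat \<times> nat) list" where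
  "chain 0 = []"
| "chain (Suc k) = (2 * k + 3, 2, 2 * k + 1) # chain k"

text \<open>This is the encoding that \<open>enc_nfa\<close> applies to its transitions. Codes of
  lists are built from the tail, so transitions can be put in front of \<open>T\<close> knowing only
  this number.\<close>

definition code_trans :: "(nat \<times> nat \<times> nat) list \<Rightarrow> nat" where
  "code_trans T = list_encode (map (\<lambda>(p, a, q). prod_encode (p, prod_encode (a, q))) T)"

text \<open>The constants 0, 4 and 2 are the numbers of \<open>Init\<close>, \<open>PreChain\<close>
  and \<open>Fin\<close> under \<open>num\<close>. They do not depend on the program, as everything
  outside \<open>T\<close> has to be computed without it.\<close>

definition planted :: "(nat \<times> nat \<times> nat) list \<Rightarrow> nat \<Rightarrow> nfa" where
  "planted T c = ([0], (4, 1, 2 * c + 1) # chain c @ T, [2])"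

definition inst :: "nfa \<Rightarrow> (nat \<times> nat \<times> nat) list \<Rightarrow> uinst" where
  "inst B T = ([0, 1], out_letters (code_trans T), planted T (code_trans T), B)"

lemma set_out_letters: "set (out_letters k) = {2..<k + 2}"
  by (induction k) (auto simp: atLeastLessThanSuc)

section \<open>Recursive functions that build the code of an instance\<close>

lemma eval_Comp1: "eval g xs y \<Longrightarrow> eval f [y] z \<Longrightarrow> eval (Comp f [g]) xs z"
  by (rule eval_comp[where ys = "[y]"]) auto

lemma eval_Comp2: "eval g xs y \<Longrightarrow> eval g' xs y' \<Longrightarrow> eval f [y, y'] z \<Longrightarrow> eval (Comp f [g, g']) xs z"
  by (rule eval_comp[where ys = "[y, y']"]) auto

lemma eval_Succ1: "eval Succ [x] (Suc x)"
  by (rule eval_succ)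

lemma eval_Proj0: "eval (Proj 0) (x # xs) x"
  using eval_proj[of 0 "x # xs"] by simp

lemma eval_Proj1: "eval (Proj (Suc 0)) (x # y # xs) y"
  using eval_proj[of "Suc 0" "x # y # xs"] by simp

primrec const_rf :: "nat \<Rightarrow> recf" where
  "const_rf 0 = Zero"
| "const_rf (Suc k) = Comp Succ [const_rf k]"

lemma eval_const: "eval (const_rf k) xs k"
  by (induction k) (auto intro: eval_zero eval_Comp1 eval_Succ1)

definition add_rf :: recf where
  "add_rf = Prim (Proj 0) (Comp Succ [Proj 0])"

lemma eval_add: "eval add_rf [m, n] (m + n)"
  unfolding add_rf_def
  by (induction m) (auto intro: eval_prim0 eval_primS eval_Comp1 eval_Proj0 eval_Succ1)

text \<open>Triangular numbers are what the Cantor pairing \<open>prod_encode\<close> is made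
  of.\<close>

definition triangle_rf :: recf where
  "triangle_rf = Prim Zero (Comp add_rf [Proj 0, Comp Succ [Proj (Suc 0)]])"

lemma eval_triangle: "eval triangle_rf [n] (triangle n)"
  unfolding triangle_rf_def
proof (induction n)
  case (Suc n)
  show ?case
    by (rule eval_primS[OF Suc]) (auto intro!: eval_Comp2 eval_Comp1 eval_Proj0 eval_Proj1 eval_Succ1 eval_add
       simp del: add_Suc_right)
qed (auto intro: eval_prim0 eval_zero)

definition pair_rf :: "recf \<Rightarrow> recf \<Rightarrow> recf" where
  "pair_rf f g = Comp add_rf [Comp triangle_rf [Comp add_rf [f, g]], f]"

lemma eval_pair: "eval f xs a \<Longrightarrow> eval g xs b \<Longrightarrow> eval (pair_rf f g) xs (prod_encode (a, b))"
  unfolding pair_rf_def prod_encode_def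
  by (auto intro!: eval_Comp2 eval_Comp1 eval_triangle eval_add)

definition cons_rf :: "recf \<Rightarrow> recf \<Rightarrow> recf" where
  "cons_rf f g = Comp Succ [pair_rf f g]"

lemma eval_cons:
  "eval f xs a \<Longrightarrow> eval g xs (list_encode l) \<Longrightarrow> eval (cons_rf f g) xs (list_encode (a # l))"
  unfolding cons_rf_def by (auto intro!: eval_Comp1 eval_pair eval_Succ1)

lemma eval_cons_trans:
  "eval f xs (prod_encode (p, prod_encode (a, q))) \<Longrightarrow> eval g xs (code_trans T) \<Longrightarrow>
    eval (cons_rf f g) xs (code_trans ((p, a, q) # T))"
  unfolding code_trans_def using eval_cons by auto

definition out_letters_rf :: recf where
  "out_letters_rf = Prim Zero (cons_rf (Comp Succ [Comp Succ [Proj (Suc 0)]]) (Proj 0))"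

lemma eval_out_letters: "eval out_letters_rf [k] (list_encode (out_letters k))"
  unfolding out_letters_rf_def
proof (induction k)
  case (Suc k)
  have "eval (Comp Succ [Comp Succ [Proj (Suc 0)]]) [list_encode (out_letters k), k] (k + 2)"
    by (auto intro!: eval_Comp1 eval_Proj1 intro: eval_succ)
  then show ?case
    using eval_primS[OF Suc eval_cons[OF _ eval_Proj0]] by simp
qed (auto intro: eval_prim0 eval_zero)

definition odd_rf :: "recf \<Rightarrow> recf" where
  "odd_rf f = Comp Succ [Comp add_rf [f, f]]"

lemma eval_odd: "eval f xs k \<Longrightarrow> eval (odd_rf f) xs (2 * k + 1)"
  unfolding odd_rf_def using eval_Comp1[OF eval_Comp2[OF _ _ eval_add] eval_Succ1]
  by (metis Suc_eq_plus1 mult_2)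

definition chain_rf :: recf where
  "chain_rf = Prim (Proj 0)
     (cons_rf (pair_rf (odd_rf (Comp Succ [Proj (Suc 0)])) (pair_rf (const_rf 2) (odd_rf (Proj (Suc 0))))) (Proj 0))"

lemma eval_chain: "eval chain_rf [k, code_trans T] (code_trans (chain k @ T))"
  unfolding chain_rf_def
proof (induction k)
  case 0
  then show ?case by (auto intro: eval_prim0 eval_Proj0)
next
  case (Suc k)
  have "eval (pair_rf (odd_rf (Comp Succ [Proj (Suc 0)])) (pair_rf (const_rf 2) (odd_rf (Proj (Suc 0)))))
     [code_trans (chain k @ T), k, code_trans T] (prod_encode (2 * Suc k + 1, prod_encode (2, 2 * k + 1)))"
    by (intro eval_pair eval_odd eval_const eval_Comp1[OF eval_Proj1 eval_Succ1] eval_Proj1)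
  from eval_cons_trans[OF this eval_Proj0]
  have "eval (cons_rf (pair_rf (odd_rf (Comp Succ [Proj (Suc 0)])) (pair_rf (const_rf 2) (odd_rf (Proj (Suc 0))))) (Proj 0))
     [code_trans (chain k @ T), k, code_trans T] (code_trans ((2 * Suc k + 1, 2, 2 * k + 1) # chain k @ T))" .
  from eval_primS[OF Suc this]
  show ?case by (simp add: numeral_3_eq_3)
qed

definition inst_rf :: "nfa \<Rightarrow> recf" where
  "inst_rf B = cons_rf (const_rf (list_encode [0, 1])) (cons_rf out_letters_rf
     (cons_rf (cons_rf (const_rf (list_encode [0]))
        (cons_rf (cons_rf (pair_rf (const_rf 4) (pair_rf (const_rf 1) (odd_rf (Proj 0)))) (Comp chain_rf [Proj 0, Proj 0]))
          (const_rf (list_encode [list_encode [2]]))))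
       (const_rf (list_encode [enc_nfa B]))))"

text \<open>The single argument serves three times: as the bound of the output alphabet, as the
  length of the chain, and as the code of the list to which the chain is prepended.\<close>

lemma eval_inst: "eval (inst_rf B) [code_trans T] (enc_instance (inst B T))"
proof -
  let ?c = "code_trans T"
  have trans: "eval (cons_rf (pair_rf (const_rf 4) (pair_rf (const_rf 1) (odd_rf (Proj 0)))) (Comp chain_rf [Proj 0, Proj 0]))
    [?c] (code_trans ((4, 1, 2 * ?c + 1) # chain ?c @ T))"
    by (intro eval_cons_trans eval_pair eval_const eval_odd eval_Proj0 eval_Comp2[OF eval_Proj0 eval_Proj0] eval_chain)
  have "enc_instance (inst B T) = list_encode [list_encode [0, 1], list_encode (out_letters ?c),
      list_encode [list_encode [0], code_trans ((4, 1, 2 * ?c + 1) # chain ?c @ T), list_encode [2]], enc_nfa B]"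
    by (simp add: enc_instance_def inst_def planted_def enc_nfa_def code_trans_def)
  then show ?thesis
    unfolding inst_rf_def
    by (simp only:) (intro eval_cons eval_const eval_out_letters trans)
qed

lemma list_encode_ge: "x \<in> set xs \<Longrightarrow> x \<le> list_encode xs"
proof (induction xs)
  case (Cons y xs)
  then show ?case
    using le_prod_encode_1[of y "list_encode xs"] le_prod_encode_2[of "list_encode xs" y] by auto
qed simp

lemma letter_le_code:
  assumes "(p, a, q) \<in> set T"
  shows "a \<le> code_trans T"
proof -
  have "a \<le> prod_encode (p, prod_encode (a, q))"
    using le_prod_encode_1[of a q] le_prod_encode_2[of "prod_encode (a, q)" p] by linarith
  also have "\<dots> \<le> code_trans T"
    unfolding code_trans_def using assms by (intro list_encode_ge) force
  finally show ?thesis .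
qed

section \<open>Synchronizations and automata\<close>

fun sync :: "nat list \<Rightarrow> nat list \<Rightarrow> nat list" where
  "sync [] v = v"
| "sync u [] = u"
| "sync (a # u) (b # v) = a # b # sync u v"

lemma sync_Nil2 [simp]: "sync u [] = u"
  by (cases u) auto

lemma filter_sync:
  assumes "\<And>x. x \<in> set u \<Longrightarrow> P x" "\<And>x. x \<in> set v \<Longrightarrow> \<not> P x"
  shows "filter P (sync u v) = u" "filter (\<lambda>x. \<not> P x) (sync u v) = v"
  using assms by (induction u v rule: sync.induct) (auto simp: filter_empty_conv filter_id_conv)

lemma sem_sync:
  assumes "\<Sigma> \<inter> \<Gamma> = {}" "set u \<subseteq> \<Sigma>" "set v \<subseteq> \<Gamma>"
  shows "sem \<Sigma> \<Gamma> (sync u v) = (u, v)"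
  using filter_sync(1)[of u "\<lambda>x. x \<notin> \<Gamma>" v] filter_sync(2)[of u "\<lambda>x. x \<in> \<Sigma>" v] assms
  unfolding sem_def pi_i_def pi_o_def by blast

lemma sync_shape:
  assumes "in_sync_shape \<Sigma> \<Gamma> w"
  obtains u v where "w = sync u v" "set u \<subseteq> \<Sigma>" "set v \<subseteq> \<Gamma>"
proof -
  obtain ps t where w: "w = concat (map (\<lambda>(a, b). [a, b]) ps) @ t"
    "\<forall>(a, b)\<in>set ps. a \<in> \<Sigma> \<and> b \<in> \<Gamma>" "set t \<subseteq> \<Sigma> \<or> set t \<subseteq> \<Gamma>"
    using assms unfolding in_sync_shape_def by blast
  have "sync (map fst ps @ u) (map snd ps @ v) = concat (map (\<lambda>(a, b). [a, b]) ps) @ sync u v" for u v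
    by (induction ps) auto
  from this[of t "[]"] this[of "[]" t] show ?thesis
    using w that[of "map fst ps @ t" "map snd ps"] that[of "map fst ps" "map snd ps @ t"] by fastforce
qed

text \<open>A word of the required shape is determined by its two projections, so membership of a
  pair is membership of a single word.\<close>

lemma rel_of_sync:
  assumes "\<Sigma> \<inter> \<Gamma> = {}" "\<forall>w\<in>S. in_sync_shape \<Sigma> \<Gamma> w"
  shows "(u, v) \<in> rel_of \<Sigma> \<Gamma> S \<longleftrightarrow> set u \<subseteq> \<Sigma> \<and> set v \<subseteq> \<Gamma> \<and> sync u v \<in> S"
proof
  assume "(u, v) \<in> rel_of \<Sigma> \<Gamma> S"
  then obtain w where w: "w \<in> S" "(u, v) = sem \<Sigma> \<Gamma> w" unfolding rel_of_def by auto
  then obtain u' v' where "w = sync u' v'" "set u' \<subseteq> \<Sigma>" "set v' \<subseteq> \<Gamma>"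
    using assms(2) sync_shape by metis
  with w sem_sync[OF assms(1)] show "set u \<subseteq> \<Sigma> \<and> set v \<subseteq> \<Gamma> \<and> sync u v \<in> S" by auto
next
  assume "set u \<subseteq> \<Sigma> \<and> set v \<subseteq> \<Gamma> \<and> sync u v \<in> S"
  with sem_sync[OF assms(1)] show "(u, v) \<in> rel_of \<Sigma> \<Gamma> S"
    unfolding rel_of_def by (metis image_eqI)
qed

text \<open>The type of states is left open: the automaton is described with structured states and
  receives numbers only at the end, by \<open>accepts_transfer\<close>.\<close>

fun accepts :: "('s \<Rightarrow> 'a \<Rightarrow> 's \<Rightarrow> bool) \<Rightarrow> 's set \<Rightarrow> 's \<Rightarrow> 'a list \<Rightarrow> bool" where
  "accepts \<tau> F p [] \<longleftrightarrow> p \<in> F"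
| "accepts \<tau> F p (a # w) \<longleftrightarrow> (\<exists>q. \<tau> p a q \<and> accepts \<tau> F q w)"

lemma nfa_run_accepts:
  "nfa_run A P w \<inter> F \<noteq> {} \<longleftrightarrow> (\<exists>p\<in>P. accepts (\<lambda>p a q. (p, a, q) \<in> set (fst (snd A))) F p w)"
  by (induction w arbitrary: P) (auto simp: nfa_step_def)

lemma nfa_lang_accepts:
  "nfa_lang (I, T, F) = {w. \<exists>p\<in>set I. accepts (\<lambda>p a q. (p, a, q) \<in> set T) (set F) p w}"
  unfolding nfa_lang_def nfa_run_accepts by simp

lemma accepts_transfer:
  assumes "inj \<phi>"
  shows "accepts (\<lambda>p a q. \<exists>s s'. p = \<phi> s \<and> q = \<phi> s' \<and> \<tau> s a s') (\<phi> ` F) (\<phi> s) w \<longleftrightarrow> accepts \<tau> F s w"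
proof (induction w arbitrary: s)
  case Nil
  then show ?case using assms by (auto dest: injD)
next
  case (Cons a w)
  then show ?case using assms by (auto simp: Cons.IH[symmetric] dest: injD)
qed

section \<open>The control language\<close>

text \<open>State 2 is inside the first, nonempty block of output. State 3 has read an input letter
  whose output is undecided: a 2 leads to state 4, another 1 to state 5, where output is no longer
  possible.\<close>

definition pace_nfa :: nfa where
  "pace_nfa = ([0], [(0,1,1), (1,2,2), (2,2,2), (2,1,3), (3,2,4), (4,1,3), (3,1,5), (5,1,5)], [2, 3, 4, 5])"

definition blocks :: "nat list \<Rightarrow> nat list" where
  "blocks ks = concat (map (\<lambda>k. 1 # replicate k 2) ks)"

definition paced :: "nat list \<Rightarrow> bool" where
  "paced ks \<longleftrightarrow> (\<exists>k i e. ks = Suc k # replicate i 1 @ replicate e 0)"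

lemma blocks_simps [simp]: "blocks [] = []" "blocks (k # ks) = 1 # replicate k 2 @ blocks ks"
  by (simp_all add: blocks_def)

abbreviation pace_acc :: "nat \<Rightarrow> nat list \<Rightarrow> bool" where
  "pace_acc \<equiv> accepts (\<lambda>p a q. (p, a, q) \<in> set (fst (snd pace_nfa))) {2, 3, 4, 5}"

lemma pace_acc_simps:
  "pace_acc 0 [] \<longleftrightarrow> False" "pace_acc 0 (a # w) \<longleftrightarrow> a = 1 \<and> pace_acc 1 w"
  "pace_acc (Suc 0) [] \<longleftrightarrow> False" "pace_acc (Suc 0) (a # w) \<longleftrightarrow> a = 2 \<and> pace_acc 2 w"
  "pace_acc 2 [] \<longleftrightarrow> True" "pace_acc 2 (a # w) \<longleftrightarrow> a = 2 \<and> pace_acc 2 w \<or> a = 1 \<and> pace_acc 3 w"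
  "pace_acc 3 [] \<longleftrightarrow> True" "pace_acc 3 (a # w) \<longleftrightarrow> a = 2 \<and> pace_acc 4 w \<or> a = 1 \<and> pace_acc 5 w"
  "pace_acc 4 [] \<longleftrightarrow> True" "pace_acc 4 (a # w) \<longleftrightarrow> a = 1 \<and> pace_acc 3 w"
  "pace_acc 5 [] \<longleftrightarrow> True" "pace_acc 5 (a # w) \<longleftrightarrow> a = 1 \<and> pace_acc 5 w"
  by (auto simp: pace_nfa_def)

lemma pace_acc_5: "pace_acc 5 (blocks ks) \<longleftrightarrow> (\<exists>e. ks = replicate e 0)"
proof (induction ks)
  case (Cons k ks)
  have "(\<exists>e. k # ks = replicate e 0) \<longleftrightarrow> k = 0 \<and> (\<exists>e. ks = replicate e 0)"
    by (metis list.inject replicate_Suc Cons_replicate_eq)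
  then show ?case using Cons by (cases k) (auto simp: pace_acc_simps simp del: accepts.simps)
qed (auto simp: pace_acc_simps simp del: accepts.simps)

lemma pace_acc_4: "pace_acc 4 (blocks ks) \<longleftrightarrow> (\<exists>i e. ks = replicate i 1 @ replicate e 0)"
proof (induction ks)
  case (Cons k ks)
  consider "k = 0" | "k = 1" | l where "k = Suc (Suc l)" by (metis One_nat_def not0_implies_Suc)
  then show ?case
  proof cases
    case 1
    have "(\<exists>i e. k # ks = replicate i 1 @ replicate e 0) \<longleftrightarrow> (\<exists>e. ks = replicate e 0)"
    proof
      assume "\<exists>i e. k # ks = replicate i 1 @ replicate e 0"
      then obtain i e where "k # ks = replicate i 1 @ replicate e 0" by blast
      then have "ks = replicate (e - 1) 0" using 1 by (cases i; cases e) auto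
      then show "\<exists>e. ks = replicate e 0" by blast
    next
      assume "\<exists>e. ks = replicate e 0"
      then obtain e where "k # ks = replicate 0 1 @ replicate (Suc e) 0" using 1 by auto
      then show "\<exists>i e. k # ks = replicate i 1 @ replicate e 0" by blast
    qed
    moreover have "pace_acc 3 (blocks ks) \<longleftrightarrow> pace_acc 5 (blocks ks)"
      by (cases ks) (auto simp: pace_acc_simps simp del: accepts.simps)
    ultimately show ?thesis using 1 pace_acc_5 by (auto simp: pace_acc_simps simp del: accepts.simps)
  next
    case 2
    have "(\<exists>i e. k # ks = replicate i 1 @ replicate e 0) \<longleftrightarrow> (\<exists>i e. ks = replicate i 1 @ replicate e 0)"
    proof
      assume "\<exists>i e. k # ks = replicate i 1 @ replicate e 0"
      then obtain i e where "k # ks = replicate i 1 @ replicate e 0" by blast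
      then have "ks = replicate (i - 1) 1 @ replicate e 0" using 2 by (cases i; cases e) auto
      then show "\<exists>i e. ks = replicate i 1 @ replicate e 0" by blast
    next
      assume "\<exists>i e. ks = replicate i 1 @ replicate e 0"
      then obtain i e where "k # ks = replicate (Suc i) 1 @ replicate e 0" using 2 by auto
      then show "\<exists>i e. k # ks = replicate i 1 @ replicate e 0" by blast
    qed
    then show ?thesis using 2 Cons by (auto simp: pace_acc_simps simp del: accepts.simps)
  next
    case 3
    have "k # ks \<noteq> replicate i 1 @ replicate e 0" for i e
      using 3 by (cases i; cases e) auto
    then show ?thesis using 3 by (auto simp: pace_acc_simps simp del: accepts.simps)
  qed
qed (auto simp: pace_acc_simps simp del: accepts.simps)

lemma pace_acc_2: "pace_acc 2 (replicate k 2 @ blocks ks) \<longleftrightarrow> pace_acc 4 (blocks ks)"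
proof (induction k)
  case 0
  then show ?case by (cases ks) (auto simp: pace_acc_simps simp del: accepts.simps)
qed (auto simp: pace_acc_simps simp del: accepts.simps)

lemma blocks_in_pace: "blocks ks \<in> nfa_lang pace_nfa \<longleftrightarrow> paced ks"
proof -
  have "blocks ks \<in> nfa_lang pace_nfa \<longleftrightarrow> pace_acc 0 (blocks ks)"
    using nfa_lang_accepts[of "[0]" "fst (snd pace_nfa)" "[2, 3, 4, 5]"] by (simp add: pace_nfa_def)
  also have "\<dots> \<longleftrightarrow> (\<exists>k ks'. ks = Suc k # ks' \<and> pace_acc 4 (blocks ks'))"
  proof (cases ks)
    case Nil
    then show ?thesis by (simp add: pace_acc_simps del: accepts.simps)
  next
    case (Cons k ks')
    show ?thesis
    proof (cases k)
      case 0
      then show ?thesis using Cons by (cases ks') (auto simp: pace_acc_simps simp del: accepts.simps)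
    next
      case (Suc l)
      then show ?thesis using Cons pace_acc_2[of l ks'] by (simp add: pace_acc_simps del: accepts.simps)
    qed
  qed
  also have "\<dots> \<longleftrightarrow> paced ks"
    unfolding pace_acc_4 paced_def by blast
  finally show ?thesis .
qed

lemma accepts_letters:
  "accepts \<tau> F p w \<Longrightarrow> (\<And>p a q. \<tau> p a q \<Longrightarrow> a \<in> X) \<Longrightarrow> set w \<subseteq> X"
  by (induction w arbitrary: p) auto

lemma pace_letters: "w \<in> nfa_lang pace_nfa \<Longrightarrow> set w \<subseteq> {1, 2}"
  unfolding pace_nfa_def nfa_lang_accepts by (auto dest!: accepts_letters[where X = "{1, 2}"])

text \<open>An empty block is followed only by empty ones. So a transducer that still has something
  to write at the end cannot have been silent on any earlier letter.\<close>

lemma paced_last: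
  assumes "paced ks" "last ks \<noteq> 0"
  shows "\<exists>k i. ks = Suc k # replicate i 1"
proof -
  obtain k i e where ks: "ks = Suc k # replicate i 1 @ replicate e 0" using assms(1) paced_def by auto
  then have "e = 0" using assms(2) by (cases e) (auto simp: last_append replicate_append_same[symmetric])
  then show ?thesis using ks by auto
qed

section \<open>Continuations\<close>

text \<open>These are the remaining programs met on the way from \<open>p @ k\<close> to
  \<open>k\<close>. A loop body returns to the very list that unrolled it, so they are finite in
  number, and so are the letters needed for a program.\<close>

fun conts :: "cmd list \<Rightarrow> cmd list \<Rightarrow> cmd list set" where
  "conts [] k = {k}"
| "conts (Inc r # p) k = insert (Inc r # p @ k) (conts p k)"
| "conts (Dec r # p) k = insert (Dec r # p @ k) (conts p k)"
| "conts (While r b # p) k =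
     insert (While r b # p @ k) (conts b (While r b # p @ k) \<union> conts p k)"

lemma finite_conts: "finite (conts p k)"
  by (induction p k rule: conts.induct) auto

lemma start_in_conts: "p @ k \<in> conts p k"
  by (induction p k rule: conts.induct) auto

text \<open>The escape \<open>q = k\<close> serves the bodies of loops: their continuation is the
  loop itself, which lies in the outer set. For \<open>k = []\<close> it is harmless because the
  empty program stays as it is.\<close>

lemma step_in_conts:
  "q \<in> conts p k \<Longrightarrow> fst (step (q, \<rho>)) \<in> conts p k \<or> q = k"
proof (induction p k rule: conts.induct)
  case (4 r b p k)
  then show ?case
    using start_in_conts[of b "While r b # p @ k"] start_in_conts[of p k] by auto
qed (use start_in_conts in auto)

fun regs_below :: "nat \<Rightarrow> cmd list \<Rightarrow> bool" where
  "regs_below n [] \<longleftrightarrow> True"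
| "regs_below n (Inc r # p) \<longleftrightarrow> r < n \<and> regs_below n p"
| "regs_below n (Dec r # p) \<longleftrightarrow> r < n \<and> regs_below n p"
| "regs_below n (While r b # p) \<longleftrightarrow> r < n \<and> regs_below n b \<and> regs_below n p"

lemma regs_below_mono: "regs_below m p \<Longrightarrow> m \<le> n \<Longrightarrow> regs_below n p"
  by (induction m p rule: regs_below.induct) auto

lemma regs_below_exists: "\<exists>n. regs_below n p"
proof (induction p rule: regs_below.induct[where P = "\<lambda>_. \<lambda>p. \<exists>n. regs_below n p"])
  case (2 n r p)
  then obtain m where "regs_below m p" by blast
  then show ?case
    by (intro exI[of _ "max m (Suc r)"]) (auto intro: regs_below_mono)
next
  case (3 n r p)
  then obtain m where "regs_below m p" by blast
  then show ?case
    by (intro exI[of _ "max m (Suc r)"]) (auto intro: regs_below_mono)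
next
  case (4 n r b p)
  then obtain m m' where "regs_below m p" "regs_below m' b" by blast
  then show ?case
    by (intro exI[of _ "max (max m m') (Suc r)"]) (auto intro: regs_below_mono)
qed auto

lemma regs_below_append: "regs_below n (p @ q) \<longleftrightarrow> regs_below n p \<and> regs_below n q"
  by (induction n p rule: regs_below.induct) auto

lemma regs_below_step: "regs_below n p \<Longrightarrow> regs_below n (fst (step (p, \<rho>)))"
  by (cases "(p, \<rho>)" rule: step.cases) (auto simp: regs_below_append)

section \<open>The relation\<close>

text \<open>A configuration is written as a row of cells. A cell records whether it is the first one of
  its row, the program still to be run, and the registers whose value is its index in the row.\<close>

datatype letter = Cell bool "cmd list" "nat list" | Dollar | Hash

instance letter :: countable
  by countable_datatype

fun is_start :: "letter \<Rightarrow> bool" where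
  "is_start (Cell s k X) = s"
| "is_start _ = False"

fun toks :: "letter \<Rightarrow> nat list" where
  "toks (Cell s k X) = X"
| "toks _ = []"

text \<open>Only the first cell of a row sees which registers are 0 and can decide a branch; this
  condition carries the resulting program along the row. The ban on \<open>Hash\<close> keeps the
  end marker out of everything written before the mark.\<close>

fun hok :: "letter option \<Rightarrow> letter \<Rightarrow> bool" where
  "hok _ Hash = False"
| "hok (Some (Cell s k X)) (Cell False k' X') = (k = k')"
| "hok _ _ = True"

fun hchain :: "letter option \<Rightarrow> letter list \<Rightarrow> bool" where
  "hchain z [] = True"
| "hchain z (l # ls) = (hok z l \<and> hchain (Some l) ls)"

text \<open>A token comes from the left for \<open>Inc\<close> and from the right for
  \<open>Dec\<close>. The left neighbour of a first cell and a right neighbour that is a first cell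
  belong to other rows and are ignored; a token in the first cell stays there under
  \<open>Dec\<close>, as 0 - 1 = 0.\<close>

fun moved :: "cmd \<Rightarrow> letter option \<Rightarrow> bool \<Rightarrow> nat list \<Rightarrow> letter \<Rightarrow> nat \<Rightarrow> bool" where
  "moved (Inc q) x s X z r =
     (if r = q then \<not> s \<and> (\<exists>l. x = Some l \<and> r \<in> set (toks l)) else r \<in> set X)"
| "moved (Dec q) x s X z r =
     (if r = q then s \<and> r \<in> set X \<or> \<not> is_start z \<and> r \<in> set (toks z) else r \<in> set X)"
| "moved (While q b) x s X z r = (r \<in> set X)"

fun follow :: "cmd \<Rightarrow> cmd list \<Rightarrow> nat list \<Rightarrow> cmd list" where
  "follow (While r b) k X = (if r \<in> set X then k else b @ While r b # k)"
| "follow _ k X = k"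

text \<open>A token pushed beyond the last cell would be lost. Forbidding this forces the transducer
  to choose a lag above all register values.\<close>

fun overflow :: "cmd \<Rightarrow> nat list \<Rightarrow> letter \<Rightarrow> bool" where
  "overflow (Inc q) X z = (q \<in> set X \<and> is_start z)"
| "overflow _ X z = False"

text \<open>Which letter may stand one row below \<open>y\<close>, whose neighbours are \<open>x\<close> and \<open>z\<close>. A row with the
  empty program has a successor only if register 1 holds 0.\<close>

fun vok :: "nat \<Rightarrow> letter option \<Rightarrow> letter \<Rightarrow> letter \<Rightarrow> letter \<Rightarrow> bool" where
  "vok n x (Cell s [] X) z y' = (s \<longrightarrow> 1 \<in> set X \<and> y' = Dollar)"
| "vok n x (Cell s (i # k) X) z y' =
     (\<not> overflow i X z \<and>
      (\<exists>k'. y' = Cell s k' (filter (moved i x s X z) [0..<n]) \<and> (s \<longrightarrow> k' = follow i k X)))"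
| "vok n x _ z y' = True"

text \<open>\<open>Scan\<close> keeps the last three output letters, the window that
  \<open>vok\<close> needs. The \<open>Half\<close> states wait for the output letter that pairs
  with an input letter; the \<open>Pair\<close> states freeze the window at the mark and track the
  latest output letter. In \<open>Late\<close> the input outlives the output.\<close>

datatype 'l state =
    Init | Scan "'l option" "'l option" "'l option" | Half "'l option" "'l option" "'l option" | Over 'l
  | Marked "'l option" 'l 'l | Pair "'l option" 'l 'l 'l | HalfPair "'l option" 'l 'l 'l
  | Excess | End | Done bool | Late | First | PreChain | Chain nat | Tail | Fin

instance state :: (countable) countable
  by countable_datatype

locale game =
  fixes P :: "cmd list" and n :: nat
begin

text \<open>The code of the blank letter does not depend on the program: the chain planted into an instance
  reads this letter, and the function computing the code of the instance is fixed before the program.\<close>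

definition code :: "letter \<Rightarrow> nat" where
  "code l = (if l = Cell False P [] then 2 else 3 + to_nat l)"

lemma code_eq [simp]: "code l = code l' \<longleftrightarrow> l = l'"
  by (auto simp: code_def)

lemma code_neq [simp]: "code l \<noteq> 0" "code l \<noteq> Suc 0" "0 \<noteq> code l" "Suc 0 \<noteq> code l" "0 < code l"
  by (auto simp: code_def)

lemma code_ge: "2 \<le> code l"
  by (auto simp: code_def)

lemma code_blank: "code (Cell False P []) = 2"
  by (simp add: code_def)

text \<open>Input 0 is a tick, 1 is the mark. The vertical check is made where \<open>Hash\<close>
  pairs with a tick, and its verdict counts only if the word ends there: through \<open>End\<close>
  and \<open>Late\<close> the other lengths are accepted without it. The second move of
  \<open>Init\<close> guesses that the mark comes right after the first tick.\<close>

inductive move :: "letter state \<Rightarrow> nat \<Rightarrow> letter state \<Rightarrow> bool" where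
  "move Init 0 (Half None None None)"
| "move (Scan x y z) 0 (Half x y z)"
| "hok z l \<Longrightarrow> move (Half x y z) (code l) (Scan y z (Some l))"
| "hok (Some z) l \<Longrightarrow> move (Scan x y (Some z)) (code l) (Over l)"
| "hok (Some z) l \<Longrightarrow> move (Over z) (code l) (Over l)"
| "move (Scan x (Some y) (Some z)) (Suc 0) (Marked x y z)"
| "l \<noteq> Hash \<Longrightarrow> move (Marked x y z) (code l) (Pair x y z l)"
| "move (Pair x y z l) 0 (HalfPair x y z l)"
| "l' \<noteq> Hash \<Longrightarrow> move (Pair x y z l) (code l') Excess"
| "move (Pair x y z l) (code Hash) End"
| "l' \<noteq> Hash \<Longrightarrow> move (HalfPair x y z l) (code l') (Pair x y z l')"
| "move (HalfPair x y z l) (code Hash) (Done (vok n x y z l))"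
| "l' \<noteq> Hash \<Longrightarrow> move Excess (code l') Excess"
| "move Excess (code Hash) End"
| "move (Done v) 0 Late"
| "move Late 0 Late"
| "move Init 0 First"
| "move First (code (Cell True P [1..<n])) PreChain"
| "move (Chain 0) (code (Cell False P [0])) Tail"
| "move Tail (code (Cell False P [])) Tail"
| "move Tail (code Hash) End"

inductive_simps move_simps:
  "move Init a s" "move (Scan x y z) a s" "move (Half x y z) a s" "move (Over l) a s"
  "move (Marked x y' z') a s" "move (Pair x y' z' l) a s" "move (HalfPair x y' z' l) a s"
  "move Excess a s" "move End a s" "move (Done v) a s" "move Late a s" "move First a s"
  "move PreChain a s" "move (Chain k) a s" "move Tail a s" "move Fin a s"

fun accepting :: "letter state \<Rightarrow> bool" where
  "accepting (Scan x y z) = (z \<noteq> None)"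
| "accepting (Over l) = True"
| "accepting (Done v) = v"
| "accepting Late = True"
| "accepting End = True"
| "accepting _ = False"

text \<open>Separated from \<open>move\<close> because only these transitions mention
  \<open>c\<close>, which will be the code of the list of all the others.\<close>

inductive chain_move :: "nat \<Rightarrow> letter state \<Rightarrow> nat \<Rightarrow> letter state \<Rightarrow> bool" for c where
  "chain_move c PreChain (Suc 0) (Chain c)"
| "k < c \<Longrightarrow> chain_move c (Chain (Suc k)) 2 (Chain k)"

inductive_simps chain_move_simps:
  "chain_move c Init a s" "chain_move c (Scan x y z) a s" "chain_move c (Half x y z) a s" "chain_move c (Over l) a s"
  "chain_move c (Marked x y' z') a s" "chain_move c (Pair x y' z' l) a s" "chain_move c (HalfPair x y' z' l) a s"
  "chain_move c Excess a s" "chain_move c End a s" "chain_move c (Done v) a s" "chain_move c Late a s" "chain_move c First a s"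
  "chain_move c PreChain a s" "chain_move c (Chain k) a s" "chain_move c Tail a s" "chain_move c Fin a s"

abbreviation ok :: "nat \<Rightarrow> letter state \<Rightarrow> nat list \<Rightarrow> bool" where
  "ok c \<equiv> accepts (\<lambda>s a s'. move s a s' \<or> chain_move c s a s') {s. accepting s}"

section \<open>Words accepted from the single states\<close>

fun hashed :: "letter list \<Rightarrow> bool" where
  "hashed [] = False"
| "hashed (l # ls) = (if l = Hash then ls = [] else hashed ls)"

lemma hashed_iff: "hashed vs \<longleftrightarrow> (\<exists>vs'. vs = vs' @ [Hash] \<and> Hash \<notin> set vs')"
proof (induction vs)
  case (Cons l ls)
  have "(\<exists>vs'. l # ls = vs' @ [Hash] \<and> Hash \<notin> set vs') \<longleftrightarrow> (if l = Hash then ls = [] else (\<exists>vs'. ls = vs' @ [Hash] \<and> Hash \<notin> set vs'))"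
    by (auto simp: Cons_eq_append_conv)
  then show ?case using Cons by simp
qed simp

lemma ok_End: "ok c End w \<longleftrightarrow> w = []"
  by (cases w) (auto simp: move_simps chain_move_simps)

lemma ok_Excess: "ok c Excess (map code vs) \<longleftrightarrow> hashed vs"
  by (induction vs) (auto simp: move_simps chain_move_simps ok_End)

lemma ok_Over: "ok c (Over z) (map code vs) \<longleftrightarrow> hchain (Some z) vs"
  by (induction vs arbitrary: z) (auto simp: move_simps chain_move_simps)

lemma ok_Scan_letters: "ok c (Scan x y z) (map code vs) \<longleftrightarrow> z \<noteq> None \<and> hchain z vs"
  by (cases vs; cases z) (auto simp: move_simps chain_move_simps ok_Over)

lemma ok_Late: "ok c Late (sync (replicate m 0) (map code vs)) \<longleftrightarrow> vs = []"
proof (induction m)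
  case 0
  then show ?case by (cases vs) (auto simp: move_simps chain_move_simps)
next
  case (Suc m)
  then show ?case by (cases vs) (auto simp: move_simps chain_move_simps)
qed

lemma ok_Done: "ok c (Done v) (sync (replicate m 0) (map code vs)) \<longleftrightarrow> vs = [] \<and> (m = 0 \<longrightarrow> v)"
  using ok_Late[of c "m - 1" vs]
  by (cases m; cases vs) (auto simp: move_simps chain_move_simps)

text \<open>The letter compared is the one just before \<open>Hash\<close>, and that is
  \<open>l\<close> itself when \<open>Hash\<close> comes at once. The condition
  \<open>length vs = m\<close> says that \<open>Hash\<close> pairs with the last tick.\<close>

lemma ok_Pair:
  "ok c (Pair x y z l) (sync (replicate m 0) (map code vs)) \<longleftrightarrow>
     hashed vs \<and> (length vs = m \<longrightarrow> vok n x y z (last (l # butlast vs)))"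
proof (induction m arbitrary: l vs)
  case 0
  then show ?case by (cases vs) (auto simp: move_simps chain_move_simps ok_End ok_Excess)
next
  case (Suc m)
  show ?case
  proof (cases vs)
    case Nil
    then show ?thesis by (cases m) (auto simp: move_simps chain_move_simps)
  next
    case (Cons l' vs')
    show ?thesis
    proof (cases "l' = Hash")
      case True
      then show ?thesis using Cons by (auto simp: move_simps chain_move_simps ok_Done)
    next
      case False
      have "ok c (Pair x y z l) (sync (replicate (Suc m) 0) (map code vs)) \<longleftrightarrow>
          ok c (Pair x y z l') (sync (replicate m 0) (map code vs'))"
        using False Cons by (auto simp: move_simps chain_move_simps)
      also have "\<dots> \<longleftrightarrow> hashed vs' \<and> (length vs' = m \<longrightarrow> vok n x y z (last (l' # butlast vs')))"
        by (rule Suc)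
      also have "\<dots> \<longleftrightarrow> hashed vs \<and> (length vs = Suc m \<longrightarrow> vok n x y z (last (l # butlast vs)))"
        using False Cons by (cases "vs' = []") auto
      finally show ?thesis .
    qed
  qed
qed

definition shift :: "letter option \<times> letter option \<times> letter option \<Rightarrow> letter \<Rightarrow> letter option \<times> letter option \<times> letter option" where
  "shift = (\<lambda>(x, y, z) l. (y, z, Some l))"

abbreviation scan :: "letter option \<times> letter option \<times> letter option \<Rightarrow> letter state" where
  "scan \<equiv> \<lambda>(x, y, z). Scan x y z"

lemma ok_Scan:
  assumes "set u \<subseteq> {0, 1}"
  shows "ok c (Scan x y z) (sync (replicate j 0 @ u) (map code vs)) \<longleftrightarrow>
    j \<le> length vs \<and> hchain z (take j vs) \<and>
    ok c (scan (foldl shift (x, y, z) (take j vs))) (sync u (map code (drop j vs)))"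
proof (induction j arbitrary: x y z vs)
  case 0
  then show ?case by simp
next
  case (Suc j)
  show ?case
  proof (cases vs)
    case Nil
    have "\<not> ok c (Half x y z) (replicate j 0 @ u)"
      using assms by (cases j; cases u) (auto simp: move_simps chain_move_simps)
    then show ?thesis using Nil by (auto simp: move_simps chain_move_simps)
  next
    case (Cons l vs')
    then show ?thesis
      using Suc by (auto simp: move_simps chain_move_simps shift_def)
  qed
qed

definition nth_last :: "nat \<Rightarrow> letter list \<Rightarrow> letter option" where
  "nth_last k ls = (if k \<le> length ls then Some (ls ! (length ls - k)) else None)"

lemma foldl_shift: "foldl shift (None, None, None) ls = (nth_last 3 ls, nth_last 2 ls, nth_last 1 ls)"
  by (induction ls rule: rev_induct) (auto simp: nth_last_def shift_def nth_append)

abbreviation "blank \<equiv> Cell False P []"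
abbreviation "mark0 \<equiv> Cell False P [0]"
abbreviation "start0 \<equiv> Cell True P [1..<n]"

lemma code_eq_2: "code l = 2 \<longleftrightarrow> l = blank" "2 = code l \<longleftrightarrow> l = blank"
  by (auto simp: code_def)

lemma ok_Tail: "ok c Tail (map code vs) \<longleftrightarrow> (\<exists>i. vs = replicate i blank @ [Hash])"
proof (induction vs)
  case Nil
  then show ?case by simp
next
  case (Cons l vs)
  have "ok c Tail (map code (l # vs)) \<longleftrightarrow> l = blank \<and> ok c Tail (map code vs) \<or> l = Hash \<and> vs = []"
    by (auto simp: move_simps chain_move_simps ok_End)
  also have "\<dots> \<longleftrightarrow> (\<exists>i. l # vs = replicate i blank @ [Hash])"
    unfolding Cons
  proof
    assume "l = blank \<and> (\<exists>i. vs = replicate i blank @ [Hash]) \<or> l = Hash \<and> vs = []"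
    then show "\<exists>i. l # vs = replicate i blank @ [Hash]"
      by (metis append_Cons append_Nil replicate_0 replicate_Suc)
  next
    assume "\<exists>i. l # vs = replicate i blank @ [Hash]"
    then obtain i where "l # vs = replicate i blank @ [Hash]" by blast
    then show "l = blank \<and> (\<exists>i. vs = replicate i blank @ [Hash]) \<or> l = Hash \<and> vs = []"
      by (cases i) auto
  qed
  finally show ?case .
qed

lemma ok_Chain:
  "k \<le> c \<Longrightarrow> ok c (Chain k) (map code vs) \<longleftrightarrow>
    (\<exists>i. vs = replicate k blank @ mark0 # replicate i blank @ [Hash])"
proof (induction k arbitrary: vs)
  case 0
  then show ?case by (cases vs) (auto simp: move_simps chain_move_simps ok_Tail)
next
  case (Suc k)
  then show ?case by (cases vs) (auto simp: move_simps chain_move_simps code_eq_2)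
qed

lemma set_sync: "set (sync u v) = set u \<union> set v"
  by (induction u v rule: sync.induct) auto

text \<open>The planted row is read when the input is already over, which confines this branch to
  the input \<open>[0, 1]\<close>.\<close>

lemma ok_Chain_letters:
  assumes "ok c s w" "s = Tail \<or> s = End \<or> (\<exists>k. s = Chain k)"
  shows "set w \<inter> {0, 1} = {}"
  using assms
proof (induction w arbitrary: s)
  case (Cons a w)
  then obtain s' where s': "move s a s' \<or> chain_move c s a s'" "ok c s' w" by auto
  have "(s' = Tail \<or> s' = End \<or> (\<exists>k. s' = Chain k)) \<and> a \<notin> {0, 1}"
    using s'(1) Cons.prems(2) by (auto simp: move_simps chain_move_simps)
  with Cons.IH s'(2) show ?case by auto
qed simp

lemma ok_marked_letters:
  assumes "ok c s w" "s \<in> {Excess, End, Late} \<union> range Done \<or> (\<exists>x y z l. s = Pair x y z l \<or> s = HalfPair x y z l)"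
  shows "1 \<notin> set w"
  using assms
proof (induction w arbitrary: s)
  case (Cons a w)
  then obtain s' where s': "move s a s' \<or> chain_move c s a s'" "ok c s' w" by auto
  have "(s' \<in> {Excess, End, Late} \<union> range Done \<or> (\<exists>x y z l. s' = Pair x y z l \<or> s' = HalfPair x y z l)) \<and> a \<noteq> 1"
    using s'(1) Cons.prems(2) by (auto simp: move_simps chain_move_simps)
  with Cons.IH s'(2) show ?case by auto
qed simp

section \<open>The three kinds of inputs: no mark, a mark after one tick, a later mark\<close>

lemma ok_Scan_mark: "ok c (Scan x (Some y) (Some z)) (1 # w) \<longleftrightarrow> ok c (Marked x y z) w"
  by (auto simp: move_simps chain_move_simps)

lemma ok_First: "ok c First w \<longleftrightarrow> (\<exists>w'. w = code start0 # 1 # w' \<and> ok c (Chain c) w')"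
  by (cases w; cases "tl w") (auto simp: move_simps chain_move_simps)

lemma ok_Init: "ok c Init (0 # w) \<longleftrightarrow> ok c (Scan None None None) (0 # w) \<or> ok c First w"
  by (auto simp: move_simps chain_move_simps)

lemma hchain_no_Hash: "hchain z vs \<Longrightarrow> Hash \<notin> set vs"
  by (induction vs arbitrary: z) auto

lemma hchain_append:
  "xs \<noteq> [] \<Longrightarrow> hchain z (xs @ ys) \<longleftrightarrow> hchain z xs \<and> hchain (Some (last xs)) ys"
proof (induction xs arbitrary: z)
  case (Cons x xs)
  then show ?case by (cases xs) auto
qed simp

lemma ok_Init_ticks:
  assumes "1 \<le> m"
  shows "ok c Init (sync (replicate m 0) (map code vs)) \<longleftrightarrow> m \<le> length vs \<and> hchain None vs"
proof -
  obtain w where w: "sync (replicate m 0) (map code vs) = 0 # w" "1 \<notin> set w"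
  proof (cases m; cases vs)
    fix j assume "m = Suc j" "vs = []"
    then show ?thesis using that by simp
  next
    fix j l vs' assume "m = Suc j" "vs = l # vs'"
    then show ?thesis using that by (auto simp: set_sync image_iff)
  qed (use assms in auto)
  then have "\<not> ok c First w" by (auto simp: ok_First)
  then have "ok c Init (sync (replicate m 0) (map code vs)) \<longleftrightarrow>
      ok c (Scan None None None) (sync (replicate m 0 @ []) (map code vs))"
    using w(1) by (simp only: ok_Init append_Nil2 simp_thms)
  also have "\<dots> \<longleftrightarrow> m \<le> length vs \<and> hchain None (take m vs) \<and>
      nth_last 1 (take m vs) \<noteq> None \<and> hchain (nth_last 1 (take m vs)) (drop m vs)"
    by (simp only: ok_Scan foldl_shift prod.case sync.simps ok_Scan_letters list.set empty_subsetI simp_thms)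
  also have "\<dots> \<longleftrightarrow> m \<le> length vs \<and> hchain None vs"
  proof (cases "m \<le> length vs")
    case True
    then have "take m vs \<noteq> []" using assms by auto
    then have "nth_last 1 (take m vs) = Some (last (take m vs))"
      using last_conv_nth[of "take m vs"] by (simp add: nth_last_def Suc_le_eq)
    then show ?thesis using True hchain_append[OF \<open>take m vs \<noteq> []\<close>, of None "drop m vs"] by simp
  qed simp
  finally show ?thesis .
qed

text \<open>\<open>Scan\<close> passes a mark only with two letters behind it, so after a single
  tick just the guess \<open>First\<close> remains, and it asks for the planted row.\<close>

lemma ok_Init_mark:
  assumes "set u \<subseteq> {0, 1}"
  shows "ok c Init (sync (0 # 1 # u) (map code vs)) \<longleftrightarrow>
     u = [] \<and> (\<exists>i. vs = start0 # replicate c blank @ mark0 # replicate i blank @ [Hash])"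
proof (cases vs)
  case Nil
  then show ?thesis by (auto simp: move_simps chain_move_simps)
next
  case (Cons l vs')
  obtain w where w: "sync (1 # u) (map code vs') = 1 # w" "set u \<subseteq> set w" "u = [] \<Longrightarrow> w = map code vs'"
    by (cases vs'; cases u) (auto simp: set_sync)
  have 1: "sync (0 # 1 # u) (map code vs) = 0 # code l # 1 # w" using w Cons by simp
  have "\<not> ok c (Scan None None None) (0 # code l # 1 # w)"
    by (auto simp: move_simps chain_move_simps)
  then have "ok c Init (sync (0 # 1 # u) (map code vs)) \<longleftrightarrow> l = start0 \<and> ok c (Chain c) w"
    by (simp only: 1 ok_Init ok_First simp_thms) auto
  also have "\<dots> \<longleftrightarrow> l = start0 \<and> u = [] \<and> ok c (Chain c) (map code vs')"
    using assms w ok_Chain_letters[of c "Chain c" w] by (cases u) auto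
  finally show ?thesis using Cons by (auto simp: ok_Chain)
qed

lemma ok_Init_ticks_mark:
  assumes "2 \<le> j" "set u \<subseteq> {0, 1}"
  shows "ok c Init (sync (replicate j 0 @ 1 # u) (map code vs)) \<longleftrightarrow>
     j < length vs \<and> hchain None (take j vs) \<and> vs ! j \<noteq> Hash \<and>
     ok c (Pair (nth_last 3 (take j vs)) (vs ! (j - 2)) (vs ! (j - 1)) (vs ! j)) (sync u (map code (drop (Suc j) vs)))"
proof -
  obtain w where w: "sync (replicate j 0 @ 1 # u) (map code vs) = 0 # w" "\<not> ok c First w"
  proof (cases vs)
    case Nil
    obtain i where "j = Suc (Suc i)" using assms(1) by (metis One_nat_def Suc_1 Suc_le_D Suc_le_mono)
    then show ?thesis using that Nil by (auto simp: ok_First)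
  next
    case (Cons l vs')
    obtain i where "j = Suc (Suc i)" using assms(1) by (metis One_nat_def Suc_1 Suc_le_D Suc_le_mono)
    then show ?thesis using that Cons by (cases vs') (auto simp: ok_First)
  qed
  have "ok c Init (sync (replicate j 0 @ 1 # u) (map code vs)) \<longleftrightarrow>
      ok c (Scan None None None) (sync (replicate j 0 @ 1 # u) (map code vs))"
    using w by (simp only: ok_Init simp_thms)
  also have "\<dots> \<longleftrightarrow> j \<le> length vs \<and> hchain None (take j vs) \<and>
     ok c (Scan (nth_last 3 (take j vs)) (nth_last 2 (take j vs)) (nth_last 1 (take j vs)))
       (sync (1 # u) (map code (drop j vs)))"
    using ok_Scan[of "1 # u" c None None None j vs] assms(2) unfolding foldl_shift by auto
  also have "\<dots> \<longleftrightarrow> j \<le> length vs \<and> hchain None (take j vs) \<and>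
     ok c (Marked (nth_last 3 (take j vs)) (vs ! (j - 2)) (vs ! (j - 1)))
       (tl (sync (1 # u) (map code (drop j vs))))"
  proof -
    have "sync (1 # u) (map code (drop j vs)) = 1 # tl (sync (1 # u) (map code (drop j vs)))"
      by (cases "drop j vs") auto
    moreover have "j \<le> length vs \<Longrightarrow> nth_last 2 (take j vs) = Some (vs ! (j - 2)) \<and> nth_last 1 (take j vs) = Some (vs ! (j - 1))"
      using assms(1) by (auto simp: nth_last_def)
    ultimately show ?thesis
      by (metis (no_types, lifting) ok_Scan_mark)
  qed
  also have "\<dots> \<longleftrightarrow> j < length vs \<and> hchain None (take j vs) \<and> vs ! j \<noteq> Hash \<and>
     ok c (Pair (nth_last 3 (take j vs)) (vs ! (j - 2)) (vs ! (j - 1)) (vs ! j)) (sync u (map code (drop (Suc j) vs)))"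
  proof (cases "j < length vs")
    case True
    then show ?thesis
      unfolding Cons_nth_drop_Suc[OF True, symmetric]
      by (auto simp: move_simps chain_move_simps)
  next
    case False
    then show ?thesis using assms(2) by (cases u) (auto simp: move_simps chain_move_simps)
  qed
  finally show ?thesis .
qed

text \<open>The checked letter sits at \<open>j - 2\<close>, so that its right neighbour at
  \<open>j - 1\<close> is also known at the mark. Input and output, the latter with
  \<open>Hash\<close>, have lengths \<open>j + 1 + l\<close> and \<open>length vs + 1\<close>; if
  they agree, the last letter of \<open>vs\<close> stands \<open>l + 1\<close> places after the
  checked one.\<close>

definition marked :: "nat \<Rightarrow> nat \<Rightarrow> letter list \<Rightarrow> bool" where
  "marked j l vs \<longleftrightarrow> Hash \<notin> set vs \<and> j < length vs \<and> hchain None (take j vs) \<and>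
     (length vs = j + l \<longrightarrow> vok n (nth_last 3 (take j vs)) (vs ! (j - 2)) (vs ! (j - 1)) (last vs))"

lemma ok_Init_marked:
  assumes "2 \<le> j"
  shows "ok c Init (sync (replicate j 0 @ 1 # replicate l 0) (map code vs)) \<longleftrightarrow>
     (\<exists>vs'. vs = vs' @ [Hash] \<and> marked j l vs')"
proof -
  let ?V = "\<lambda>vs. vok n (nth_last 3 (take j vs)) (vs ! (j - 2)) (vs ! (j - 1))"
  have "ok c Init (sync (replicate j 0 @ 1 # replicate l 0) (map code vs)) \<longleftrightarrow>
     j < length vs \<and> hchain None (take j vs) \<and> vs ! j \<noteq> Hash \<and> hashed (drop (Suc j) vs) \<and>
     (length vs - Suc j = l \<longrightarrow> ?V vs (last (vs ! j # butlast (drop (Suc j) vs))))"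
    by (subst ok_Init_ticks_mark[OF assms]) (auto simp: ok_Pair)
  also have "\<dots> \<longleftrightarrow> (\<exists>vs'. vs = vs' @ [Hash] \<and> marked j l vs')"
  proof (intro iffI)
    assume a: "j < length vs \<and> hchain None (take j vs) \<and> vs ! j \<noteq> Hash \<and> hashed (drop (Suc j) vs) \<and>
     (length vs - Suc j = l \<longrightarrow> ?V vs (last (vs ! j # butlast (drop (Suc j) vs))))"
    then obtain ws where ws: "drop (Suc j) vs = ws @ [Hash]" "Hash \<notin> set ws" by (auto simp: hashed_iff)
    define vs' where "vs' = take j vs @ vs ! j # ws"
    have vs: "vs = vs' @ [Hash]"
      using a ws(1) id_take_nth_drop[of j vs] unfolding vs'_def by simp
    have "marked j l vs'"
      unfolding marked_def
    proof (intro conjI impI)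
      show "Hash \<notin> set vs'" using a ws(2) hchain_no_Hash unfolding vs'_def by auto
      show "j < length vs'" using a by (auto simp: vs'_def)
      show "hchain None (take j vs')" using a by (simp add: vs'_def)
      assume "length vs' = j + l"
      then have "length vs - Suc j = l" by (simp add: vs)
      with a have "?V vs (last (vs ! j # butlast (drop (Suc j) vs)))" by blast
      then have "?V vs (last (vs ! j # ws))" by (simp only: ws(1) butlast_snoc)
      then show "vok n (nth_last 3 (take j vs')) (vs' ! (j - 2)) (vs' ! (j - 1)) (last vs')"
      proof -
        have "take j vs = take j vs'" "vs ! (j - 2) = vs' ! (j - 2)" "vs ! (j - 1) = vs' ! (j - 1)"
          using \<open>j < length vs'\<close> less_imp_diff_less[of j "length vs'"] by (simp_all add: vs nth_append)
        moreover have "last vs' = last (vs ! j # ws)" by (simp add: vs'_def)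
        ultimately show ?thesis using \<open>?V vs (last (vs ! j # ws))\<close> by (simp only:)
      qed
    qed
    with vs show "\<exists>vs'. vs = vs' @ [Hash] \<and> marked j l vs'" by blast
  next
    assume "\<exists>vs'. vs = vs' @ [Hash] \<and> marked j l vs'"
    then obtain vs' where vs: "vs = vs' @ [Hash]" and m: "marked j l vs'" by blast
    then have j: "j < length vs'" "Hash \<notin> set vs'" by (auto simp: marked_def)
    have d: "drop (Suc j) vs = drop (Suc j) vs' @ [Hash]" using j vs by simp
    have "last (vs ! j # drop (Suc j) vs') = last (drop j vs')"
      using j by (simp add: vs nth_append Cons_nth_drop_Suc)
    then have "last (vs ! j # drop (Suc j) vs') = last vs'" using j by simp
    moreover have "Hash \<notin> set (drop (Suc j) vs')" using j by (auto dest: in_set_dropD)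
    moreover have "vs' ! j \<noteq> Hash" using j by (metis nth_mem)
    then have "vs ! j \<noteq> Hash" using j by (simp add: vs nth_append)
    ultimately show "j < length vs \<and> hchain None (take j vs) \<and> vs ! j \<noteq> Hash \<and> hashed (drop (Suc j) vs) \<and>
     (length vs - Suc j = l \<longrightarrow> ?V vs (last (vs ! j # butlast (drop (Suc j) vs))))"
      unfolding d hashed_iff using m by (auto simp: marked_def vs nth_append)
  qed
  finally show ?thesis .
qed

lemma ok_Init_dom:
  assumes "ok c Init (sync u (map code vs))" "set u \<subseteq> {0, 1}"
  shows "(\<exists>m\<ge>1. u = replicate m 0) \<or> u = [0, 1] \<or> (\<exists>j\<ge>2. \<exists>l. u = replicate j 0 @ 1 # replicate l 0)"
proof -
  have rep: "set w \<subseteq> {0, 1} \<Longrightarrow> 1 \<notin> set w \<Longrightarrow> w = replicate (length w) 0" for w :: "nat list"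
    by (induction w) auto
  show ?thesis
  proof (cases "1 \<in> set u")
    case True
    then obtain x w where u: "u = x @ 1 # w" "1 \<notin> set x" by (meson split_list_first)
    then have x: "x = replicate (length x) 0" using assms(2) rep by auto
    have w: "set w \<subseteq> {0, 1}" using assms(2) u by simp
    consider "length x = 0" | "length x = 1" | "2 \<le> length x" by linarith
    then show ?thesis
    proof cases
      case 1
      then have "u = 1 # w" using u by simp
      with assms(1) show ?thesis by (cases vs) (auto simp: move_simps chain_move_simps)
    next
      case 2
      then have "u = 0 # 1 # w" using u x by (metis One_nat_def append_Cons append_Nil replicate_0 replicate_Suc)
      then show ?thesis using assms(1) w by (simp only: ok_Init_mark) blast
    next
      case 3
      have "ok c Init (sync (replicate (length x) 0 @ 1 # w) (map code vs))"
        using assms(1) u(1) x by metis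
      then have "1 \<notin> set (sync w (map code (drop (Suc (length x)) vs)))"
        unfolding ok_Init_ticks_mark[OF 3 w] using ok_marked_letters by blast
      then have "w = replicate (length w) 0" using rep w by (simp add: set_sync)
      then show ?thesis using u(1) x 3 by metis
    qed
  next
    case False
    then have u: "u = replicate (length u) 0" using assms(2) rep by auto
    moreover have "u \<noteq> []"
      using assms(1) by (cases vs) (auto simp: move_simps chain_move_simps)
    ultimately show ?thesis by (metis One_nat_def Suc_leI length_greater_0_conv)
  qed
qed

end

section \<open>The automaton\<close>

text \<open>Guessing the last letter makes the list of final states independent of the program.\<close>

lemma accepts_guess:
  assumes "\<And>s a. \<not> \<tau> s a e" "\<And>a s. \<not> \<tau> e a s" "e \<notin> F"
  shows "accepts (\<lambda>s a s'. \<tau> s a s' \<or> s' = e \<and> (\<exists>q\<in>F. \<tau> s a q)) {e} s w \<longleftrightarrow>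
     (if w = [] then s = e else accepts \<tau> F s w)"
proof (induction w arbitrary: s)
  case (Cons a w)
  let ?g = "accepts (\<lambda>s a s'. \<tau> s a s' \<or> s' = e \<and> (\<exists>q\<in>F. \<tau> s a q)) {e}"
  show ?case
  proof (cases "w = []")
    case True
    have "?g s [a] \<longleftrightarrow> (\<exists>q\<in>F. \<tau> s a q)" using assms(1) by auto
    moreover have "accepts \<tau> F s [a] \<longleftrightarrow> (\<exists>q\<in>F. \<tau> s a q)" by auto
    ultimately show ?thesis using True by (simp only: list.distinct if_False)
  next
    case False
    have IH: "?g s' w \<longleftrightarrow> accepts \<tau> F s' w" for s' using Cons.IH[of s'] False by (simp only: if_False)
    have e: "\<not> accepts \<tau> F e w" using False assms(2) by (cases w) auto
    have "?g s (a # w) \<longleftrightarrow> (\<exists>s'. (\<tau> s a s' \<or> s' = e \<and> (\<exists>q\<in>F. \<tau> s a q)) \<and> accepts \<tau> F s' w)"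
      by (simp only: accepts.simps IH)
    also have "\<dots> \<longleftrightarrow> accepts \<tau> F s (a # w)" using e by auto
    finally show ?thesis by (simp only: list.distinct if_False)
  qed
qed simp

context game
begin

definition letters :: "letter set" where
  "letters = {Dollar, Hash} \<union> {Cell s k X | s k X. k \<in> conts P [] \<and> X \<in> range (\<lambda>f. filter f [0..<n])}"

lemma finite_letters: "finite letters"
proof -
  define R where "R = range (\<lambda>f. filter f [0..<n])"
  have "R \<subseteq> {X. set X \<subseteq> {..<n} \<and> length X \<le> n}"
    using length_filter_le[of _ "[0..<n]"] by (auto simp: R_def)
  then have R: "finite R"
    using finite_lists_length_le[of "{..<n}" n] finite_subset by blast
  have "l \<in> {Dollar, Hash} \<union> (\<lambda>(s, k, X). Cell s k X) ` ({True, False} \<times> conts P [] \<times> R)" if "l \<in> letters" for l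
  proof (cases l)
    case (Cell s k X)
    then have "k \<in> conts P []" "X \<in> R" using that by (auto simp: letters_def R_def)
    then have "(s, k, X) \<in> {True, False} \<times> conts P [] \<times> R" by simp
    from imageI[OF this, of "\<lambda>(s, k, X). Cell s k X"] show ?thesis using Cell by simp
  qed simp_all
  then have "letters \<subseteq> {Dollar, Hash} \<union> (\<lambda>(s, k, X). Cell s k X) ` ({True, False} \<times> conts P [] \<times> R)"
    by (rule subsetI)
  moreover have "finite ({Dollar, Hash} \<union> (\<lambda>(s, k, X). Cell s k X) ` ({True, False} \<times> conts P [] \<times> R))"
    using R finite_conts by (intro finite_UnI finite_imageI finite_cartesian_product) simp_all
  ultimately show ?thesis by (rule finite_subset)
qed

lemma filter_letters: "k \<in> conts P [] \<Longrightarrow> Cell s k (filter f [0..<n]) \<in> letters"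
  unfolding letters_def by auto

lemma cell_letters:
  assumes "2 \<le> n"
  shows "start0 \<in> letters" "blank \<in> letters" "mark0 \<in> letters" "Hash \<in> letters" "Dollar \<in> letters"
proof -
  have P: "P \<in> conts P []" using start_in_conts[of P "[]"] by simp
  have 0: "[0..<n] = 0 # [1..<n]" using assms upt_conv_Cons by simp
  have "filter (\<lambda>r. r \<noteq> 0) [0..<n] = [1..<n]" "filter (\<lambda>r. r = 0) [0..<n] = [0]" "filter (\<lambda>r. False) [0..<n] = []"
    unfolding 0 by (auto simp: filter_id_conv filter_empty_conv)
  then show "start0 \<in> letters" "blank \<in> letters" "mark0 \<in> letters"
    using filter_letters[OF P] by metis+
qed (auto simp: letters_def)

text \<open>The states \<open>Chain (Suc k)\<close> are left to the planted chain, which keeps this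
  set finite and independent of \<open>c\<close>.\<close>

definition states :: "letter state set" where
  "states = {s. set_state s \<subseteq> letters \<and> (\<forall>k. s \<noteq> Chain (Suc k))}"

lemma finite_states: "finite states"
proof -
  define opts where "opts = insert None (Some ` letters)"
  have O: "set_option x \<subseteq> letters \<longleftrightarrow> x \<in> opts" for x
    unfolding opts_def by (cases x) auto
  have fO: "finite opts" unfolding opts_def using finite_letters by simp
  have f3: "finite {f x y z | x y z. x \<in> A \<and> y \<in> B \<and> z \<in> C}"
    if "finite A" "finite B" "finite C" for f :: "'x \<Rightarrow> 'y \<Rightarrow> 'z \<Rightarrow> letter state" and A B C
  proof -
    have "{f x y z | x y z. x \<in> A \<and> y \<in> B \<and> z \<in> C} = (\<lambda>(x, y, z). f x y z) ` (A \<times> B \<times> C)" by force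
    then show ?thesis using that by simp
  qed
  have f4: "finite {f x y z l | x y z l. x \<in> A \<and> y \<in> B \<and> z \<in> C \<and> l \<in> D}"
    if "finite A" "finite B" "finite C" "finite D" for f :: "'x \<Rightarrow> 'y \<Rightarrow> 'z \<Rightarrow> 'l \<Rightarrow> letter state" and A B C D
  proof -
    have "{f x y z l | x y z l. x \<in> A \<and> y \<in> B \<and> z \<in> C \<and> l \<in> D} = (\<lambda>(x, y, z, l). f x y z l) ` (A \<times> B \<times> C \<times> D)"
      by force
    then show ?thesis using that by simp
  qed
  let ?S = "{Init, Excess, End, Done True, Done False, Late, First, PreChain, Chain 0, Tail, Fin} \<union> Over ` letters
    \<union> {Scan x y z | x y z. x \<in> opts \<and> y \<in> opts \<and> z \<in> opts} \<union> {Half x y z | x y z. x \<in> opts \<and> y \<in> opts \<and> z \<in> opts}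
    \<union> {Marked x y z | x y z. x \<in> opts \<and> y \<in> letters \<and> z \<in> letters}
    \<union> {Pair x y z l | x y z l. x \<in> opts \<and> y \<in> letters \<and> z \<in> letters \<and> l \<in> letters}
    \<union> {HalfPair x y z l | x y z l. x \<in> opts \<and> y \<in> letters \<and> z \<in> letters \<and> l \<in> letters}"
  have "s \<in> ?S" if "s \<in> states" for s
  proof (cases s)
    case (Chain k)
    then show ?thesis using that by (cases k) (auto simp: states_def)
  qed (use that in \<open>auto simp: states_def O\<close>)
  moreover have "finite ?S"
    using finite_letters fO by (intro finite_UnI f3 f4) auto
  ultimately show ?thesis by (meson finite_subset subsetI)
qed

fun chain_index :: "letter state \<Rightarrow> nat option" where
  "chain_index (Chain k) = Some k"
| "chain_index _ = None"

lemma chain_index_Some: "chain_index s = Some k \<longleftrightarrow> s = Chain k"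
  by (cases s) auto

definition num :: "letter state \<Rightarrow> nat" where
  "num s = (case chain_index s of Some k \<Rightarrow> 2 * k + 1
     | None \<Rightarrow> if s = Init then 0 else if s = Fin then 2 else if s = PreChain then 4 else 6 + 2 * to_nat s)"

lemma num_even: "even (num s) \<longleftrightarrow> chain_index s = None"
  by (cases "chain_index s") (simp_all add: num_def)

lemma inj_num: "inj num"
proof (rule injI)
  fix s s' assume e: "num s = num s'"
  show "s = s'"
  proof (cases "chain_index s")
    case None
    then have "chain_index s' = None" using e num_even by metis
    with None e show ?thesis by (simp add: num_def split: if_split_asm)
  next
    case (Some k)
    then have "chain_index s' \<noteq> None" using e num_even by (metis option.distinct(1))
    then obtain k' where "chain_index s' = Some k'" by blast
    then show ?thesis using Some e by (simp add: num_def chain_index_Some)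
  qed
qed

definition alphabet :: "nat set" where
  "alphabet = {0, 1} \<union> code ` letters"

definition guess :: "letter state \<Rightarrow> nat \<Rightarrow> letter state \<Rightarrow> bool" where
  "guess s a s' \<longleftrightarrow> s \<in> states \<and> a \<in> alphabet \<and> (move s a s' \<or> s' = Fin \<and> (\<exists>q. accepting q \<and> move s a q))"

lemma move_states:
  assumes "2 \<le> n" "s \<in> states" "a \<in> alphabet" "move s a s'"
  shows "s' \<in> states"
  using assms(4,2,3) cell_letters[OF assms(1)]
  by (cases rule: move.cases) (auto simp: states_def alphabet_def)

text \<open>Any list will do: it is determined by the program, and nothing has to compute it from
  the program, whose only access to its code is the planted input.\<close>

definition base :: "(nat \<times> nat \<times> nat) list" where
  "base = (SOME T. set T = {(num s, a, num s') | s a s'. guess s a s'})"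

lemma set_base:
  assumes "2 \<le> n"
  shows "set base = {(num s, a, num s') | s a s'. guess s a s'}"
proof -
  have "s' \<in> states \<and> s \<in> states \<and> a \<in> alphabet" if "guess s a s'" for s a s'
  proof -
    have g: "s \<in> states" "a \<in> alphabet" "move s a s' \<or> s' = Fin"
      using that unfolding guess_def by blast+
    have "Fin \<in> states" by (simp add: states_def)
    then show ?thesis using g move_states[OF assms g(1,2)] by blast
  qed
  then have "{(num s, a, num s') | s a s'. guess s a s'} \<subseteq> num ` states \<times> alphabet \<times> num ` states"
    by (intro subsetI) (elim CollectE exE conjE, simp)
  moreover have "finite (num ` states \<times> alphabet \<times> num ` states)"
    using finite_states finite_letters by (intro finite_cartesian_product finite_imageI) (simp_all add: alphabet_def)
  ultimately have "finite {(num s, a, num s') | s a s'. guess s a s'}" by (rule finite_subset)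
  then have "\<exists>T. set T = {(num s, a, num s') | s a s'. guess s a s'}" by (rule finite_list)
  then show ?thesis unfolding base_def by (rule someI_ex)
qed

lemma set_chain: "set (chain c) = {(num (Chain (Suc k)), 2, num (Chain k)) | k. k < c}"
  by (induction c) (auto simp: num_def less_Suc_eq)

lemma set_planted:
  assumes "2 \<le> n"
  shows "(p, a, q) \<in> set ((4, 1, 2 * c + 1) # chain c @ base) \<longleftrightarrow>
    (\<exists>s s'. p = num s \<and> q = num s' \<and> (guess s a s' \<or> chain_move c s a s'))"
proof -
  have 1: "(p, a, q) \<in> set base \<longleftrightarrow> (\<exists>s s'. p = num s \<and> q = num s' \<and> guess s a s')"
    unfolding set_base[OF assms] by auto
  have n: "num PreChain = 4" "num (Chain c) = 2 * c + 1" by (simp_all add: num_def)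
  have 2: "(p, a, q) = (4, 1, 2 * c + 1) \<or> (p, a, q) \<in> set (chain c) \<longleftrightarrow>
      (\<exists>s s'. p = num s \<and> q = num s' \<and> chain_move c s a s')"
  proof
    assume "(p, a, q) = (4, 1, 2 * c + 1) \<or> (p, a, q) \<in> set (chain c)"
    then consider "p = num PreChain" "a = Suc 0" "q = num (Chain c)"
      | k where "k < c" "p = num (Chain (Suc k))" "a = 2" "q = num (Chain k)"
      unfolding set_chain using n by auto
    then show "\<exists>s s'. p = num s \<and> q = num s' \<and> chain_move c s a s'"
      using chain_move.intros by cases metis+
  next
    assume "\<exists>s s'. p = num s \<and> q = num s' \<and> chain_move c s a s'"
    then obtain s s' where s: "p = num s" "q = num s'" "chain_move c s a s'" by blast
    from s(3) show "(p, a, q) = (4, 1, 2 * c + 1) \<or> (p, a, q) \<in> set (chain c)"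
    proof cases
      case 1
      then show ?thesis using s n by simp
    next
      case (2 k)
      then show ?thesis unfolding set_chain using s by blast
    qed
  qed
  have "(p, a, q) \<in> set ((4, 1, 2 * c + 1) # chain c @ base) \<longleftrightarrow>
      ((p, a, q) = (4, 1, 2 * c + 1) \<or> (p, a, q) \<in> set (chain c)) \<or> (p, a, q) \<in> set base"
    by (simp only: list.set set_append Un_iff insert_iff disj_assoc)
  then show ?thesis unfolding 1 2 by blast
qed

definition restricted :: "nat \<Rightarrow> letter state \<Rightarrow> nat \<Rightarrow> letter state \<Rightarrow> bool" where
  "restricted c s a s' \<longleftrightarrow> s \<in> states \<and> a \<in> alphabet \<and> move s a s' \<or> chain_move c s a s'"

text \<open>A move on a letter of the alphabet stores only such letters in the next state, so the
  restriction to finitely many states loses nothing but words over other letters.\<close>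

lemma accepts_restricted:
  assumes "2 \<le> n" "set_state s \<subseteq> letters"
  shows "accepts (restricted c) {s. accepting s} s w \<longleftrightarrow> set w \<subseteq> alphabet \<and> ok c s w"
  using assms(2)
proof (induction w arbitrary: s)
  case (Cons a w)
  have 1: "s \<in> states" if "move s a s'" for s'
    using that Cons.prems unfolding states_def by (auto elim: move.cases)
  have 2: "a \<in> alphabet" if "chain_move c s a s'" for s'
    using that
  proof cases
    case 2
    then show ?thesis
      using cell_letters(2)[OF assms(1)] code_blank unfolding alphabet_def by (metis UnI2 imageI)
  qed (simp add: alphabet_def)
  have r: "restricted c s a s' \<longleftrightarrow> a \<in> alphabet \<and> (move s a s' \<or> chain_move c s a s')" for s'
    unfolding restricted_def using 1 2 by blast
  have l: "set_state s' \<subseteq> letters" if "restricted c s a s'" for s'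
    using that unfolding restricted_def
  proof
    assume "s \<in> states \<and> a \<in> alphabet \<and> move s a s'"
    then have "s' \<in> states" using move_states[OF assms(1)] by blast
    then show ?thesis by (simp add: states_def)
  next
    assume "chain_move c s a s'"
    then show ?thesis by cases simp_all
  qed
  have "accepts (restricted c) {s. accepting s} s (a # w) \<longleftrightarrow>
      (\<exists>s'. restricted c s a s' \<and> set w \<subseteq> alphabet \<and> ok c s' w)"
    using Cons.IH l by (simp only: accepts.simps) blast
  also have "\<dots> \<longleftrightarrow> set (a # w) \<subseteq> alphabet \<and> ok c s (a # w)"
    unfolding r by (simp only: accepts.simps list.set insert_subset) blast
  finally show ?case .
qed simp

lemma planted_lang:
  assumes "2 \<le> n"
  shows "w \<in> nfa_lang (planted base c) \<longleftrightarrow> w \<noteq> [] \<and> set w \<subseteq> alphabet \<and> ok c Init w"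
proof -
  have lift: "(\<lambda>p a q. (p, a, q) \<in> set ((4, 1, 2 * c + 1) # chain c @ base)) =
      (\<lambda>p a q. \<exists>s s'. p = num s \<and> q = num s' \<and> (guess s a s' \<or> chain_move c s a s'))"
    unfolding set_planted[OF assms] ..
  have num: "num Init = 0" "num ` {Fin} = set [2]" by (simp_all add: num_def)
  have no_in: "\<not> restricted c s a Fin" and no_out: "\<not> restricted c Fin a s" for s a
    unfolding restricted_def by (auto elim: move.cases chain_move.cases)
  have eq: "(\<lambda>s a s'. guess s a s' \<or> chain_move c s a s') =
      (\<lambda>s a s'. restricted c s a s' \<or> s' = Fin \<and> (\<exists>q\<in>{s. accepting s}. restricted c s a q))"
  proof (intro ext)
    fix s a s'
    \<comment> \<open>No chain move ends in an accepting state. So the moves of the program alone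
      can guess the last letter, and the planted part needs no transitions into
      \<open>Fin\<close>.\<close>
    have "\<not> accepting q" if "chain_move c s a q" for q
      using that by cases simp_all
    then show "(guess s a s' \<or> chain_move c s a s') =
        (restricted c s a s' \<or> s' = Fin \<and> (\<exists>q\<in>{s. accepting s}. restricted c s a q))"
      unfolding guess_def restricted_def by blast
  qed
  have "w \<in> nfa_lang (planted base c) \<longleftrightarrow> accepts (\<lambda>s a s'. guess s a s' \<or> chain_move c s a s') {Fin} Init w"
    unfolding planted_def nfa_lang_accepts lift
    using accepts_transfer[OF inj_num, of "\<lambda>s a s'. guess s a s' \<or> chain_move c s a s'" "{Fin}" Init w]
    unfolding num by (simp del: accepts.simps)
  also have "\<dots> \<longleftrightarrow> (if w = [] then (Init :: letter state) = Fin else accepts (restricted c) {s. accepting s} Init w)"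
    unfolding eq by (rule accepts_guess) (use no_in no_out in auto)
  also have "\<dots> \<longleftrightarrow> w \<noteq> [] \<and> set w \<subseteq> alphabet \<and> ok c Init w"
    using accepts_restricted[OF assms, of Init c w] by (auto simp del: accepts.simps)
  finally show ?thesis .
qed

lemma letters_le_code:
  assumes "2 \<le> n"
  shows "code ` letters \<subseteq> set (out_letters (code_trans base))"
proof
  fix a assume "a \<in> code ` letters"
  then obtain l where l: "a = code l" "l \<in> letters" by auto
  \<comment> \<open>\<open>Excess\<close> reads every letter, hence each letter labels some
    transition of \<open>base\<close> and is bounded by the code.\<close>
  have "guess Excess a (if l = Hash then End else Excess)"
    unfolding guess_def using l by (auto simp: states_def alphabet_def intro: move.intros)
  then have "(num Excess, a, num (if l = Hash then End else Excess)) \<in> set base"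
    unfolding set_base[OF assms] by blast
  then show "a \<in> set (out_letters (code_trans base))"
    using letter_le_code code_ge[of l] l(1) by (simp add: set_out_letters le_imp_less_Suc less_SucI)
qed

lemma shape_pair: "in_sync_shape \<Sigma> \<Gamma> w \<Longrightarrow> a \<in> \<Sigma> \<Longrightarrow> b \<in> \<Gamma> \<Longrightarrow> in_sync_shape \<Sigma> \<Gamma> (a # b # w)"
proof -
  assume "in_sync_shape \<Sigma> \<Gamma> w" and ab: "a \<in> \<Sigma>" "b \<in> \<Gamma>"
  then obtain ps t where "w = concat (map (\<lambda>(a, b). [a, b]) ps) @ t"
    "\<forall>(a, b)\<in>set ps. a \<in> \<Sigma> \<and> b \<in> \<Gamma>" "set t \<subseteq> \<Sigma> \<or> set t \<subseteq> \<Gamma>" unfolding in_sync_shape_def by blast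
  then show ?thesis unfolding in_sync_shape_def
    using ab by (intro exI[of _ "(a, b) # ps"] exI[of _ t]) auto
qed

lemma shape_tail: "set w \<subseteq> \<Sigma> \<or> set w \<subseteq> \<Gamma> \<Longrightarrow> in_sync_shape \<Sigma> \<Gamma> w"
  unfolding in_sync_shape_def by (intro exI[of _ "[]"] exI[of _ w]) auto

definition shaped :: "nat set \<Rightarrow> nat list \<Rightarrow> bool" where
  "shaped \<Gamma> w \<longleftrightarrow> in_sync_shape {0, 1} \<Gamma> w"

definition half_shaped :: "nat set \<Rightarrow> nat list \<Rightarrow> bool" where
  "half_shaped \<Gamma> w \<longleftrightarrow> (\<exists>b w'. w = b # w' \<and> b \<in> \<Gamma> \<and> shaped \<Gamma> w')"

text \<open>The invariant behind \<open>ok_shape\<close>: some states owe the output half of a pair,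
  some admit only output from now on, some only input, and the remaining ones stand between two
  pairs.\<close>

fun state_shape :: "nat set \<Rightarrow> letter state \<Rightarrow> nat list \<Rightarrow> bool" where
  "state_shape \<Gamma> (Half x y z) w = half_shaped \<Gamma> w"
| "state_shape \<Gamma> (Marked x y' z') w = half_shaped \<Gamma> w"
| "state_shape \<Gamma> (HalfPair x y' z' l) w = half_shaped \<Gamma> w"
| "state_shape \<Gamma> First w = half_shaped \<Gamma> w"
| "state_shape \<Gamma> (Chain k) w = (w \<noteq> [] \<and> set w \<subseteq> \<Gamma>)"
| "state_shape \<Gamma> (Over z) w = (set w \<subseteq> \<Gamma>)"
| "state_shape \<Gamma> Excess w = (set w \<subseteq> \<Gamma>)"
| "state_shape \<Gamma> Tail w = (set w \<subseteq> \<Gamma>)"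
| "state_shape \<Gamma> End w = (w = [])"
| "state_shape \<Gamma> (Done v) w = (set w \<subseteq> {0, 1})"
| "state_shape \<Gamma> Late w = (set w \<subseteq> {0, 1})"
| "state_shape \<Gamma> _ w = shaped \<Gamma> w"

lemma ok_shape:
  assumes "alphabet - {0, 1} \<subseteq> \<Gamma>" "ok c s w" "set w \<subseteq> alphabet"
  shows "state_shape \<Gamma> s w"
  using assms(2,3)
proof (induction w arbitrary: s)
  case Nil
  then show ?case by (cases s) (auto simp: shaped_def shape_tail)
next
  case (Cons a w)
  then obtain s' where s': "move s a s' \<or> chain_move c s a s'" "ok c s' w" by auto
  then have IH: "state_shape \<Gamma> s' w" using Cons by auto
  have G: "code l \<in> \<Gamma>" if "code l = a" for l
    using that assms(1) Cons.prems code_neq[of l] by auto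
  have p: "half_shaped \<Gamma> w \<Longrightarrow> b \<in> {0, 1} \<Longrightarrow> shaped \<Gamma> (b # w)" for b
    unfolding half_shaped_def shaped_def using shape_pair by blast
  have q: "set w \<subseteq> \<Gamma> \<Longrightarrow> b \<in> \<Gamma> \<Longrightarrow> shaped \<Gamma> (b # w)" for b
    unfolding shaped_def by (intro shape_tail) auto
  have r: "set w \<subseteq> {0, 1} \<Longrightarrow> shaped \<Gamma> w" for w
    unfolding shaped_def by (intro shape_tail) auto
  have t: "w \<noteq> [] \<Longrightarrow> set w \<subseteq> \<Gamma> \<Longrightarrow> half_shaped \<Gamma> w"
    unfolding half_shaped_def shaped_def by (cases w) (auto intro: shape_tail)
  from s'(1) show ?case
  proof
    assume "move s a s'"
    then show ?thesis using IH
      by (cases rule: move.cases) (use G p q r t in \<open>auto simp: half_shaped_def\<close>)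
  next
    assume "chain_move c s a s'"
    then show ?thesis using IH G[of blank] p t
      by (cases rule: chain_move.cases) (auto simp: code_blank)
  qed
qed

theorem inst_valid:
  assumes "2 \<le> n"
  shows "valid_instance (inst pace_nfa base)"
  unfolding valid_instance_def inst_def prod.case
proof (intro conjI ballI)
  let ?c = "code_trans base"
  show "set [0, 1] \<inter> set (out_letters ?c) = {}" by (auto simp: set_out_letters)
  fix w assume "w \<in> nfa_lang (planted base ?c)"
  then have w: "ok ?c Init w" "set w \<subseteq> alphabet" using planted_lang[OF assms] by auto
  have "alphabet - {0, 1} \<subseteq> set (out_letters ?c)"
    using letters_le_code[OF assms] by (auto simp: alphabet_def)
  from ok_shape[OF this w] show "in_sync_shape (set [0, 1]) (set (out_letters ?c)) w"
    by (simp add: shaped_def)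
qed (rule pace_letters)

definition rel :: "(nat list \<times> nat list) set" where
  "rel = rel_of {0, 1} (set (out_letters (code_trans base))) (nfa_lang (planted base (code_trans base)))"

lemma rel_iff:
  assumes "2 \<le> n"
  shows "(u, v) \<in> rel \<longleftrightarrow> set u \<subseteq> {0, 1} \<and>
    (\<exists>vs. v = map code vs \<and> set vs \<subseteq> letters \<and> ok (code_trans base) Init (sync u (map code vs)))"
proof -
  let ?c = "code_trans base" and ?\<Gamma> = "set (out_letters (code_trans base))"
  have d: "{0, 1} \<inter> ?\<Gamma> = {}" by (auto simp: set_out_letters)
  have shape: "\<forall>w\<in>nfa_lang (planted base ?c). in_sync_shape {0, 1} ?\<Gamma> w"
    using inst_valid[OF assms] unfolding valid_instance_def inst_def by simp
  have a: "alphabet \<inter> ?\<Gamma> = code ` letters"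
    using d letters_le_code[OF assms] unfolding alphabet_def by blast
  have ne: "sync u v \<noteq> []" if "ok ?c Init (sync u v)"
  proof
    assume "sync u v = []"
    with that show False by simp
  qed
  have "(u, v) \<in> rel \<longleftrightarrow> set u \<subseteq> {0, 1} \<and> set v \<subseteq> ?\<Gamma> \<and> sync u v \<in> nfa_lang (planted base ?c)"
    unfolding rel_def by (rule rel_of_sync[OF d shape])
  also have "\<dots> \<longleftrightarrow> set u \<subseteq> {0, 1} \<and> set v \<subseteq> code ` letters \<and> sync u v \<noteq> [] \<and> ok ?c Init (sync u v)"
  proof -
    have "set v \<subseteq> ?\<Gamma> \<and> set u \<union> set v \<subseteq> alphabet \<longleftrightarrow> set u \<subseteq> alphabet \<and> set v \<subseteq> code ` letters"
      using a by blast
    moreover have "{0, 1} \<subseteq> alphabet" unfolding alphabet_def by blast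
    ultimately show ?thesis
      unfolding planted_lang[OF assms] set_sync by blast
  qed
  also have "\<dots> \<longleftrightarrow> set u \<subseteq> {0, 1} \<and> set v \<subseteq> code ` letters \<and> ok ?c Init (sync u v)"
    using ne by blast
  also have "\<dots> \<longleftrightarrow> set u \<subseteq> {0, 1} \<and> (\<exists>vs. v = map code vs \<and> set vs \<subseteq> letters \<and> ok ?c Init (sync u (map code vs)))"
  proof -
    have "set v \<subseteq> code ` letters \<longleftrightarrow> (\<exists>vs. v = map code vs \<and> set vs \<subseteq> letters)"
    proof
      assume "set v \<subseteq> code ` letters"
      then have "v = map code (map (inv_into letters code) v) \<and> set (map (inv_into letters code) v) \<subseteq> letters"
        by (auto simp: f_inv_into_f subset_iff intro!: map_idI[symmetric] inv_into_into)
      then show "\<exists>vs. v = map code vs \<and> set vs \<subseteq> letters" by blast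
    qed (elim exE conjE, simp add: image_mono)
    then show ?thesis by blast
  qed
  finally show ?thesis .
qed

end

section \<open>Transducer runs\<close>

text \<open>A common refinement of \<open>run_out\<close> and \<open>run_sync\<close> that keeps the
  outputs of the single letters apart, since the control language speaks about their
  lengths.\<close>

fun outs :: "(nat \<Rightarrow> nat \<Rightarrow> (nat list \<times> nat) option) \<Rightarrow> nat \<Rightarrow> nat list \<Rightarrow> (nat list list \<times> nat) option" where
  "outs \<delta> q [] = Some ([], q)"
| "outs \<delta> q (a # w) = (case \<delta> q a of None \<Rightarrow> None
     | Some (v, p) \<Rightarrow> (case outs \<delta> p w of None \<Rightarrow> None | Some (vs, r) \<Rightarrow> Some (v # vs, r)))"

lemma run_out_outs: "run_out \<delta> q u = map_option (\<lambda>(vs, r). (concat vs, r)) (outs \<delta> q u)"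
  by (induction u arbitrary: q) (auto split: option.splits)

lemma run_sync_outs:
  "run_sync \<delta> q u = map_option (\<lambda>(vs, r). (concat (map2 (#) u vs), r)) (outs \<delta> q u)"
  by (induction u arbitrary: q) (auto split: option.splits)

lemma outs_append:
  "outs \<delta> q (u @ w) = (case outs \<delta> q u of None \<Rightarrow> None
     | Some (vs, p) \<Rightarrow> (case outs \<delta> p w of None \<Rightarrow> None | Some (ws, r) \<Rightarrow> Some (vs @ ws, r)))"
  by (induction u arbitrary: q) (auto split: option.splits)

lemma outs_length: "outs \<delta> q u = Some (vs, r) \<Longrightarrow> length vs = length u"
  by (induction u arbitrary: q vs) (auto split: option.splits)

lemma sst_fun_outs:
  "sst_fun (Q, q0, \<delta>, F, f) u = Some v \<longleftrightarrow>
    (\<exists>vs p. outs \<delta> q0 u = Some (vs, p) \<and> p \<in> F \<and> v = concat vs @ f p)"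
  unfolding sst_fun_def run_out_outs by (auto split: option.splits)

lemma sst_sync_outs:
  "sst_sync (Q, q0, \<delta>, F, f) = {concat (map2 (#) u vs) @ f p | u vs p. outs \<delta> q0 u = Some (vs, p) \<and> p \<in> F}"
  unfolding sst_sync_def run_sync_outs by fastforce

lemma hmor_blocks:
  "length u = length vs \<Longrightarrow> set u \<subseteq> \<Sigma> \<Longrightarrow> (\<And>v. v \<in> set vs \<Longrightarrow> set v \<inter> \<Sigma> = {}) \<Longrightarrow>
    hmor \<Sigma> (concat (map2 (#) u vs)) = blocks (map length vs)"
proof (induction u vs rule: list_induct2)
  case (Cons a u v vs)
  have "hmor \<Sigma> v = replicate (length v) 2"
  proof -
    have "set v \<inter> \<Sigma> = {}" using Cons.prems by simp
    then show ?thesis unfolding hmor_def by (induction v) auto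
  qed
  then show ?case using Cons by (auto simp: hmor_def)
qed (simp add: hmor_def)

text \<open>The final output has no input letter of its own and counts towards the block of the last
  letter.\<close>

lemma hmor_blocks_final:
  assumes "length u = Suc (length vs)" "set u \<subseteq> \<Sigma>" "\<And>v. v \<in> set (vs @ [w @ x]) \<Longrightarrow> set v \<inter> \<Sigma> = {}"
  shows "hmor \<Sigma> (concat (map2 (#) u (vs @ [w])) @ x) = blocks (map length vs @ [length w + length x])"
proof -
  obtain u' a where u: "u = u' @ [a]" "length u' = length vs"
    using assms(1) by (cases u rule: rev_cases) auto
  have "concat (map2 (#) u (vs @ [w])) @ x = concat (map2 (#) u (vs @ [w @ x]))"
    using u by simp
  then show ?thesis using hmor_blocks[of u "vs @ [w @ x]" \<Sigma>] assms by simp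
qed

section \<open>Rows\<close>

context game
begin

section \<open>The relation and its domain\<close>

lemma rel_ticks:
  assumes "2 \<le> n" "1 \<le> m"
  shows "(replicate m 0, v) \<in> rel \<longleftrightarrow>
    (\<exists>vs. v = map code vs \<and> set vs \<subseteq> letters \<and> m \<le> length vs \<and> hchain None vs)"
  unfolding rel_iff[OF assms(1)] ok_Init_ticks[OF assms(2)] by auto

lemma rel_init:
  assumes "2 \<le> n"
  shows "([0, 1], v) \<in> rel \<longleftrightarrow>
    (\<exists>i. v = map code (start0 # replicate (code_trans base) blank @ mark0 # replicate i blank @ [Hash]))"
proof -
  let ?w = "\<lambda>i. start0 # replicate (code_trans base) blank @ mark0 # replicate i blank @ [Hash]"
  have l: "set (?w i) \<subseteq> letters" for i
    using cell_letters[OF assms] by auto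
  have o: "ok c Init (sync [0, 1] (map code vs)) \<longleftrightarrow>
      (\<exists>i. vs = start0 # replicate c blank @ mark0 # replicate i blank @ [Hash])" for c vs
    by (subst ok_Init_mark) simp_all
  have "([0, 1], v) \<in> rel \<longleftrightarrow> (\<exists>vs. v = map code vs \<and> set vs \<subseteq> letters \<and> (\<exists>i. vs = ?w i))"
    unfolding rel_iff[OF assms] o by simp
  also have "\<dots> \<longleftrightarrow> (\<exists>i. v = map code (?w i))"
    using l by blast
  finally show ?thesis .
qed

lemma rel_mark:
  assumes "2 \<le> n" "2 \<le> j"
  shows "(replicate j 0 @ 1 # replicate l 0, v) \<in> rel \<longleftrightarrow>
    (\<exists>vs. v = map code (vs @ [Hash]) \<and> set vs \<subseteq> letters \<and> marked j l vs)"
proof -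
  have "set (replicate j 0 @ 1 # replicate l (0::nat)) \<subseteq> {0, 1}" by auto
  then have "(replicate j 0 @ 1 # replicate l 0, v) \<in> rel \<longleftrightarrow>
      (\<exists>vs. v = map code vs \<and> set vs \<subseteq> letters \<and> (\<exists>vs'. vs = vs' @ [Hash] \<and> marked j l vs'))"
    unfolding rel_iff[OF assms(1)] ok_Init_marked[OF assms(2)] by blast
  also have "\<dots> \<longleftrightarrow> (\<exists>vs. v = map code (vs @ [Hash]) \<and> set (vs @ [Hash]) \<subseteq> letters \<and> marked j l vs)"
    by blast
  also have "\<dots> \<longleftrightarrow> (\<exists>vs. v = map code (vs @ [Hash]) \<and> set vs \<subseteq> letters \<and> marked j l vs)"
    using cell_letters(4)[OF assms(1)] by simp
  finally show ?thesis .
qed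

lemma rel_dom:
  assumes "2 \<le> n" "(u, v) \<in> rel"
  shows "(\<exists>m\<ge>1. u = replicate m 0) \<or> u = [0, 1] \<or> (\<exists>j\<ge>2. \<exists>l. u = replicate j 0 @ 1 # replicate l 0)"
  using assms(2) ok_Init_dom unfolding rel_iff[OF assms(1)] by blast

lemma dom_ticks:
  assumes "2 \<le> n" "1 \<le> m"
  shows "replicate m 0 \<in> Domain rel"
proof -
  have "hchain z (replicate m Dollar)" for z
    by (induction m arbitrary: z) (auto elim!: hok.elims)
  then have "(replicate m 0, map code (replicate m Dollar)) \<in> rel"
    unfolding rel_ticks[OF assms] using cell_letters(5)[OF assms(1)]
    by (intro exI[of _ "replicate m Dollar"]) auto
  then show ?thesis by blast
qed

lemma dom_init: "2 \<le> n \<Longrightarrow> [0, 1] \<in> Domain rel"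
  using rel_init[of "map code (start0 # replicate (code_trans base) blank @ mark0 # replicate 0 blank @ [Hash])"] by blast

text \<open>A word of \<open>Dollar\<close> that is one letter too long for the comparison is always
  a correct output. Thus the domain does not depend on what the program does.\<close>

lemma dom_mark:
  assumes "2 \<le> n" "2 \<le> j"
  shows "replicate j 0 @ 1 # replicate l 0 \<in> Domain rel"
proof -
  have "hchain z (replicate m Dollar)" for z m
    by (induction m arbitrary: z) (auto elim!: hok.elims)
  then have "hchain None (take j (replicate (j + l + 1) Dollar))"
    by (simp only: take_replicate)
  then have "marked j l (replicate (j + l + 1) Dollar)"
    unfolding marked_def by auto
  then have "(replicate j 0 @ 1 # replicate l 0, map code (replicate (j + l + 1) Dollar @ [Hash])) \<in> rel"
    unfolding rel_mark[OF assms] using cell_letters(5)[OF assms(1)]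
    by (intro exI[of _ "replicate (j + l + 1) Dollar"] conjI) auto
  then show ?thesis by blast
qed

section \<open>Rows that describe configurations\<close>

fun cell :: "cmd list \<times> (nat \<Rightarrow> nat) \<Rightarrow> nat \<Rightarrow> letter" where
  "cell (k, \<rho>) p = Cell (p = 0) k (filter (\<lambda>r. \<rho> r = p) [0..<n])"

lemma is_start_cell [simp]: "is_start (cell C p) \<longleftrightarrow> p = 0"
  by (cases C) simp

lemma moved_cell:
  assumes "regs_below n (i # k)" "\<forall>r<n. \<rho> r < K" "p < K"
    "0 < p \<Longrightarrow> x = Some (cell (i # k, \<rho>) (p - 1))"
    "p + 1 < K \<Longrightarrow> z = cell (i # k, \<rho>) (p + 1)" "p + 1 = K \<Longrightarrow> is_start z"
  shows "filter (moved i x (p = 0) (filter (\<lambda>r. \<rho> r = p) [0..<n]) z) [0..<n] =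
    filter (\<lambda>r. snd (step (i # k, \<rho>)) r = p) [0..<n]"
proof (rule filter_cong[OF refl])
  fix r assume "r \<in> set [0..<n]"
  then have r: "r < n" by simp
  then have b: "\<rho> r < K" using assms(2) by simp
  show "moved i x (p = 0) (filter (\<lambda>r. \<rho> r = p) [0..<n]) z r \<longleftrightarrow> snd (step (i # k, \<rho>)) r = p"
  proof (cases i)
    case (Inc q)
    then show ?thesis using r assms(4) by (cases "p = 0") auto
  next
    case (Dec q)
    show ?thesis
    proof (cases "p + 1 < K")
      case True
      then show ?thesis using r Dec assms(5) by auto
    next
      case False
      then have "p + 1 = K" using assms(3) by simp
      then show ?thesis using r b Dec assms(6) by auto
    qed
  next
    case (While q b')
    then show ?thesis using r by simp
  qed
qed

lemma follow_cell:
  assumes "regs_below n (i # k)"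
  shows "follow i k (filter (\<lambda>r. \<rho> r = 0) [0..<n]) = fst (step (i # k, \<rho>))"
  using assms by (cases i) auto

text \<open>The start value is \<open>Suc c\<close> and not \<open>c\<close>, so that register 0 is
  never found in the first cell: this makes \<open>start0\<close> a letter that does not depend on
  \<open>c\<close>, and the row after it is the planted chain.\<close>

definition cfg :: "nat \<Rightarrow> nat \<Rightarrow> cmd list \<times> (nat \<Rightarrow> nat)" where
  "cfg c t = (step ^^ t) (P, \<lambda>r. if r = 0 then Suc c else 0)"

lemma cfg_0: "cfg c 0 = (P, \<lambda>r. if r = 0 then Suc c else 0)"
  by (simp add: cfg_def)

lemma cfg_Suc: "cfg c (Suc t) = step (cfg c t)"
  by (simp add: cfg_def)

lemma cfg_regs_below:
  assumes "regs_below n P"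
  shows "regs_below n (fst (cfg c t))"
proof (induction t)
  case (Suc t)
  then show ?case unfolding cfg_Suc using regs_below_step by (metis prod.collapse)
qed (simp add: cfg_0 assms)

lemma initial_row:
  assumes "2 \<le> n"
  shows "map (cell (cfg c 0)) [0..<c + 2 + i] = start0 # replicate c blank @ mark0 # replicate i blank"
proof (rule nth_equalityI)
  have 0: "[0..<n] = 0 # [1..<n]" using assms upt_conv_Cons by simp
  have f: "filter (\<lambda>r. (if r = 0 then Suc c else 0) = p) [0..<n] =
      (if p = 0 then [1..<n] else if p = Suc c then [0] else [])" for p
    unfolding 0 by (auto simp: filter_id_conv filter_empty_conv)
  fix p assume "p < length (map (cell (cfg c 0)) [0..<c + 2 + i])"
  then have "p < c + 2 + i" by simp
  then show "map (cell (cfg c 0)) [0..<c + 2 + i] ! p = (start0 # replicate c blank @ mark0 # replicate i blank) ! p"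
    by (simp only: nth_map_upt cfg_0 cell.simps f minus_nat.diff_0 add_0)
      (auto simp: nth_Cons nth_append split: nat.split)
qed simp

lemma vok_cell:
  "vok n x (cell (i # k, \<rho>) p) z y' \<longleftrightarrow>
     \<not> overflow i (filter (\<lambda>r. \<rho> r = p) [0..<n]) z \<and>
      (\<exists>k'. y' = Cell (p = 0) k' (filter (moved i x (p = 0) (filter (\<lambda>r. \<rho> r = p) [0..<n]) z) [0..<n]) \<and>
        (p = 0 \<longrightarrow> k' = follow i k (filter (\<lambda>r. \<rho> r = p) [0..<n])))"
  by simp

text \<open>The vertical check fixes the tokens of every cell in the next row, but the program only
  in its first cell, from where \<open>hok\<close> spreads it to the right.\<close>

lemma row_step:
  assumes K: "0 < K" and b: "regs_below n (i # k)"
    and row: "\<And>p. p < K \<Longrightarrow> U p = cell (i # k, \<rho>) p" and bound: "\<forall>r<n. \<rho> r < K"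
    and vok: "\<And>p. p < K \<Longrightarrow> vok n (if p = 0 then x else Some (U (p - 1))) (U p) (U (p + 1)) (U (p + K))"
    and hok: "\<And>p. hok (Some (U p)) (U (Suc p))"
  shows "(\<forall>p<K. U (K + p) = cell (step (i # k, \<rho>)) p) \<and> (\<forall>r<n. snd (step (i # k, \<rho>)) r < K)"
proof -
  let ?X = "\<lambda>p. filter (\<lambda>r. \<rho> r = p) [0..<n]"
  obtain k' \<rho>' where s: "step (i # k, \<rho>) = (k', \<rho>')" by fastforce
  have v: "\<not> overflow i (?X p) (U (p + 1)) \<and>
      (\<exists>k'. U (p + K) = Cell (p = 0) k' (filter (moved i (if p = 0 then x else Some (U (p - 1))) (p = 0) (?X p) (U (p + 1))) [0..<n]) \<and>
        (p = 0 \<longrightarrow> k' = follow i k (?X p)))" if "p < K" for p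
    using vok[OF that] unfolding row[OF that] vok_cell .
  \<comment> \<open>The flag for the first cell is copied to the letter \<open>K\<close> places
    later, so the next row starts exactly there.\<close>
  have start: "is_start (U K)" using v[of 0] K by auto
  have m: "filter (moved i (if p = 0 then x else Some (U (p - 1))) (p = 0) (?X p) (U (p + 1))) [0..<n] =
      filter (\<lambda>r. \<rho>' r = p) [0..<n]" if p: "p < K" for p
    using moved_cell[OF b bound p, of "if p = 0 then x else Some (U (p - 1))" "U (p + 1)"] row start p
    unfolding s snd_conv by (auto simp del: cell.simps)
  have c: "\<exists>k''. U (p + K) = Cell (p = 0) k'' (filter (\<lambda>r. \<rho>' r = p) [0..<n]) \<and> (p = 0 \<longrightarrow> k'' = k')"
    if "p < K" for p
    using v[OF that] follow_cell[OF b, of \<rho>] unfolding m[OF that] s fst_conv by metis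
  have "U (K + p) = cell (k', \<rho>') p" if "p < K" for p
    using that
  proof (induction p)
    case 0
    then show ?case using c[of 0] by simp
  next
    case (Suc p)
    then have "U (K + p) = cell (k', \<rho>') p" by simp
    moreover obtain k'' where "U (K + Suc p) = Cell False k'' (filter (\<lambda>r. \<rho>' r = Suc p) [0..<n])"
      using c[OF Suc.prems] by (auto simp: add.commute)
    ultimately show ?case using hok[of "K + p"] by simp
  qed
  moreover have "\<rho>' r < K" if r: "r < n" for r
  proof (cases "i = Inc r")
    case True
    \<comment> \<open>The value \<open>K - 1\<close> would sit in the last cell, whose right
      neighbour \<open>U K\<close> starts a row, and this is an overflow.\<close>
    have "\<rho> r \<noteq> K - 1"
    proof
      assume e: "\<rho> r = K - 1"
      then have "overflow i (?X (K - 1)) (U (K - 1 + 1))"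
        using True start r K by simp
      moreover have "K - 1 < K" using K by simp
      ultimately show False using v by blast
    qed
    moreover have "\<rho> r < K" using bound r by blast
    ultimately have "Suc (\<rho> r) < K" by linarith
    moreover have "\<rho>' r = Suc (\<rho> r)" using s True by auto
    ultimately show ?thesis by simp
  next
    case False
    then have "\<rho>' r \<le> \<rho> r" using s by (cases i) auto
    moreover have "\<rho> r < K" using bound r by blast
    ultimately show ?thesis by linarith
  qed
  ultimately show ?thesis unfolding s snd_conv by blast
qed

lemma rows_sound:
  assumes n: "2 \<le> n" "regs_below n P" and K: "Suc c < K"
    and row0: "\<And>p. p < K \<Longrightarrow> V p = cell (cfg c 0) p"
    and vok: "\<And>i. vok n (if i = 0 then None else Some (V (i - 1))) (V i) (V (i + 1)) (V (i + K))"
    and hok: "\<And>i. hok (Some (V i)) (V (Suc i))"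
    and run: "\<And>s. s < t \<Longrightarrow> fst (cfg c s) \<noteq> []"
  shows "(\<forall>p<K. V (t * K + p) = cell (cfg c t) p) \<and> (\<forall>r<n. snd (cfg c t) r < K)"
  using run
proof (induction t)
  case 0
  then show ?case using row0 K by (simp add: cfg_0)
next
  case (Suc t)
  then have IH: "\<And>p. p < K \<Longrightarrow> V (t * K + p) = cell (cfg c t) p" "\<forall>r<n. snd (cfg c t) r < K" by auto
  obtain i k \<rho> where s: "cfg c t = (i # k, \<rho>)"
    using Suc.prems[of t] by (metis lessI list.exhaust prod.collapse)
  have "(\<forall>p<K. V (t * K + (K + p)) = cell (step (i # k, \<rho>)) p) \<and> (\<forall>r<n. snd (step (i # k, \<rho>)) r < K)"
  proof (rule row_step[where U = "\<lambda>p. V (t * K + p)" and x = "if t * K = 0 then None else Some (V (t * K - 1))"])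
    show "0 < K" using K by simp
    show "regs_below n (i # k)" using cfg_regs_below[OF n(2), of c t] s by simp
    show "\<And>p. p < K \<Longrightarrow> V (t * K + p) = cell (i # k, \<rho>) p" using IH(1) s by metis
    show "\<forall>r<n. \<rho> r < K" using IH(2) s by simp
    show "\<And>p. hok (Some (V (t * K + p))) (V (t * K + Suc p))" using hok by simp
    fix p assume "p < K"
    show "vok n (if p = 0 then if t * K = 0 then None else Some (V (t * K - 1)) else Some (V (t * K + (p - 1))))
        (V (t * K + p)) (V (t * K + (p + 1))) (V (t * K + (p + K)))"
    proof (cases "p = 0")
      case True
      then show ?thesis using vok[of "t * K"] by (simp only: simp_thms if_True add_0_right add_0)
    next
      case False
      then have "t * K + p \<noteq> 0" "t * K + p - 1 = t * K + (p - 1)" by simp_all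
      then show ?thesis using vok[of "t * K + p"] False by (simp only: if_False add.assoc)
    qed
  qed
  then show ?case unfolding cfg_Suc s by (simp add: add.assoc add.commute)
qed

text \<open>When the program becomes empty, the check below the first cell of that row can only
  succeed if register 1 is found there, that is, has value 0.\<close>

lemma rows_accept:
  assumes n: "2 \<le> n" "regs_below n P" and K: "Suc c < K"
    and row0: "\<And>p. p < K \<Longrightarrow> V p = cell (cfg c 0) p"
    and vok: "\<And>i. vok n (if i = 0 then None else Some (V (i - 1))) (V i) (V (i + 1)) (V (i + K))"
    and hok: "\<And>i. hok (Some (V i)) (V (Suc i))"
    and halt: "fst (cfg c t) = []"
  shows "\<exists>t. fst (cfg c t) = [] \<and> snd (cfg c t) 1 = 0"
proof -
  \<comment> \<open>The least halting time is taken because rows determine each other only as long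
    as a command is left.\<close>
  define T where "T = (LEAST t. fst (cfg c t) = [])"
  have T: "fst (cfg c T) = []" unfolding T_def using halt by (rule LeastI)
  have "\<And>s. s < T \<Longrightarrow> fst (cfg c s) \<noteq> []" unfolding T_def by (rule not_less_Least)
  then have "\<forall>p<K. V (T * K + p) = cell (cfg c T) p"
    using rows_sound[OF n K row0 vok hok] by blast
  then have "V (T * K) = cell (cfg c T) 0" using K by (metis add_0_right not_less_zero neq0_conv)
  moreover obtain \<rho> where \<rho>: "cfg c T = ([], \<rho>)" using T by (cases "cfg c T") simp
  ultimately have "V (T * K) = Cell True [] (filter (\<lambda>r. \<rho> r = 0) [0..<n])" by simp
  then have "1 \<in> set (filter (\<lambda>r. \<rho> r = 0) [0..<n])"
    using vok[of "T * K"] by simp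
  then show ?thesis using \<rho> by (intro exI[of _ T]) simp
qed

section \<open>From a uniformizing transducer to a computation with result 0\<close>

text \<open>The control language and the forced answer to a mark fix the shape of a uniformizing transducer:
  its first output has some length \<open>K\<close>, and every further tick yields exactly one letter. Ending the
  input when it has caught up with the output lets the relation compare letters at distance \<open>K\<close>.\<close>

lemma uniformizer_accepts:
  assumes n: "2 \<le> n" "regs_below n P"
    and wf: "sst_wf {0, 1} (set (out_letters (code_trans base))) T"
    and ctrl: "controlled {0, 1} (nfa_lang pace_nfa) T"
    and unif: "uniformizes T rel"
    and halt: "fst (cfg (code_trans base) t) = []"
  shows "\<exists>t. fst (cfg (code_trans base) t) = [] \<and> snd (cfg (code_trans base) t) 1 = 0"
proof -
  obtain Q q0 \<delta> F f where T: "T = (Q, q0, \<delta>, F, f)" by (cases T)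
  let ?c = "code_trans base" and ?h = "code Hash"
  have wf\<delta>: "set v \<inter> {0, 1} = {}" if "\<delta> q a = Some (v, p)" for q a v p
    using wf that unfolding T sst_wf_def by (fastforce simp: set_out_letters)
  have wff: "set (f q) \<inter> {0, 1} = {}" if "q \<in> F" for q
    using wf that unfolding T sst_wf_def by (fastforce simp: set_out_letters)
  have wfo: "set v \<inter> {0, 1} = {}" if "outs \<delta> q u = Some (vs, p)" "v \<in> set vs" for q u vs p v
    using that
  proof (induction u arbitrary: q vs)
    case (Cons a u)
    then show ?case using wf\<delta> by (auto split: option.splits)
  qed simp
  have run: "\<exists>vs p. outs \<delta> q0 u = Some (vs, p) \<and> p \<in> F \<and> (u, concat vs @ f p) \<in> rel"
    if "u \<in> Domain rel" for u
  proof -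
    obtain v where v: "sst_fun T u = Some v" using unif \<open>u \<in> Domain rel\<close> unfolding uniformizes_def by blast
    then have "(u, v) \<in> rel" using unif unfolding uniformizes_def by blast
    with v show ?thesis unfolding T sst_fun_outs by blast
  qed
  have pace: "paced (map length vs @ [length w + length (f p)])"
    if "outs \<delta> q0 u = Some (vs @ [w], p)" "p \<in> F" "set u \<subseteq> {0, 1}" for u vs w p
  proof -
    have "concat (map2 (#) u (vs @ [w])) @ f p \<in> sst_sync T" unfolding T sst_sync_outs using that by blast
    then have "hmor {0, 1} (concat (map2 (#) u (vs @ [w])) @ f p) \<in> nfa_lang pace_nfa"
      using ctrl unfolding controlled_def by blast
    moreover have "length u = Suc (length vs)" using outs_length[OF that(1)] by simp
    moreover have "set v \<inter> {0, 1} = {}" if "v \<in> set (vs @ [w @ f p])" for v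
      using that wfo[OF \<open>outs \<delta> q0 u = Some (vs @ [w], p)\<close>] wff[OF \<open>p \<in> F\<close>] by auto
    ultimately show ?thesis using hmor_blocks_final[of u vs "{0, 1}" w "f p"] that(3) blocks_in_pace by metis
  qed

  \<comment> \<open>\<open>o' i\<close> is the output on tick \<open>i\<close>, counted from 0, and
    \<open>q m\<close> the state after \<open>m\<close> ticks. They exist because all nonempty words
    of ticks are in the domain.\<close>
  define o' where "o' i = last (fst (the (outs \<delta> q0 (replicate (Suc i) 0))))" for i
  define q where "q m = snd (the (outs \<delta> q0 (replicate m 0)))" for m
  have ticks: "outs \<delta> q0 (replicate m 0) = Some (map o' [0..<m], q m)" for m
  proof (induction m)
    case 0
    then show ?case by (simp add: q_def)
  next
    case (Suc m)
    obtain vs p where "outs \<delta> q0 (replicate (Suc m) 0) = Some (vs, p)"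
      using run[OF dom_ticks[OF n(1), of "Suc m"]] by auto
    moreover have r: "replicate (Suc m) (0::nat) = replicate m 0 @ [0]" by (metis replicate_Suc replicate_append_same)
    ultimately obtain w where w: "outs \<delta> q0 (replicate (Suc m) 0) = Some (map o' [0..<m] @ [w], p)"
      unfolding r outs_append Suc by (auto split: option.splits)
    then have "o' m = w" "q (Suc m) = p" unfolding o'_def q_def by simp_all
    then show ?case using w by simp
  qed
  have after: "\<exists>ws p. outs \<delta> q0 (replicate j 0 @ u) = Some (map o' [0..<j] @ ws, p) \<and> length ws = length u \<and> p \<in> F \<and>
      (replicate j 0 @ u, concat (map o' [0..<j]) @ concat ws @ f p) \<in> rel"
    if d: "replicate j 0 @ u \<in> Domain rel" for j u
  proof -
    obtain vs p where v: "outs \<delta> q0 (replicate j 0 @ u) = Some (vs, p)" "p \<in> F" "(replicate j 0 @ u, concat vs @ f p) \<in> rel"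
      using run[OF d] by blast
    then obtain ws where "vs = map o' [0..<j] @ ws" "outs \<delta> (q j) u = Some (ws, p)"
      unfolding outs_append ticks by (auto split: option.splits)
    then show ?thesis using v outs_length by fastforce
  qed
  have in_dom: "replicate j 0 @ 1 # replicate l 0 \<in> Domain rel" if "2 \<le> j \<or> j = 1 \<and> l = 0" for j l
    using that dom_mark[OF n(1)] dom_init[OF n(1)] by auto

  have tick_rel: "\<exists>vs. concat (map o' [0..<m]) @ f (q m) = map code vs \<and> hchain None vs" if "1 \<le> m" for m
    using run[OF dom_ticks[OF n(1) that]] unfolding ticks rel_ticks[OF n(1) that] by auto
  have no_hash: "?h \<notin> set (o' i)" for i
  proof -
    obtain vs where vs: "concat (map o' [0..<Suc i]) @ f (q (Suc i)) = map code vs" "hchain None vs"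
      using tick_rel[of "Suc i"] by auto
    have "set (o' i) \<subseteq> set (map code vs)" unfolding vs(1)[symmetric] by auto
    then show ?thesis using hchain_no_Hash[OF vs(2)] by auto
  qed
  have hash_last: "\<exists>vs. v = map code vs @ [?h] \<and> Hash \<notin> set vs"
    if "(replicate j 0 @ 1 # replicate l 0, v) \<in> rel" "2 \<le> j \<or> j = 1 \<and> l = 0" for j l v
    using that(2)
  proof
    assume "2 \<le> j"
    then show ?thesis using that(1) unfolding rel_mark[OF n(1) \<open>2 \<le> j\<close>] marked_def by auto
  next
    assume "j = 1 \<and> l = 0"
    then have "([0, 1], v) \<in> rel" using that(1) by simp
    then obtain i where "v = map code (start0 # replicate ?c blank @ mark0 # replicate i blank @ [Hash])"
      unfolding rel_init[OF n(1)] by blast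
    then show ?thesis by (intro exI[of _ "start0 # replicate ?c blank @ mark0 # replicate i blank"]) auto
  qed
  have split_hash: "\<exists>ys'. ys = ys' @ [?h] \<and> ?h \<notin> set ys'"
    if e: "xs @ ys = map code vs @ [?h]" and h: "?h \<notin> set xs" "Hash \<notin> set vs" for xs ys vs
  proof (cases ys rule: rev_cases)
    case Nil
    then show ?thesis using e h(1) by auto
  next
    case (snoc ys' y)
    then have "xs @ ys' = map code vs" "y = ?h" using e by simp_all
    moreover have "?h \<notin> set (map code vs)" using h(2) by auto
    ultimately show ?thesis using snoc by (metis Un_iff set_append)
  qed
  have no_hash_concat: "?h \<notin> set (concat (map o' [0..<j]))" for j
    using no_hash by auto
  \<comment> \<open>Ticks never produce \<open>Hash\<close>, but a marked input needs it at the end,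
    so the block of the mark together with the final output is nonempty. By
    \<open>paced_last\<close> no block is empty; all but the first then have length 1, and the mark
    yields \<open>Hash\<close> alone.\<close>
  have mark1: "\<exists>w. \<delta> (q j) 1 = Some (w, p) \<and> p \<in> F \<and> w @ f p = [?h]
      \<and> 1 \<le> length (o' 0) \<and> (\<forall>i. 1 \<le> i \<longrightarrow> i < j \<longrightarrow> length (o' i) = 1)"
    if j1: "1 \<le> j" and p: "p = snd (the (\<delta> (q j) 1))" for j p
  proof -
    have j2: "2 \<le> j \<or> j = 1 \<and> (0::nat) = 0" using j1 by auto
    have "replicate j 0 @ [1] \<in> Domain rel" using in_dom[OF j2] by simp
    then obtain ws p' where w: "outs \<delta> q0 (replicate j 0 @ [1]) = Some (map o' [0..<j] @ ws, p')" "length ws = 1" "p' \<in> F"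
      "(replicate j 0 @ [1], concat (map o' [0..<j]) @ concat ws @ f p') \<in> rel"
      using after[of j "[1]"] by auto
    then obtain w where ws: "ws = [w]" by (auto simp: length_Suc_conv)
    have \<delta>: "\<delta> (q j) 1 = Some (w, p')"
      using w(1) unfolding outs_append ticks ws by (auto split: option.splits)
    obtain vs where "concat (map o' [0..<j]) @ w @ f p' = map code vs @ [?h]" "Hash \<notin> set vs"
      using hash_last[of j 0 "concat (map o' [0..<j]) @ w @ f p'"] w(4) j2 ws by auto
    then obtain ys where ys: "w @ f p' = ys @ [?h]" using split_hash no_hash_concat by blast
    have "paced (map length (map o' [0..<j]) @ [length w + length (f p')])"
      by (rule pace) (use w ws in auto)
    moreover have l: "length w + length (f p') = length ys + 1" using ys by (metis length_append length_append_singleton Suc_eq_plus1)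
    ultimately obtain k i where ki: "map length (map o' [0..<j]) @ [length w + length (f p')] = Suc k # replicate i 1"
      using paced_last by (metis add_is_0 last_snoc one_neq_zero)
    have nth: "(map length (map o' [0..<j]) @ [length w + length (f p')]) ! x = (if x = 0 then Suc k else 1)" if "x \<le> j" for x
      unfolding ki using arg_cong[OF ki, of length] that by (simp add: nth_Cons split: nat.split)
    have "length w + length (f p') = 1" using nth[of j] j1 by (simp add: nth_append)
    then have "w @ f p' = [?h]" using ys l by simp
    moreover have "1 \<le> length (o' 0)" using nth[of 0] j1 by (simp add: nth_append)
    moreover have "length (o' i) = 1" if "1 \<le> i" "i < j" for i using nth[of i] that by (simp add: nth_append)
    ultimately show ?thesis using \<delta> w(3) p by simp
  qed
  define K where "K = length (o' 0)"
  have K1: "1 \<le> K" unfolding K_def using mark1[of 1] by auto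
  have len: "length (o' i) = 1" if "1 \<le> i" for i using mark1[of "Suc i"] that by auto

  have mark_out: "(replicate j 0 @ 1 # replicate l 0, concat (map o' [0..<j]) @ [?h]) \<in> rel" if j: "2 \<le> j" for j l
  proof -
    obtain w p where w: "\<delta> (q j) 1 = Some (w, p)" "p \<in> F" "w @ f p = [?h]"
      using mark1[of j] j by auto
    \<comment> \<open>\<open>Hash\<close> cannot be left to the final output: after an empty block
      at the mark the control language admits no further output, yet \<open>Hash\<close> would still
      be due after one more tick.\<close>
    have w1: "w = [?h]"
    proof -
      have "replicate j 0 @ [1, 0] \<in> Domain rel" using in_dom[of j 1] j by simp
      then obtain ws p' where a: "outs \<delta> q0 (replicate j 0 @ [1, 0]) = Some (map o' [0..<j] @ ws, p')" "length ws = 2" "p' \<in> F"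
        "(replicate j 0 @ [1, 0], concat (map o' [0..<j]) @ concat ws @ f p') \<in> rel"
        using after[of j "[1, 0]"] by auto
      then obtain z where ws: "ws = [w, z]"
        using w(1) unfolding outs_append ticks by (auto split: option.splits)
      obtain vs where vs: "concat (map o' [0..<j]) @ w @ z @ f p' = map code vs @ [?h]" "Hash \<notin> set vs"
        using hash_last[of j 1 "concat (map o' [0..<j]) @ w @ z @ f p'"] a(4) j ws by auto
      show ?thesis
      proof (cases w)
        case Nil
        obtain ys where "z @ f p' = ys @ [?h]" using split_hash[OF vs(1)] vs(2) no_hash_concat Nil by auto
        then have "length z + length (f p') \<noteq> 0" by (metis add_is_0 append_is_Nil_conv length_0_conv list.distinct(1))
        moreover have "paced (map length (map o' [0..<j] @ [w]) @ [length z + length (f p')])"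
          by (rule pace) (use a ws in auto)
        ultimately obtain k i where ki: "map length (map o' [0..<j] @ [w]) @ [length z + length (f p')] = Suc k # replicate i 1"
          using paced_last by (metis last_snoc)
        have "(map length (map o' [0..<j] @ [w]) @ [length z + length (f p')]) ! j = 1"
          unfolding ki using arg_cong[OF ki, of length] j by (simp add: nth_Cons split: nat.split)
        then show ?thesis using Nil by (simp add: nth_append)
      next
        case (Cons a w')
        then show ?thesis using w(3) by auto
      qed
    qed
    obtain ws p' where a: "outs \<delta> q0 (replicate j 0 @ 1 # replicate l 0) = Some (map o' [0..<j] @ ws, p')"
      "(replicate j 0 @ 1 # replicate l 0, concat (map o' [0..<j]) @ concat ws @ f p') \<in> rel"
      using after[OF in_dom[of j l]] j by auto
    then obtain zs where ws: "ws = [?h] # zs"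
      using w(1) w1 unfolding outs_append ticks by (auto split: option.splits)
    obtain vs where vs: "concat (map o' [0..<j]) @ [?h] @ concat zs @ f p' = map code vs @ [?h]" "Hash \<notin> set vs"
      using hash_last[OF a(2)] j ws by auto
    then obtain ys where "[?h] @ concat zs @ f p' = ys @ [?h]" "?h \<notin> set ys"
      using split_hash no_hash_concat by blast
    \<comment> \<open>\<open>Hash\<close> occurs only at the very end of an output, so nothing can
      follow the one written on the mark.\<close>
    then have "concat zs @ f p' = []" by (cases ys) auto
    then have "concat ws @ f p' = [?h]" unfolding ws by simp
    then show ?thesis using a(2) by (simp only:)
  qed

  \<comment> \<open>The output letters in one sequence: the first tick gives \<open>K\<close> of
    them, and letter \<open>i\<close> with \<open>K \<le> i\<close> comes from tick
    \<open>i - K + 1\<close>.\<close>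
  define W where "W i = (if i < K then o' 0 ! i else hd (o' (i - K + 1)))" for i
  have concat_W: "concat (map o' [0..<Suc j]) = map W [0..<K + j]" for j
  proof (induction j)
    case 0
    show ?case by (rule nth_equalityI) (simp_all add: K_def W_def)
  next
    case (Suc j)
    have "o' (Suc j) = [W (K + j)]"
      using len[of "Suc j"] unfolding W_def by (cases "o' (Suc j)") auto
    then show ?case using Suc by simp
  qed
  define V where "V i = inv code (W i)" for i
  have W: "W i = code (V i)" for i
  proof -
    obtain vs where "concat (map o' [0..<Suc i]) @ f (q (Suc i)) = map code vs" using tick_rel[of "Suc i"] by auto
    then have "set (concat (map o' [0..<Suc i])) \<subseteq> range code" by (metis Un_subset_iff image_mono list.set_map set_append subset_UNIV)
    then have "W i \<in> range code" unfolding concat_W using K1 by auto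
    then show ?thesis unfolding V_def by (simp add: f_inv_into_f)
  qed
  have concat_V: "concat (map o' [0..<Suc j]) = map code (map V [0..<K + j])" for j
    unfolding concat_W by (simp add: W)
  have inj: "map code xs = map code ys \<longleftrightarrow> xs = ys" for xs ys
    by (metis code_eq injI inj_map_eq_map)

  have hok: "hok (Some (V i)) (V (Suc i))" for i
  proof -
    obtain vs where vs: "map code (map V [0..<K + Suc i]) @ f (q (Suc (Suc i))) = map code vs" "hchain None vs"
      using tick_rel[of "Suc (Suc i)"] unfolding concat_V by auto
    then obtain ws where ws: "vs = map V [0..<K + Suc i] @ ws"
      by (metis inj append_eq_map_conv)
    obtain m where m: "K = Suc m" using K1 by (cases K) auto
    have u: "[0..<K + Suc i] = [0..<i] @ [i, Suc i] @ [i + 2..<i + 2 + m]"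
    proof -
      have "K + Suc i = i + (2 + m)" using m by simp
      then have "[0..<K + Suc i] = [0..<i] @ [i..<i + (2 + m)]"
        by (simp only: upt_add_eq_append[OF le0])
      also have "[i..<i + (2 + m)] = i # Suc i # [i + 2..<i + 2 + m]"
        by (simp add: upt_conv_Cons del: upt_Suc)
      finally show ?thesis by simp
    qed
    have "hchain None (map V [0..<i] @ V i # V (Suc i) # map V [i + 2..<i + 2 + m] @ ws)"
      using vs(2) unfolding ws u by (simp del: upt_Suc)
    moreover have "hchain z (xs @ a # b # ys) \<Longrightarrow> hok (Some a) b" for z xs a b ys
      by (induction xs arbitrary: z) auto
    ultimately show ?thesis by blast
  qed
  \<comment> \<open>The mark is put after \<open>i + 2\<close> ticks, when \<open>K + i + 1\<close>
    letters are written, and is followed by \<open>K - 1\<close> ticks. Input and output then both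
    have length \<open>K + i + 2\<close>, and the letters compared are those at \<open>i\<close> and
    \<open>i + K\<close>.\<close>
  have vok: "vok n (if i = 0 then None else Some (V (i - 1))) (V i) (V (i + 1)) (V (i + K))" for i
  proof -
    let ?vs = "map V [0..<K + Suc i]"
    have "(replicate (i + 2) 0 @ 1 # replicate (K - 1) 0, map code (?vs @ [Hash])) \<in> rel"
      using mark_out[of "Suc (Suc i)" "K - 1"] unfolding concat_V by (simp del: upt_Suc replicate_Suc)
    then obtain vs where "map code (?vs @ [Hash]) = map code (vs @ [Hash])" "marked (i + 2) (K - 1) vs"
      unfolding rel_mark[OF n(1) le_add2] by blast
    then have m: "marked (i + 2) (K - 1) ?vs"
      unfolding inj append_same_eq by (simp only:)
    have "length ?vs = (i + 2) + (K - 1)" using K1 by simp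
    moreover have "i + 2 - 2 = i" "i + 2 - 1 = i + 1" by simp_all
    ultimately have "vok n (nth_last 3 (take (i + 2) ?vs)) (?vs ! i) (?vs ! (i + 1)) (last ?vs)"
      using m unfolding marked_def by metis
    moreover
    have nth: "?vs ! k = V k" if "k < K + Suc i" for k
      using that nth_map_upt[of k "K + Suc i" 0 V] by (simp del: upt_Suc)
    moreover have "last ?vs = V (i + K)" by (simp add: add.commute)
    moreover have "nth_last 3 (take (i + 2) ?vs) = (if i = 0 then None else Some (V (i - 1)))"
    proof -
      have "length (take (i + 2) ?vs) = i + 2" using K1 by (simp del: upt_Suc)
      moreover have "take (i + 2) ?vs ! (i - 1) = V (i - 1)"
        using nth[of "i - 1"] by (simp del: upt_Suc)
      ultimately show ?thesis unfolding nth_last_def by (cases i) (simp_all del: upt_Suc take_map)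
    qed
    moreover have "?vs ! i = V i" "?vs ! (i + 1) = V (i + 1)" using K1 by (auto intro!: nth simp del: upt_Suc)
    ultimately show ?thesis by (simp only:)
  qed
  \<comment> \<open>At a mark after one tick only the first block has been written, so this block is
    the planted row.\<close>
  obtain i where row: "map V [0..<K] = start0 # replicate ?c blank @ mark0 # replicate i blank"
  proof -
    obtain w p where w: "\<delta> (q 1) 1 = Some (w, p)" "p \<in> F" "w @ f p = [?h]"
      using mark1[of 1] by auto
    obtain ws p' where a: "outs \<delta> q0 (replicate 1 0 @ [1]) = Some (map o' [0..<1] @ ws, p')"
      "(replicate 1 0 @ [1], concat (map o' [0..<1]) @ concat ws @ f p') \<in> rel"
      using after[of 1 "[1]"] dom_init[OF n(1)] by auto
    then have "ws = [w]" "p' = p"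
      using w(1) unfolding outs_append ticks by (auto split: option.splits)
    then have "([0, 1], map code (map V [0..<K] @ [Hash])) \<in> rel"
      using a(2) w(3) concat_V[of 0] by simp
    then obtain i where "map V [0..<K] @ [Hash] = start0 # replicate ?c blank @ mark0 # replicate i blank @ [Hash]"
      unfolding rel_init[OF n(1)] inj by blast
    then show ?thesis using that[of i] by simp
  qed
  have K: "K = ?c + 2 + i" using arg_cong[OF row, of length] by simp
  have "map V [0..<K] = map (cell (cfg ?c 0)) [0..<K]"
    using row initial_row[OF n(1), of ?c i, folded K] by (simp only:)
  then have "V p = cell (cfg ?c 0) p" if "p < K" for p
    using that by (metis add_0 diff_zero nth_map_upt)
  then show ?thesis
    using rows_accept[OF n _ _ vok hok halt] K by simp
qed

section \<open>From a computation with result 0 to a uniformizing transducer\<close>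

lemma cfg_halted: "fst (cfg c s) = [] \<Longrightarrow> cfg c (s + j) = cfg c s"
proof (induction j)
  case (Suc j)
  then show ?case by (cases "cfg c s") (simp add: cfg_Suc)
qed simp

lemma cfg_halted_unique:
  assumes "fst (cfg c s) = []" "fst (cfg c t) = []"
  shows "cfg c s = cfg c t"
  using cfg_halted[OF assms(1), of "t - s"] cfg_halted[OF assms(2), of "s - t"] by (cases "s \<le> t") auto

lemma cfg_conts: "fst (cfg c t) \<in> conts P []"
proof (induction t)
  case 0
  then show ?case using start_in_conts[of P "[]"] by (simp add: cfg_0)
next
  case (Suc t)
  obtain q \<rho> where q: "cfg c t = (q, \<rho>)" by fastforce
  then show ?case using Suc step_in_conts[of q P "[]" \<rho>] by (auto simp: cfg_Suc)
qed

definition history :: "nat \<Rightarrow> nat \<Rightarrow> nat \<Rightarrow> nat \<Rightarrow> letter" where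
  "history c t K i = (if i < Suc t * K then cell (cfg c (i div K)) (i mod K) else Dollar)"

lemma history_cell:
  assumes "s \<le> t" "p < K"
  shows "history c t K (s * K + p) = cell (cfg c s) p"
proof -
  have "s * K \<le> t * K" using assms(1) by (rule mult_le_mono1)
  then have "s * K + p < K + t * K" using assms(2) by linarith
  then have "s * K + p < Suc t * K" by simp
  then show ?thesis using assms(2) unfolding history_def by simp
qed

lemma history_letters:
  assumes "2 \<le> n"
  shows "history c t K i \<in> letters"
proof (cases "i < Suc t * K")
  case True
  obtain k \<rho> where k: "cfg c (i div K) = (k, \<rho>)" by fastforce
  then have "k \<in> conts P []" using cfg_conts[of c "i div K"] by simp
  from filter_letters[OF this] show ?thesis using True k unfolding history_def by simp
next
  case False
  then show ?thesis using cell_letters(5)[OF assms] unfolding history_def by simp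
qed

lemma history_not_Hash: "history c t K i \<noteq> Hash"
  unfolding history_def by (cases "cfg c (i div K)") simp

lemma history_cases:
  assumes "0 < K"
  obtains (row) s p where "s \<le> t" "p < K" "i = s * K + p"
    | (beyond) "Suc t * K \<le> i"
proof (cases "i < Suc t * K")
  case True
  then have "i div K < Suc t" by (simp add: less_mult_imp_div_less)
  then show ?thesis using row[of "i div K" "i mod K"] assms by simp
next
  case False
  then show ?thesis using beyond by simp
qed

lemma history_hok:
  assumes "0 < K"
  shows "hok (Some (history c t K i)) (history c t K (Suc i))"
proof (cases "Suc i < Suc t * K")
  case False
  then have "history c t K (Suc i) = Dollar" unfolding history_def by simp
  then show ?thesis by simp
next
  case True
  then obtain s p where s: "s \<le> t" "p < K" "i = s * K + p"
    using history_cases[OF assms, of t i] by (metis Suc_lessD linorder_not_less)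
  obtain k \<rho> where k: "cfg c s = (k, \<rho>)" by fastforce
  show ?thesis
  proof (cases "Suc p < K")
    case True
    then have "history c t K (Suc i) = cell (cfg c s) (Suc p)"
      using history_cell[OF s(1) True] s(3) by simp
    moreover have "history c t K i = cell (cfg c s) p"
      using history_cell[OF s(1,2)] s(3) by simp
    ultimately show ?thesis using k by simp
  next
    case False
    then have i: "Suc i = Suc s * K + 0" using s by simp
    then have "Suc s \<le> t" using True by (metis Suc_leI add_0_right mult_less_cancel2 not_less_eq)
    from history_cell[OF this assms, of c, folded i]
    have "history c t K (Suc i) = cell (cfg c (Suc s)) 0" .
    moreover have "history c t K i = cell (cfg c s) p"
      using history_cell[OF s(1,2)] s(3) by simp
    moreover obtain k' \<rho>' where "cfg c (Suc s) = (k', \<rho>')" by fastforce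
    ultimately show ?thesis using k by simp
  qed
qed

text \<open>The local rules reproduce \<open>step\<close> on rows that have a successor. Below the
  halted row there is only \<open>Dollar\<close>, and its first cell passes because register 1 is
  0.\<close>

lemma history_vok:
  assumes n: "2 \<le> n" "regs_below n P" and K: "\<And>s r. s \<le> t \<Longrightarrow> r < n \<Longrightarrow> snd (cfg c s) r < K"
    and run: "\<And>s. s < t \<Longrightarrow> fst (cfg c s) \<noteq> []" and halt: "fst (cfg c t) = []" "snd (cfg c t) 1 = 0"
  shows "vok n (if i = 0 then None else Some (history c t K (i - 1))) (history c t K i)
     (history c t K (i + 1)) (history c t K (i + K))"
proof -
  let ?V = "history c t K"
  have K0: "0 < K" using K[of 0 0] n(1) by simp
  show ?thesis
    using K0
  proof (cases rule: history_cases[of K t i])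
    case beyond
    then have "?V i = Dollar" unfolding history_def by simp
    then show ?thesis by simp
  next
    case (row s p)
    obtain k \<rho> where k: "cfg c s = (k, \<rho>)" by fastforce
    have y: "?V i = cell (k, \<rho>) p" using history_cell[OF row(1,2)] row(3) k by metis
    show ?thesis
    proof (cases k)
      case Nil
      have "s = t" using run[of s] row(1) k Nil by (cases "s = t") auto
      have "vok n x (cell ([], \<rho>) p) z (?V (i + K))" for x z
      proof (cases "p = 0")
        case True
        have "?V (i + K) = Dollar" unfolding history_def using row(3) \<open>s = t\<close> by simp
        moreover have "\<rho> 1 = 0" using halt(2) k \<open>s = t\<close> by simp
        ultimately show ?thesis using True n(1) by simp
      qed simp
      then show ?thesis unfolding y Nil by blast
    next
      case (Cons j k')
      then have "s \<noteq> t" using halt(1) k by auto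
      then have s: "Suc s \<le> t" using row(1) by simp
      have b: "regs_below n (j # k')" using cfg_regs_below[OF n(2), of c s] k Cons by simp
      have bd: "\<forall>r<n. \<rho> r < K" using K[OF row(1)] k by simp
      have next_row: "?V (Suc s * K + p') = cell (step (j # k', \<rho>)) p'" if "p' < K" for p'
        using history_cell[OF s that, of c] k Cons by (simp only: cfg_Suc)
      have z: "p + 1 < K \<Longrightarrow> ?V (i + 1) = cell (j # k', \<rho>) (p + 1)"
        using history_cell[OF row(1), of "p + 1" K c] row(3) k Cons by (simp del: cell.simps)
      have z': "is_start (?V (i + 1))" if "p + 1 = K"
      proof -
        have "i + 1 = Suc s * K + 0" using that row(3) by simp
        then show ?thesis using next_row[OF K0] by (simp del: cell.simps)
      qed
      have x: "0 < p \<Longrightarrow> (if i = 0 then None else Some (?V (i - 1))) = Some (cell (j # k', \<rho>) (p - 1))"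
      proof -
        assume p: "0 < p"
        then have "i - 1 = s * K + (p - 1)" "i \<noteq> 0" "p - 1 < K" using row by simp_all
        then show ?thesis using history_cell[OF row(1) \<open>p - 1 < K\<close>, of c] k Cons by (simp del: cell.simps)
      qed
      have tok: "filter (moved j (if i = 0 then None else Some (?V (i - 1))) (p = 0) (filter (\<lambda>r. \<rho> r = p) [0..<n]) (?V (i + 1))) [0..<n] =
          filter (\<lambda>r. snd (step (j # k', \<rho>)) r = p) [0..<n]"
        using moved_cell[OF b bd row(2) x z z'] .
      have no: "\<not> overflow j (filter (\<lambda>r. \<rho> r = p) [0..<n]) (?V (i + 1))"
      proof (cases j)
        case (Inc r)
        show ?thesis
        proof
          assume "overflow j (filter (\<lambda>r. \<rho> r = p) [0..<n]) (?V (i + 1))"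
          then have o: "r < n" "\<rho> r = p" "is_start (?V (i + 1))" using Inc by auto
          then have "\<not> p + 1 < K" using z by (auto simp del: cell.simps)
          \<comment> \<open>The bound is applied one step later: a token pushed out of this row
            would be a register of value \<open>K\<close> at time \<open>Suc s\<close>.\<close>
          moreover have "Suc (\<rho> r) < K" using K[OF s o(1)] k Cons Inc by (simp add: cfg_Suc)
          ultimately show False using o(2) by simp
        qed
      qed auto
      have "i + K = Suc s * K + p" using row(3) by simp
      then have y': "?V (i + K) = cell (step (j # k', \<rho>)) p" using next_row[OF row(2)] by (simp only:)
      obtain k'' \<rho>' where st: "step (j # k', \<rho>) = (k'', \<rho>')" by fastforce
      have "p = 0 \<Longrightarrow> k'' = follow j k' (filter (\<lambda>r. \<rho> r = p) [0..<n])"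
        using follow_cell[OF b, of \<rho>] st by simp
      then show ?thesis
        unfolding y Cons vok_cell y' tok st using no by simp
    qed
  qed
qed

lemma hchain_history:
  assumes "0 < K"
  shows "hchain None (map (history c t K) [0..<m])"
proof -
  have "hchain (Some (history c t K a)) (map (history c t K) [Suc a..<a + b])" for a b
  proof (induction b arbitrary: a)
    case (Suc b)
    show ?case
    proof (cases b)
      case (Suc b')
      then have "[Suc a..<a + Suc b] = Suc a # [Suc (Suc a)..<Suc a + b]" by (simp add: upt_conv_Cons del: upt_Suc)
      then show ?thesis using Suc.IH[of "Suc a"] history_hok[OF assms] by simp
    qed simp
  qed simp
  from this[of 0 m] have "hchain (Some (history c t K 0)) (map (history c t K) [Suc 0..<m])" by simp
  moreover have "hok None (history c t K 0)" using history_not_Hash by (cases "history c t K 0") auto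
  ultimately show ?thesis by (cases m) (simp_all add: upt_conv_Cons del: upt_Suc)
qed

text \<open>States up to \<open>N\<close> count the ticks. The count may stop at \<open>N\<close>
  because from index \<open>N\<close> on only \<open>Dollar\<close> is written. State
  \<open>N + 1\<close> ends the input \<open>[0, 1]\<close> and has no successor;
  \<open>N + 2\<close> silently absorbs the ticks after a later mark.\<close>

definition writer_step :: "(nat \<Rightarrow> letter) \<Rightarrow> nat \<Rightarrow> nat \<Rightarrow> nat \<Rightarrow> nat \<Rightarrow> (nat list \<times> nat) option" where
  "writer_step V K N q a =
    (if a = 0 then
       (if q = 0 then Some (map (\<lambda>i. code (V i)) [0..<K], 1)
        else if q \<le> N then Some ([code (V (K + q - 1))], min (Suc q) N)
        else if q = N + 2 then Some ([], N + 2) else None)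
     else if a = 1 then
       (if q = 1 then Some ([code Hash], N + 1)
        else if 2 \<le> q \<and> q \<le> N then Some ([code Hash], N + 2) else None)
     else None)"

text \<open>State 0 is not final, since the empty input is outside the domain. All final outputs are
  empty: \<open>Hash\<close> is written on the mark itself.\<close>

definition writer :: "(nat \<Rightarrow> letter) \<Rightarrow> nat \<Rightarrow> nat \<Rightarrow> sst" where
  "writer V K N = ({0..N + 2}, 0, writer_step V K N, {1..N + 2}, \<lambda>_. [])"

definition writer_outs :: "(nat \<Rightarrow> letter) \<Rightarrow> nat \<Rightarrow> nat \<Rightarrow> nat list list" where
  "writer_outs V K m = map (\<lambda>i. code (V i)) [0..<K] # map (\<lambda>i. [code (V (K + i))]) [0..<m]"

lemma concat_writer_outs: "concat (writer_outs V K m) = map code (map V [0..<K + m])"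
  unfolding writer_outs_def by (induction m) auto

lemma length_writer_outs: "map length (writer_outs V K m) = K # replicate m 1"
  unfolding writer_outs_def by (simp add: comp_def map_replicate_const)

lemma writer_ticks:
  assumes "2 \<le> N" "1 \<le> K" "\<And>i. N \<le> i \<Longrightarrow> V i = Dollar"
  shows "outs (writer_step V K N) 0 (replicate (Suc m) 0) = Some (writer_outs V K m, min (Suc m) N)"
proof (induction m)
  case 0
  then show ?case using assms(1) by (simp add: writer_step_def writer_outs_def)
next
  case (Suc m)
  have r: "replicate (Suc (Suc m)) (0::nat) = replicate (Suc m) 0 @ [0]" by (metis replicate_Suc replicate_append_same)
  have "V (K + min (Suc m) N - 1) = V (K + m)"
  proof (cases "Suc m \<le> N")
    case False
    then have "V (K + min (Suc m) N - 1) = Dollar" "V (K + m) = Dollar" using assms by simp_all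
    then show ?thesis by simp
  qed simp
  then have "writer_step V K N (min (Suc m) N) 0 = Some ([code (V (K + m))], min (Suc (Suc m)) N)"
    using assms(1) unfolding writer_step_def by auto
  moreover have "writer_outs V K (Suc m) = writer_outs V K m @ [[code (V (K + m))]]"
    by (simp add: writer_outs_def)
  ultimately show ?case unfolding r outs_append Suc by simp
qed

lemma writer_late: "outs (writer_step V K N) (N + 2) (replicate l 0) = Some (replicate l [], N + 2)"
  by (induction l) (simp_all add: writer_step_def)

lemma writer_init:
  "outs (writer_step V K N) 0 [0, 1] = Some (writer_outs V K 0 @ [[code Hash]], N + 1)"
  by (simp add: writer_step_def writer_outs_def)

lemma writer_mark:
  assumes "2 \<le> N" "1 \<le> K" "\<And>i. N \<le> i \<Longrightarrow> V i = Dollar"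
  shows "outs (writer_step V K N) 0 (replicate (Suc (Suc m)) 0 @ 1 # replicate l 0) =
    Some (writer_outs V K (Suc m) @ [code Hash] # replicate l [], N + 2)"
proof -
  have "writer_step V K N (min (Suc (Suc m)) N) 1 = Some ([code Hash], N + 2)"
    using assms(1) unfolding writer_step_def by simp
  moreover have "outs (writer_step V K N) 0 (replicate (Suc (Suc m)) 0) = Some (writer_outs V K (Suc m), min (Suc (Suc m)) N)"
    by (rule writer_ticks[OF assms])
  ultimately show ?thesis
    by (simp only: outs_append outs.simps(2) writer_late option.case prod.case)
qed

lemma writer_dom:
  assumes N: "2 \<le> N" "1 \<le> K" "\<And>i. N \<le> i \<Longrightarrow> V i = Dollar"
    and o: "outs (writer_step V K N) 0 u = Some (vs, p)" "u \<noteq> []"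
  shows "(\<exists>m. u = replicate (Suc m) 0) \<or> u = [0, 1] \<or> (\<exists>m l. u = replicate (Suc (Suc m)) 0 @ 1 # replicate l 0)"
proof -
  have ltr: "set u \<subseteq> {0, 1}" if "outs (writer_step V K N) q u = Some (vs, p)" for q u vs p
    using that
  proof (induction u arbitrary: q vs)
    case (Cons a u)
    then obtain w q' vs' where "writer_step V K N q a = Some (w, q')" "outs (writer_step V K N) q' u = Some (vs', p)"
      by (auto split: option.splits)
    moreover have "a \<in> {0, 1}"
    proof (rule ccontr)
      assume "a \<notin> {0, 1}"
      then have "writer_step V K N q a = None" unfolding writer_step_def by simp
      then show False using calculation by simp
    qed
    ultimately show ?case using Cons.IH by simp
  qed simp
  have rep: "set w \<subseteq> {0, 1} \<Longrightarrow> 1 \<notin> set w \<Longrightarrow> w = replicate (length w) 0" for w :: "nat list"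
    by (induction w) auto
  show ?thesis
  proof (cases "1 \<in> set u")
    case False
    then have u: "u = replicate (length u) 0" using ltr[OF o(1)] rep by blast
    moreover obtain m where "length u = Suc m" using o(2) by (cases u) auto
    ultimately show ?thesis by metis
  next
    case True
    then obtain x w where u: "u = x @ 1 # w" "1 \<notin> set x" by (meson split_list_first)
    then have x: "x = replicate (length x) 0" using ltr[OF o(1)] rep by auto
    consider "length x = 0" | "length x = 1" | m where "length x = Suc (Suc m)"
      by (metis One_nat_def not0_implies_Suc)
    then show ?thesis
    proof cases
      case 1
      then have "writer_step V K N 0 1 \<noteq> None" using o(1) u by (auto split: option.splits)
      then show ?thesis by (simp add: writer_step_def)
    next
      case 2
      then have x1: "x = [0]" using x by simp
      then obtain ws where "outs (writer_step V K N) (N + 1) w = Some (ws, p)"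
        using o(1) u by (auto simp: writer_step_def split: option.splits)
      then have "w = []" using N(1) by (cases w) (auto simp: writer_step_def split: option.splits if_splits)
      then show ?thesis using x1 u by simp
    next
      case (3 m)
      have "writer_step V K N (min (Suc (Suc m)) N) 1 = Some ([code Hash], N + 2)"
        using N(1) unfolding writer_step_def by simp
      moreover have "outs (writer_step V K N) 0 (replicate (Suc (Suc m)) 0 @ 1 # w) = Some (vs, p)"
        using o(1) u(1) x 3 by metis
      moreover have "outs (writer_step V K N) 0 (replicate (Suc (Suc m)) 0) = Some (writer_outs V K (Suc m), min (Suc (Suc m)) N)"
        by (rule writer_ticks[OF N])
      ultimately have e: "outs (writer_step V K N) (N + 2) w = None \<Longrightarrow> False"
        and e': "outs (writer_step V K N) (N + 2) w = Some (ws, r) \<Longrightarrow> r = p" for ws r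
        by (simp_all only: outs_append outs.simps(2) option.case prod.case option.inject prod.inject option.distinct)
      obtain ws where w: "outs (writer_step V K N) (N + 2) w = Some (ws, p)"
        using e e' by (cases "outs (writer_step V K N) (N + 2) w") auto
      have "1 \<notin> set w"
        using w
      proof (induction w arbitrary: ws)
        case (Cons a w)
        then show ?case by (auto simp: writer_step_def split: option.splits if_splits)
      qed simp
      then have "w = replicate (length w) 0" using ltr[OF w] rep by blast
      then show ?thesis using u(1) x 3 by metis
    qed
  qed
qed

lemma writer_uniformizes:
  assumes n: "2 \<le> n" "regs_below n P"
    and halt: "fst (cfg (code_trans base) t) = []" "snd (cfg (code_trans base) t) 1 = 0"
  shows "\<exists>T. sst_wf {0, 1} (set (out_letters (code_trans base))) T \<and>
    controlled {0, 1} (nfa_lang pace_nfa) T \<and> uniformizes T rel"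
proof -
  let ?c = "code_trans base"
  \<comment> \<open>The least halting time ensures that every row before the last one has a command
    to execute, as \<open>history_vok\<close> requires.\<close>
  define h where "h = (LEAST s. fst (cfg ?c s) = [])"
  have h: "fst (cfg ?c h) = []" unfolding h_def using halt(1) by (rule LeastI)
  have run: "fst (cfg ?c s) \<noteq> []" if "s < h" for s
    using that unfolding h_def by (rule not_less_Least)
  have h1: "snd (cfg ?c h) 1 = 0" using cfg_halted_unique[OF h halt(1)] halt(2) by simp
  \<comment> \<open>Only finitely many values occur up to the halting time, so some lag exceeds them
    all.\<close>
  have "finite ((\<lambda>(s, r). snd (cfg ?c s) r) ` ({..h} \<times> {..<n}))" by simp
  then obtain K where "\<forall>x\<in>(\<lambda>(s, r). snd (cfg ?c s) r) ` ({..h} \<times> {..<n}). x < K"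
    unfolding finite_nat_set_iff_bounded by blast
  then have K: "snd (cfg ?c s) r < K" if "s \<le> h" "r < n" for s r
    using that by auto
  have Kc: "Suc ?c < K" using K[of 0 0] n(1) by (simp add: cfg_0)
  then have K1: "1 \<le> K" "0 < K" by simp_all
  obtain i where Ki: "K = ?c + 2 + i" using Kc by (metis Suc_leI add_2_eq_Suc' le_Suc_ex)
  define V where "V = history ?c h K"
  define N where "N = Suc h * K"
  have "K \<le> N" by (simp add: N_def)
  then have N: "2 \<le> N" "1 \<le> K" using Kc by simp_all
  have dollar: "V i = Dollar" if "N \<le> i" for i using that unfolding V_def history_def N_def by simp
  note W = N dollar
  let ?S = "writer_step V K N"
  let ?\<Gamma> = "set (out_letters ?c)"
  have V_letters: "V i \<in> letters" for i unfolding V_def using history_letters[OF n(1)] .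
  have \<Gamma>: "code l \<in> ?\<Gamma>" if "l \<in> letters" for l using letters_le_code[OF n(1)] that by blast
  have VG: "code (V i) \<in> ?\<Gamma>" "code Hash \<in> ?\<Gamma>" for i
    using \<Gamma> V_letters cell_letters(4)[OF n(1)] by blast+
  have G01: "?\<Gamma> \<inter> {0, 1} = {}" by (auto simp: set_out_letters)
  have chain: "hchain None (map V [0..<m])" for m unfolding V_def using hchain_history[OF K1(2)] .
  have noH: "Hash \<notin> set (map V [0..<m])" for m unfolding V_def using history_not_Hash by (metis (no_types, lifting) ex_map_conv)
  have Vl: "set (map V [0..<m]) \<subseteq> letters" for m using V_letters by auto

  have wf: "sst_wf {0, 1} ?\<Gamma> (writer V K N)"
    unfolding sst_wf_def writer_def prod.case
  proof (intro conjI allI impI ballI)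
    fix q a v p assume s: "?S q a = Some (v, p)"
    show "q \<in> {0..N + 2}" "a \<in> {0, 1}" "set v \<subseteq> ?\<Gamma>" "p \<in> {0..N + 2}"
      using s VG N by (auto simp: writer_step_def split: if_splits)
  qed auto

  have tick_rel: "(replicate (Suc m) 0, concat (writer_outs V K m)) \<in> rel" for m
  proof -
    have "1 \<le> Suc m" by simp
    moreover have "Suc m \<le> length (map V [0..<K + m])" using K1 by simp
    ultimately show ?thesis
      unfolding concat_writer_outs using rel_ticks[OF n(1), of "Suc m"] chain Vl by blast
  qed
  have row: "map V [0..<K] = start0 # replicate ?c blank @ mark0 # replicate i blank"
  proof -
    have "V p = cell (cfg ?c 0) p" if "p < K" for p
      using history_cell[of 0 h p K ?c] that unfolding V_def by (simp del: cell.simps)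
    then have "map V [0..<K] = map (cell (cfg ?c 0)) [0..<K]" by simp
    then show ?thesis using initial_row[OF n(1), of ?c i, folded Ki] by (simp only:)
  qed
  have init_rel: "([0, 1], concat (writer_outs V K 0) @ [code Hash]) \<in> rel"
  proof -
    have "concat (writer_outs V K 0) @ [code Hash] = map code (map V [0..<K] @ [Hash])"
      unfolding concat_writer_outs by simp
    also have "\<dots> = map code (start0 # replicate ?c blank @ mark0 # replicate i blank @ [Hash])"
      unfolding row by simp
    finally show ?thesis unfolding rel_init[OF n(1)] by blast
  qed
  have vok: "vok n (if i = 0 then None else Some (V (i - 1))) (V i) (V (i + 1)) (V (i + K))" for i
    unfolding V_def using history_vok[OF n K run h h1] .
  have mark_rel: "(replicate (Suc (Suc m)) 0 @ 1 # replicate l 0, concat (writer_outs V K (Suc m)) @ [code Hash]) \<in> rel" for m l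
  proof -
    let ?vs = "map V [0..<K + Suc m]"
    have nth: "?vs ! k = V k" if "k < K + Suc m" for k
      using that nth_map_upt[of k "K + Suc m" 0 V] by (simp del: upt_Suc)
    have "marked (Suc (Suc m)) l ?vs"
      unfolding marked_def
    proof (intro conjI impI)
      show "Hash \<notin> set ?vs" by (rule noH)
      show "Suc (Suc m) < length ?vs" using Kc by simp
      have "take (Suc (Suc m)) ?vs = map V [0..<Suc (Suc m)]"
        using Kc by (simp add: take_map del: upt_Suc)
      then show "hchain None (take (Suc (Suc m)) ?vs)" using chain by (simp only:)
      have "vok n (if m = 0 then None else Some (V (m - 1))) (V m) (V (m + 1)) (V (m + K))" by (rule vok)
      moreover have "last ?vs = V (m + K)" by (simp add: add.commute)
      moreover have "nth_last 3 (take (Suc (Suc m)) ?vs) = (if m = 0 then None else Some (V (m - 1)))"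
      proof -
        have "length (take (Suc (Suc m)) ?vs) = Suc (Suc m)" using Kc by (simp del: upt_Suc)
        moreover have "take (Suc (Suc m)) ?vs ! (m - 1) = V (m - 1)"
          using nth[of "m - 1"] by (simp del: upt_Suc)
        ultimately show ?thesis unfolding nth_last_def by (cases m) (simp_all del: upt_Suc take_map)
      qed
      moreover have "?vs ! (Suc (Suc m) - 2) = V m" "?vs ! (Suc (Suc m) - 1) = V (m + 1)"
        using nth[of m] nth[of "Suc m"] Kc by (simp_all del: upt_Suc)
      ultimately show "vok n (nth_last 3 (take (Suc (Suc m)) ?vs)) (?vs ! (Suc (Suc m) - 2)) (?vs ! (Suc (Suc m) - 1)) (last ?vs)"
        by (simp only:)
    qed
    moreover have "concat (writer_outs V K (Suc m)) @ [code Hash] = map code (?vs @ [Hash])"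
      unfolding concat_writer_outs by (simp del: upt_Suc)
    moreover have "2 \<le> Suc (Suc m)" by simp
    ultimately show ?thesis using rel_mark[OF n(1), of "Suc (Suc m)" l] Vl by blast
  qed

  \<comment> \<open>Soundness and control are proved together, as both follow from the same list of
    accepting runs.\<close>
  have key: "(u, concat vs) \<in> rel \<and> paced (map length vs) \<and> set u \<subseteq> {0, 1}"
    if o: "outs ?S 0 u = Some (vs, p)" "p \<in> {1..N + 2}" for u vs p
  proof -
    have "u \<noteq> []" using o by auto
    from writer_dom[OF W o(1) this] consider m where "u = replicate (Suc m) 0" | "u = [0, 1]"
      | m l where "u = replicate (Suc (Suc m)) 0 @ 1 # replicate l 0" by blast
    then show ?thesis
    proof cases
      case (1 m)
      have "outs ?S 0 u = Some (writer_outs V K m, min (Suc m) N)"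
        unfolding 1 by (rule writer_ticks[OF W])
      then have vs: "vs = writer_outs V K m" using o(1) by simp
      have "paced (map length vs)"
        unfolding vs length_writer_outs paced_def
        using K1 by (intro exI[of _ "K - 1"] exI[of _ m] exI[of _ 0]) simp
      then show ?thesis using tick_rel[of m] 1 vs by (auto simp del: replicate_Suc)
    next
      case 2
      then have vs: "vs = writer_outs V K 0 @ [[code Hash]]" using o(1) writer_init by simp
      have "map length vs = Suc (K - 1) # replicate 1 1 @ replicate 0 0"
        unfolding vs map_append length_writer_outs using K1 by simp
      then have "paced (map length vs)" unfolding paced_def by (intro exI)
      then show ?thesis using init_rel 2 vs by simp
    next
      case (3 m l)
      have "outs ?S 0 u = Some (writer_outs V K (Suc m) @ [code Hash] # replicate l [], N + 2)"
        unfolding 3 by (rule writer_mark[OF W])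
      then have vs: "vs = writer_outs V K (Suc m) @ [code Hash] # replicate l []" using o(1) by simp
      have "map length vs = Suc (K - 1) # replicate (Suc (Suc m)) 1 @ replicate l 0"
        unfolding vs map_append length_writer_outs using K1 by (simp add: replicate_app_Cons_same)
      then have "paced (map length vs)" unfolding paced_def by (intro exI)
      moreover have "concat vs = concat (writer_outs V K (Suc m)) @ [code Hash]" unfolding vs by simp
      moreover have "set u \<subseteq> {0, 1}" unfolding 3 by auto
      ultimately show ?thesis using mark_rel[of m l] 3 by (simp only: simp_thms)
    qed
  qed
  have ctrl: "controlled {0, 1} (nfa_lang pace_nfa) (writer V K N)"
    unfolding controlled_def
  proof
    fix x assume "x \<in> hmor {0, 1} ` sst_sync (writer V K N)"
    then obtain u vs p where o: "outs ?S 0 u = Some (vs, p)" "p \<in> {1..N + 2}"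
      and x: "x = hmor {0, 1} (concat (map2 (#) u vs))"
      unfolding writer_def sst_sync_outs by auto
    have "length u = length vs" using outs_length[OF o(1)] by simp
    moreover have "set v \<inter> {0, 1} = {}" if v: "v \<in> set vs" for v
    proof -
      have "(u, concat vs) \<in> rel" using key[OF o] by blast
      then obtain ls where "concat vs = map code ls" unfolding rel_iff[OF n(1)] by blast
      then have "set (concat vs) = code ` set ls" by (simp only: set_map)
      then have "set (concat vs) \<subseteq> range code" by blast
      then have "set v \<subseteq> range code" using v by auto
      then show ?thesis using code_neq by fastforce
    qed
    ultimately have "x = blocks (map length vs)" unfolding x using key[OF o] by (intro hmor_blocks) auto
    then show "x \<in> nfa_lang pace_nfa" using key[OF o] by (simp add: blocks_in_pace)
  qed
  have val: "sst_fun (writer V K N) u = Some v \<longleftrightarrow> (\<exists>vs p. outs ?S 0 u = Some (vs, p) \<and> p \<in> {1..N + 2} \<and> v = concat vs)" for u v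
    unfolding writer_def sst_fun_outs by simp
  have sound: "(u, v) \<in> rel" if "sst_fun (writer V K N) u = Some v" for u v
    using that key unfolding val by blast
  have "\<exists>v. sst_fun (writer V K N) u = Some v" if "u \<in> Domain rel" for u
  proof -
    from that obtain v where "(u, v) \<in> rel" by blast
    from rel_dom[OF n(1) this] consider m where "1 \<le> m" "u = replicate m 0" | "u = [0, 1]"
      | j l where "2 \<le> j" "u = replicate j 0 @ 1 # replicate l 0" by blast
    then have "\<exists>vs p. outs ?S 0 u = Some (vs, p) \<and> p \<in> {1..N + 2}"
    proof cases
      case (1 m)
      then obtain m' where m: "m = Suc m'" by (cases m) auto
      have "outs ?S 0 u = Some (writer_outs V K m', min (Suc m') N)"
        unfolding 1 m by (rule writer_ticks[OF W])
      then show ?thesis using N by auto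
    next
      case 2
      then show ?thesis using writer_init by auto
    next
      case (3 j l)
      then obtain m where m: "j = Suc (Suc m)" by (metis One_nat_def Suc_1 Suc_le_D Suc_le_mono)
      have "outs ?S 0 u = Some (writer_outs V K (Suc m) @ [code Hash] # replicate l [], N + 2)"
        unfolding 3 m by (rule writer_mark[OF W])
      then show ?thesis by auto
    qed
    then show ?thesis unfolding val by blast
  qed
  then have "uniformizes (writer V K N) rel"
    unfolding uniformizes_def dom_def using sound by blast
  then show ?thesis using wf ctrl by blast
qed

lemma uniformizable_iff:
  assumes n: "2 \<le> n" "regs_below n P" and halt: "fst (cfg (code_trans base) t) = []"
  shows "controlled_uniformizable (inst pace_nfa base) \<longleftrightarrow> snd (cfg (code_trans base) t) 1 = 0"
proof -
  have 01: "set [0, 1] = {0, 1::nat}" by simp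
  have "controlled_uniformizable (inst pace_nfa base) \<longleftrightarrow>
      (\<exists>T. sst_wf {0, 1} (set (out_letters (code_trans base))) T \<and>
        controlled {0, 1} (nfa_lang pace_nfa) T \<and> uniformizes T rel)"
    unfolding controlled_uniformizable_def inst_def prod.case rel_def 01 ..
  also have "\<dots> \<longleftrightarrow> snd (cfg (code_trans base) t) 1 = 0"
    using uniformizer_accepts[OF n _ _ _ halt] writer_uniformizes[OF n halt] cfg_halted_unique[OF halt] by metis
  finally show ?thesis .
qed

end

section \<open>Undecidability\<close>

theorem mainTheorem6:
  shows "\<not> decidable_on enc_instance valid_instance controlled_uniformizable"
proof
  assume "decidable_on enc_instance valid_instance controlled_uniformizable"
  then obtain f where f: "\<And>x. valid_instance x \<Longrightarrow> eval f [enc_instance x] (if controlled_uniformizable x then 1 else 0)"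
    unfolding decidable_on_def by blast
  have comp: "compilable (Comp f [inst_rf pace_nfa])" by (rule all_compilable)
  \<comment> \<open>The input is in register 0 and the result goes to register 1, the register that
    \<open>vok\<close> inspects in a halted row; scratch space starts at 2.\<close>
  obtain p where p: "\<And>\<rho> y. \<rho> 1 = 0 \<Longrightarrow> \<forall>r\<ge>2. \<rho> r = 0 \<Longrightarrow>
      eval (Comp f [inst_rf pace_nfa]) (map \<rho> [0]) y \<Longrightarrow> exec p \<rho> (\<rho>(1 := y))"
    by (rule compilableD[OF comp, of 1 2 "[0]"]) auto
  \<comment> \<open>The leading command removes the extra one from the planted value.\<close>
  define P where "P = Dec 0 # p"
  obtain m where "regs_below m P" using regs_below_exists by blast
  define n where "n = max 2 m"
  have n: "2 \<le> n" "regs_below n P"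
    using regs_below_mono[OF \<open>regs_below m P\<close>, of n] by (simp_all add: n_def)
  \<comment> \<open>There is no circularity: the program is fixed before the list of transitions and
    meets its code only as an input value.\<close>
  let ?T = "game.base P n"
  let ?c = "code_trans ?T" and ?x = "inst pace_nfa ?T"
  define b :: nat where "b = (if controlled_uniformizable ?x then 1 else 0)"
  have "eval f [enc_instance ?x] b"
    unfolding b_def using f[OF game.inst_valid[OF n(1)]] .
  then have "eval (Comp f [inst_rf pace_nfa]) [?c] b" using eval_Comp1[OF eval_inst] by blast
  moreover define \<rho> :: "nat \<Rightarrow> nat" where "\<rho> = (\<lambda>r. if r = 0 then ?c else 0)"
  ultimately have "exec p \<rho> (\<rho>(1 := b))" by (intro p) simp_all
  then obtain i where "(step ^^ i) (p @ [], \<rho>) = ([], \<rho>(1 := b))" unfolding exec_def by blast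
  moreover have "step (P, \<lambda>r. if r = 0 then Suc ?c else 0) = (p, \<rho>)"
    by (auto simp: P_def \<rho>_def fun_eq_iff)
  ultimately have run: "game.cfg P ?c (Suc i) = ([], \<rho>(1 := b))"
    unfolding game.cfg_def by (simp add: funpow_swap1)
  \<comment> \<open>A uniformizing transducer exists exactly when register 1 ends with 0, but the
    program leaves there the supposedly correct answer \<open>b\<close>, which is 1 in that
    case.\<close>
  then have "controlled_uniformizable ?x \<longleftrightarrow> b = 0"
    using game.uniformizable_iff[OF n, of "Suc i"] by simp
  then show False by (simp add: b_def split: if_splits)
qed

end
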